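(* If $(G,X)$ is a contracting self-similar group, then the group $\mathcal{V}_G$ is finitely presented.
   Context: Let $X$ be a finite set with $d=|X|\ge 2$. $X^*$ denotes the set of finite words over $X$ (including the empty word), viewed as a rooted tree in which each word $v$ is joined to $vx$ for $x\in X$; $X^\omega$ is the space of right-infinite sequences $x_1x_2\ldots$ with the product topology. A complete antichain is a finite set $A\subset X^*$ of words, none a prefix of another, such that $X^\omega=\bigsqcup_{v\in A}vX^\omega$. A self-similar group $(G,X)$ is a group $G$ acting faithfully by automorphisms of the rooted tree $X^*$ (hence by homeomorphisms of $X^\omega$) such that for every $g\in G$ and $x\in X$ there exist $h\in G$, $y\in X$ with $g(xw)=yh(w)$ for all $w$. For $g\in G$ and $v\in X^*$ the section $g|_v\in G$ is the unique element with $g(vw)=g(v)g|_v(w)$ for all $w\in X^\omega$. $(G,X)$ is contracting if there is a finite set $\mathcal{N}\subset G$ such that for every $g\in G$ there is $n$ with $g|_v\in\mathcal{N}$ for all $v\in X^*$ with $|v|\ge n$. $\mathcal{V}_G$ is the group of all homeomorphisms $g$ of $X^\omega$ for which there exist complete antichains $A_1,A_2$, a bijection $\alpha:A_1\to A_2$ and elements $g_v\in G$ ($v\in A_1$) such that $g(vw)=\alpha(v)g_v(w)$ for all $v\in A_1$, $w\in X^\omega$. *)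

theory Defs
  imports "HOL-Analysis.Function_Topology" "HOL-Algebra.Group"
begin

text \<open>The alphabet X is a finite type 'x; finite words are 'x list, the space X^omega
  is nat => 'x with the product of discrete topologies.\<close>

definition word_prefix :: "'x list \<Rightarrow> 'x list \<Rightarrow> bool" where
  "word_prefix u v \<longleftrightarrow> (\<exists>w. v = u @ w)"

definition is_prefix_of_seq :: "'x list \<Rightarrow> (nat \<Rightarrow> 'x) \<Rightarrow> bool" where
  "is_prefix_of_seq v \<omega> \<longleftrightarrow> (\<forall>i<length v. \<omega> i = v ! i)"

definition conc :: "'x list \<Rightarrow> (nat \<Rightarrow> 'x) \<Rightarrow> (nat \<Rightarrow> 'x)" where
  "conc v w = (\<lambda>n. if n < length v then v ! n else w (n - length v))"

definition Xomega :: "(nat \<Rightarrow> 'x) topology" where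
  "Xomega = product_topology (\<lambda>_. discrete_topology UNIV) UNIV"

definition tree_aut :: "('x list \<Rightarrow> 'x list) \<Rightarrow> bool" where
  "tree_aut g \<longleftrightarrow> bij g \<and> (\<forall>v. length (g v) = length v)
      \<and> (\<forall>v w. word_prefix (g v) (g (v @ w)))"

definition act :: "('x list \<Rightarrow> 'x list) \<Rightarrow> (nat \<Rightarrow> 'x) \<Rightarrow> (nat \<Rightarrow> 'x)" where
  "act g \<omega> = (\<lambda>n. g (map \<omega> [0..<Suc n]) ! n)"

definition sect :: "('x list \<Rightarrow> 'x list) \<Rightarrow> 'x list \<Rightarrow> ('x list \<Rightarrow> 'x list)" where
  "sect g v = (\<lambda>w. drop (length v) (g (v @ w)))"

text \<open>A self-similar group: a group G of automorphisms of X^* (so the action is faithful)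
  with the self-similarity property.\<close>
definition self_similar :: "('x list \<Rightarrow> 'x list) set \<Rightarrow> bool" where
  "self_similar G \<longleftrightarrow>
     (\<forall>g\<in>G. tree_aut g) \<and> id \<in> G \<and> (\<forall>g\<in>G. \<forall>h\<in>G. g \<circ> h \<in> G) \<and> (\<forall>g\<in>G. Hilbert_Choice.inv g \<in> G)
     \<and> (\<forall>g\<in>G. \<forall>x. \<exists>h\<in>G. \<exists>y. \<forall>w. g (x # w) = y # h w)"

definition contracting :: "('x list \<Rightarrow> 'x list) set \<Rightarrow> bool" where
  "contracting G \<longleftrightarrow> (\<exists>N. finite N \<and> N \<subseteq> G \<and>
      (\<forall>g\<in>G. \<exists>n. \<forall>v. length v \<ge> n \<longrightarrow> sect g v \<in> N))"

definition complete_antichain :: "'x list set \<Rightarrow> bool" where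
  "complete_antichain A \<longleftrightarrow> finite A
     \<and> (\<forall>u\<in>A. \<forall>v\<in>A. word_prefix u v \<longrightarrow> u = v)
     \<and> (\<forall>\<omega>. \<exists>v\<in>A. is_prefix_of_seq v \<omega>)"

definition VG :: "('x list \<Rightarrow> 'x list) set \<Rightarrow> ((nat \<Rightarrow> 'x) \<Rightarrow> (nat \<Rightarrow> 'x)) set" where
  "VG G = {f. homeomorphic_map Xomega Xomega f \<and>
      (\<exists>A1 A2 \<alpha> gv. complete_antichain A1 \<and> complete_antichain A2 \<and> bij_betw \<alpha> A1 A2
         \<and> (\<forall>v\<in>A1. gv v \<in> G)
         \<and> (\<forall>v\<in>A1. \<forall>w. f (conc v w) = conc (\<alpha> v) (act (gv v) w)))}"

definition VG_group :: "('x list \<Rightarrow> 'x list) set \<Rightarrow> ((nat \<Rightarrow> 'x) \<Rightarrow> (nat \<Rightarrow> 'x)) monoid" where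
  "VG_group G = \<lparr>carrier = VG G, mult = (\<circ>), one = id\<rparr>"

text \<open>Words over generators: letters (i, True) = s_i, (i, False) = s_i^{-1}.
  Equivalence generated by free cancellation and by inserting/deleting relators.\<close>
inductive pres_eq :: "(nat \<times> bool) list set \<Rightarrow> (nat \<times> bool) list \<Rightarrow> (nat \<times> bool) list \<Rightarrow> bool"
  for R where
  refl: "pres_eq R w w"
| sym: "pres_eq R u v \<Longrightarrow> pres_eq R v u"
| trans: "pres_eq R u v \<Longrightarrow> pres_eq R v w \<Longrightarrow> pres_eq R u w"
| cancel: "pres_eq R (u @ [(i, b), (i, \<not> b)] @ v) (u @ v)"
| rel: "r \<in> R \<Longrightarrow> pres_eq R (u @ r @ v) (u @ v)"

definition word_eval :: "('a, 'b) monoid_scheme \<Rightarrow> 'a list \<Rightarrow> (nat \<times> bool) list \<Rightarrow> 'a" where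
  "word_eval H gens w =
     foldr (\<lambda>(i, b) acc. (if b then gens ! i else inv\<^bsub>H\<^esub> (gens ! i)) \<otimes>\<^bsub>H\<^esub> acc) w \<one>\<^bsub>H\<^esub>"

definition valid_word :: "nat \<Rightarrow> (nat \<times> bool) list \<Rightarrow> bool" where
  "valid_word k w \<longleftrightarrow> (\<forall>(i, b)\<in>set w. i < k)"

definition finitely_presented :: "('a, 'b) monoid_scheme \<Rightarrow> bool" where
  "finitely_presented H \<longleftrightarrow> group H \<and>
     (\<exists>gens R. set gens \<subseteq> carrier H \<and> finite R \<and> (\<forall>r\<in>R. valid_word (length gens) r)
        \<and> (\<forall>h\<in>carrier H. \<exists>w. valid_word (length gens) w \<and> word_eval H gens w = h)
        \<and> (\<forall>w. valid_word (length gens) w \<longrightarrow>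
               (word_eval H gens w = \<one>\<^bsub>H\<^esub> \<longleftrightarrow> pres_eq R w [])))"

end

theory Submission
  imports Defs
begin

text \<open>
  A basis is a finite set of charts, that is, of embeddings of $X^\omega$ into itself that act
  locally by words and elements of $G$, whose images partition $X^\omega$. The elements of
  $\mathcal V_G$ are the one-element bases, and $\mathcal V_G$ acts on all bases with finite
  stabilisers, transitively on the bases of a given size. Fix a finite nucleus $N$ closed under
  sections and inverses. Edges replace one chart $e$ by $e g$ with $g \in N$, or by the charts
  $e x h_x$ with $x \in X$ and $h_x \in N$; there are finitely many of them up to the action.

  Let $c$ assign to edges elements of a group such that all quadrilaterals of edges commute. If
  $c$ is given on the bases with at most $m$ charts and $m$ is large, it extends to those
  with $m + 1$ charts, because every cell of the larger complex is left untouched by merging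
  some $d$ charts that it does not involve, and merging lowers it. On the complex of all bases $c$ is
  trivial: contraction makes any finitely many bases refine, up to $N$, one and the same level of the tree.
  Hence the bases of bounded size form a simply connected complex on which $\mathcal V_G$ acts
  properly and cocompactly, and $\mathcal V_G$ is finitely presented.
\<close>

section \<open>Infinite sequences and tree automorphisms\<close>

text \<open>Contracting groups such as Grigorchuk's need not be finitely presented. So charts are
  kept as maps and not taken up to \<open>G\<close>: this makes stabilisers finite, and a twist by
  \<open>N\<close> becomes an edge of its own.

  No topological space is built. Simple connectedness is replaced by the statement that every
  cocycle, with values in any group, has a potential on each finite set of bases. The class
  \<open>group_add\<close> is written additively but is not commutative, so the order of summands
  matters throughout. Finite sets are enough because a relation between generators meets only
  finitely many bases, and the level of the tree into which they are refined may depend on them.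
  Taking for the target the group presented by the relations between products of two generators
  shows that all other relations follow from these. Generation is obtained in the same way one
  dimension lower, with functions constant along edges in place of cocycles.\<close>

lemma conc_Nil [simp]: "conc [] w = w"
  by (simp add: conc_def)

lemma conc_append: "conc (u @ v) w = conc u (conc v w)"
  by (auto simp: conc_def fun_eq_iff nth_append)

lemma conc_Cons: "conc (x # v) w = conc [x] (conc v w)"
  using conc_append[of "[x]" v w] by simp

lemma conc_same_length:
  assumes "length u = length u'" "conc u w = conc u' w'"
  shows "u = u' \<and> w = w'"
proof
  show "u = u'"
  proof (rule nth_equalityI)
    fix i assume "i < length u"
    then show "u ! i = u' ! i" using assms(1) fun_cong[OF assms(2), of i] unfolding conc_def by simp
  qed (use assms in simp)
  show "w = w'"
  proof
    fix i show "w i = w' i"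
      using fun_cong[OF assms(2), of "length u + i"] assms(1) unfolding conc_def by simp
  qed
qed

lemma conc_split: "\<exists>u w. length u = n \<and> \<omega> = conc u w"
  by (rule exI[of _ "map \<omega> [0..<n]"], rule exI[of _ "\<lambda>i. \<omega> (n + i)"]) (auto simp: conc_def fun_eq_iff)

lemma conc_comparable:
  assumes "conc u w = conc u' w'" "length u \<le> length u'"
  shows "\<exists>t. u' = u @ t \<and> w = conc t w'"
proof -
  have "conc u w = conc (take (length u) u') (conc (drop (length u) u') w')"
    using assms(1) by (metis append_take_drop_id conc_append)
  then have "u = take (length u) u' \<and> w = conc (drop (length u) u') w'"
    using conc_same_length assms(2) by (metis length_take min.absorb2)
  then show ?thesis by (metis append_take_drop_id)
qed

lemma map_conc_prefix: "map (conc v w) [0..<length v] = v"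
  by (rule nth_equalityI) (auto simp: conc_def)

lemma map_conc_upt: "map (conc v w) [0..<length v + k] = v @ map w [0..<k]"
  by (rule nth_equalityI) (auto simp: conc_def nth_append)

lemma tree_aut_append: "tree_aut g \<Longrightarrow> g (v @ w) = g v @ sect g v w"
proof -
  assume a: "tree_aut g"
  then obtain t where t: "g (v @ w) = g v @ t" unfolding tree_aut_def word_prefix_def by metis
  moreover have "length (g v) = length v" using a by (simp add: tree_aut_def)
  ultimately show ?thesis by (simp add: sect_def)
qed

lemma tree_aut_length: "tree_aut g \<Longrightarrow> length (g v) = length v"
  by (simp add: tree_aut_def)

text \<open>A tree automorphism respects prefixes, so letter \<open>n\<close> of the image can be
  read off from any prefix longer than \<open>n\<close>, not only from the shortest one used in
  \<open>act\<close>.\<close>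

lemma act_nth:
  assumes "tree_aut g" "n < m"
  shows "act g \<omega> n = g (map \<omega> [0..<m]) ! n"
proof -
  have "[0..<m] = [0..<Suc n] @ [Suc n..<m]"
    using upt_add_eq_append[of 0 "Suc n" "m - Suc n"] assms(2) by simp
  then have "g (map \<omega> [0..<m]) = g (map \<omega> [0..<Suc n]) @ sect g (map \<omega> [0..<Suc n]) (map \<omega> [Suc n..<m])"
    using tree_aut_append[OF assms(1)] by (metis map_append)
  moreover have "length (g (map \<omega> [0..<Suc n])) = Suc n"
    using tree_aut_length[OF assms(1)] by simp
  ultimately show ?thesis by (simp add: act_def nth_append del: upt_Suc)
qed

lemma map_act:
  assumes "tree_aut g"
  shows "map (act g \<omega>) [0..<m] = g (map \<omega> [0..<m])"
  by (rule nth_equalityI) (auto simp: act_nth[OF assms] tree_aut_length[OF assms])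

lemma act_comp:
  assumes "tree_aut g" "tree_aut h"
  shows "act (g \<circ> h) = act g \<circ> act h"
proof (intro ext)
  fix \<omega> n
  have "act (g \<circ> h) \<omega> n = g (map (act h \<omega>) [0..<Suc n]) ! n"
    unfolding map_act[OF assms(2)] by (simp add: act_def)
  then show "act (g \<circ> h) \<omega> n = (act g \<circ> act h) \<omega> n" by (simp add: act_def[of g])
qed

lemma act_id [simp]: "act id = id"
  by (auto simp: fun_eq_iff act_def nth_append)

lemma act_conc:
  assumes "tree_aut g"
  shows "act g (conc v w) = conc (g v) (act (sect g v) w)"
proof
  fix n
  note len = tree_aut_length[OF assms]
  show "act g (conc v w) n = conc (g v) (act (sect g v) w) n"
  proof (cases "n < length v")
    case True
    then show ?thesis
      using act_nth[OF assms True, of "conc v w"] len[of v] unfolding map_conc_prefix by (simp add: conc_def[of "g v"])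
  next
    case False
    then obtain k where k: "n = length v + k" by (metis le_iff_add linorder_not_less)
    have "act g (conc v w) n = g (v @ map w [0..<Suc k]) ! n"
      unfolding act_def k using map_conc_upt[of v w "Suc k"] by simp
    also have "\<dots> = sect g v (map w [0..<Suc k]) ! k"
      unfolding tree_aut_append[OF assms] using len[of v] by (simp add: nth_append k del: upt_Suc)
    finally show ?thesis using len[of v] by (simp add: conc_def act_def k del: upt_Suc)
  qed
qed

lemma sect_append: "sect g (u @ v) = sect (sect g u) v"
  by (auto simp: sect_def fun_eq_iff add.commute)

lemma sect_Nil [simp]: "sect g [] = g"
  by (simp add: sect_def)

lemma self_similar_sect:
  assumes "self_similar G" "g \<in> G"
  shows "sect g v \<in> G"
  using assms(2)
proof (induction v arbitrary: g)
  case (Cons x v)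
  obtain h y where h: "h \<in> G" "\<forall>w. g (x # w) = y # h w"
    using assms(1) Cons.prems unfolding self_similar_def by meson
  then have "sect g [x] = h" by (simp add: sect_def fun_eq_iff)
  then show ?case using Cons.IH[OF h(1)] sect_append[of g "[x]" v] by simp
qed simp

lemma sect_id [simp]: "sect id v = id"
  by (auto simp: sect_def fun_eq_iff)

lemma tree_aut_bij: "tree_aut g \<Longrightarrow> bij g"
  by (simp add: tree_aut_def)

section \<open>Splitting, twisting and merging charts\<close>

definition sub :: "((nat \<Rightarrow> 'x) \<Rightarrow> (nat \<Rightarrow> 'x)) \<Rightarrow> 'x \<Rightarrow> (nat \<Rightarrow> 'x) \<Rightarrow> (nat \<Rightarrow> 'x)" where
  "sub e x = e \<circ> conc [x]"

definition twist :: "((nat \<Rightarrow> 'x) \<Rightarrow> (nat \<Rightarrow> 'x)) \<Rightarrow> ('x list \<Rightarrow> 'x list) \<Rightarrow> (nat \<Rightarrow> 'x) \<Rightarrow> (nat \<Rightarrow> 'x)" where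
  "twist e g = e \<circ> act g"

text \<open>Inverse to splitting. The charts \<open>z x\<close> need not be adjacent in the tree, so
  any family indexed by the letters can be merged; this freedom makes downward moves
  abundant.\<close>

definition merge :: "('x \<Rightarrow> (nat \<Rightarrow> 'x) \<Rightarrow> (nat \<Rightarrow> 'x)) \<Rightarrow> (nat \<Rightarrow> 'x) \<Rightarrow> (nat \<Rightarrow> 'x)" where
  "merge z \<omega> = z (\<omega> 0) (\<lambda>n. \<omega> (Suc n))"

lemma sub_apply: "sub e x w = e (conc [x] w)"
  by (simp add: sub_def)

lemma twist_apply: "twist e g w = e (act g w)"
  by (simp add: twist_def)

lemma twist_id [simp]: "twist e id = e"
  by (simp add: twist_def)

lemma sub_merge [simp]: "sub (merge z) x = z x"
  by (auto simp: sub_def merge_def conc_def fun_eq_iff)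

lemma conc_hd_tl: "conc [\<omega> 0] (\<lambda>n. \<omega> (Suc n)) = \<omega>"
  by (auto simp: conc_def fun_eq_iff)

lemma merge_conc: "merge z (conc [x] w) = z x w"
  by (simp add: merge_def conc_def)

lemma conc_single_cases: obtains x w where "\<omega> = conc [x] w"
  by (metis conc_hd_tl)

text \<open>Simple connectedness of the complex of pairwise disjoint blocks: any two blocks, and any two paths
  of length two between them, have a common disjoint block.\<close>

lemma potential_of_disjointness:
  fixes \<kappa> :: "'z \<Rightarrow> 'z \<Rightarrow> 'k::group_add"
  assumes anti: "\<And>z w. z \<in> Z \<Longrightarrow> w \<in> Z \<Longrightarrow> dis z w \<Longrightarrow> \<kappa> w z = - \<kappa> z w"
    and tri: "\<And>x y z. x \<in> Z \<Longrightarrow> y \<in> Z \<Longrightarrow> z \<in> Z \<Longrightarrow> dis x y \<Longrightarrow> dis y z \<Longrightarrow> dis x z \<Longrightarrow> \<kappa> x y + \<kappa> y z = \<kappa> x z"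
    and sym: "\<And>z w. dis z w \<Longrightarrow> dis w z"
    and room: "\<And>x y z w. x \<in> Z \<Longrightarrow> y \<in> Z \<Longrightarrow> z \<in> Z \<Longrightarrow> w \<in> Z \<Longrightarrow>
                 \<exists>v\<in>Z. dis v x \<and> dis v y \<and> dis v z \<and> dis v w"
  shows "\<exists>a. \<forall>z\<in>Z. \<forall>w\<in>Z. dis z w \<longrightarrow> \<kappa> z w = - a z + a w"
proof (cases "Z = {}")
  case False
  then obtain o' where o: "o' \<in> Z" by blast
  have indep: "\<kappa> o' w + \<kappa> w z = \<kappa> o' v + \<kappa> v z"
    if zwv: "z \<in> Z" "w \<in> Z" "dis w o'" "dis w z" "v \<in> Z" "dis v o'" "dis v z" for z w v
  proof -
    obtain t where t: "t \<in> Z" "dis t o'" "dis t z" "dis t w" "dis t v"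
      using room[OF o zwv(1,2,5)] by blast
    have *: "\<kappa> o' p + \<kappa> p z = \<kappa> o' t + \<kappa> t z" if p: "p \<in> Z" "dis p o'" "dis p z" "dis t p" for p
    proof -
      have "\<kappa> o' t = \<kappa> o' p + \<kappa> p t" using tri[OF o p(1) t(1)] p t sym by metis
      moreover have "\<kappa> t z = - \<kappa> p t + \<kappa> p z"
        using tri[OF t(1) p(1) \<open>z \<in> Z\<close>] anti[OF p(1) t(1)] p t sym by metis
      ultimately show ?thesis by (simp add: add.assoc)
    qed
    show ?thesis using *[of w] *[of v] zwv t by simp
  qed
  define a where "a z = (let w = SOME w. w \<in> Z \<and> dis w o' \<and> dis w z in \<kappa> o' w + \<kappa> w z)" for z
  have a: "a z = \<kappa> o' w + \<kappa> w z" if "z \<in> Z" "w \<in> Z" "dis w o'" "dis w z" for z w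
  proof -
    let ?P = "\<lambda>w. w \<in> Z \<and> dis w o' \<and> dis w z"
    have "?P (SOME w. ?P w)" using someI[of ?P w] that by blast
    then show ?thesis unfolding a_def Let_def using indep that by blast
  qed
  have "\<kappa> z w = - a z + a w" if zw: "z \<in> Z" "w \<in> Z" "dis z w" for z w
  proof -
    obtain v where v: "v \<in> Z" "dis v o'" "dis v z" "dis v w" using room[OF o o zw(1,2)] by blast
    have "a z = \<kappa> o' v + \<kappa> v z" "a w = \<kappa> o' v + \<kappa> v w" using a v zw by auto
    moreover have "\<kappa> v z + \<kappa> z w = \<kappa> v w" using tri v zw by blast
    ultimately show ?thesis by (metis add.assoc minus_add_cancel)
  qed
  then show ?thesis by blast
qed simp

section \<open>Bases\<close>

text \<open>Closure under sections lets a twist pass through a splitting, and closure under inverses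
  lets an element of \<open>N\<close> be undone by a twist in \<open>N\<close>. A set that merely
  witnesses contraction may lack both; \<open>nucleus_exists\<close> enlarges it.\<close>

locale nucleus_group =
  fixes G N :: "('x::finite list \<Rightarrow> 'x list) set"
  assumes two: "card (UNIV :: 'x set) \<ge> 2"
    and self_sim: "self_similar G"
    and finite_N: "finite N"
    and N_sub: "N \<subseteq> G"
    and id_N: "id \<in> N"
    and N_inv: "g \<in> N \<Longrightarrow> Hilbert_Choice.inv g \<in> N"
    and N_sect: "g \<in> N \<Longrightarrow> sect g [x] \<in> N"
    and absorb: "g \<in> G \<Longrightarrow> \<exists>n. \<forall>v. length v \<ge> n \<longrightarrow> sect g v \<in> N"
begin

lemma G_tree_aut: "g \<in> G \<Longrightarrow> tree_aut g"
  using self_sim by (simp add: self_similar_def)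

lemma G_comp: "g \<in> G \<Longrightarrow> h \<in> G \<Longrightarrow> g \<circ> h \<in> G"
  using self_sim by (simp add: self_similar_def)

lemma G_inv: "g \<in> G \<Longrightarrow> Hilbert_Choice.inv g \<in> G"
  using self_sim by (simp add: self_similar_def)

lemma G_id: "id \<in> G"
  using self_sim by (simp add: self_similar_def)

lemma N_G: "g \<in> N \<Longrightarrow> g \<in> G"
  using N_sub by blast

lemma G_sect: "g \<in> G \<Longrightarrow> sect g v \<in> G"
  by (rule self_similar_sect[OF self_sim])

lemma act_inv_left: "g \<in> G \<Longrightarrow> act (Hilbert_Choice.inv g) (act g w) = w"
proof -
  assume g: "g \<in> G"
  have "Hilbert_Choice.inv g \<circ> g = id"
    using tree_aut_bij[OF G_tree_aut[OF g]] by (simp add: bij_is_inj)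
  then show ?thesis using act_comp[OF G_tree_aut[OF G_inv[OF g]] G_tree_aut[OF g]]
    by (metis act_id comp_apply id_apply)
qed

lemma act_inv_right: "g \<in> G \<Longrightarrow> act g (act (Hilbert_Choice.inv g) w) = w"
proof -
  assume g: "g \<in> G"
  have "g \<circ> Hilbert_Choice.inv g = id"
    using tree_aut_bij[OF G_tree_aut[OF g]] by (simp add: bij_is_surj fun_eq_iff surj_f_inv_f)
  then show ?thesis using act_comp[OF G_tree_aut[OF g] G_tree_aut[OF G_inv[OF g]]]
    by (metis act_id comp_apply id_apply)
qed

lemma act_inject: "g \<in> G \<Longrightarrow> act g w = act g w' \<longleftrightarrow> w = w'"
  by (metis act_inv_left)

definition lact :: "('x list \<Rightarrow> 'x list) \<Rightarrow> 'x \<Rightarrow> 'x" where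
  "lact g x = hd (g [x])"

lemma lact: "g \<in> G \<Longrightarrow> g [x] = [lact g x]"
  using tree_aut_length[OF G_tree_aut, of g "[x]"] unfolding lact_def
  by (cases "g [x]") auto

lemma bij_lact: "g \<in> G \<Longrightarrow> bij (lact g)"
proof -
  assume g: "g \<in> G"
  have "inj (lact g)"
  proof (rule injI)
    fix x y assume "lact g x = lact g y"
    then have "g [x] = g [y]" using lact[OF g] by simp
    then show "x = y" using tree_aut_bij[OF G_tree_aut[OF g]] by (auto dest: bij_is_inj injD)
  qed
  then show ?thesis by (simp add: bij_def finite_UNIV_inj_surj)
qed

text \<open>A twist passes through a splitting at the price of permuting the letters and replacing
  \<open>g\<close> by its sections. Twisting and then splitting is thus a splitting with twisted
  pieces.\<close>

lemma sub_twist: "g \<in> G \<Longrightarrow> sub (twist e g) x = twist (sub e (lact g x)) (sect g [x])"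
  by (auto simp: fun_eq_iff sub_apply twist_apply act_conc[OF G_tree_aut] lact)

lemma twist_twist: "g \<in> G \<Longrightarrow> h \<in> G \<Longrightarrow> twist (twist e g) h = twist e (g \<circ> h)"
  by (simp add: twist_def act_comp[OF G_tree_aut G_tree_aut] comp_assoc)

lemma ex_other_letter: "\<exists>y::'x. y \<noteq> x"
proof (rule ccontr)
  assume "\<not> ?thesis"
  then have "(UNIV::'x set) = {x}" by auto
  then have "card (UNIV :: 'x set) = 1" by (metis card_1_singleton_iff One_nat_def)
  then show False using two by simp
qed

lemma conc_Cons_not_surj: "\<exists>\<omega>. \<forall>w. conc ((x::'x) # v) w \<noteq> \<omega>"
proof -
  obtain y where "y \<noteq> x" using ex_other_letter[of x] by blast
  then show ?thesis by (intro exI[of _ "\<lambda>_. y"]) (auto simp: conc_def fun_eq_iff intro!: exI[of _ 0])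
qed

section \<open>Maps given locally by words and elements of \<open>G\<close>\<close>

definition gform :: "((nat \<Rightarrow> 'x) \<Rightarrow> (nat \<Rightarrow> 'x)) \<Rightarrow> 'x list \<Rightarrow> bool" where
  "gform e w \<longleftrightarrow> (\<exists>u. \<exists>g\<in>G. e \<circ> conc w = conc u \<circ> act g)"

lemma gformI: "g \<in> G \<Longrightarrow> e \<circ> conc w = conc u \<circ> act g \<Longrightarrow> gform e w"
  by (auto simp: gform_def)

lemma gformE:
  assumes "gform e w"
  obtains u g where "g \<in> G" "e \<circ> conc w = conc u \<circ> act g"
  using assms unfolding gform_def by blast

text \<open>A uniform depth replaces the complete antichain in the definition of \<open>VG\<close>:
  deeper cylinders inherit the form with a section of \<open>g\<close>, so finitely many charts
  share one depth.\<close>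

definition glocal :: "((nat \<Rightarrow> 'x) \<Rightarrow> (nat \<Rightarrow> 'x)) \<Rightarrow> bool" where
  "glocal e \<longleftrightarrow> (\<exists>n. \<forall>w. length w = n \<longrightarrow> gform e w)"

lemma glocal_deep:
  assumes "glocal e"
  shows "\<exists>n. \<forall>w. length w \<ge> n \<longrightarrow> gform e w"
proof -
  obtain n where n: "\<And>w. length w = n \<Longrightarrow> gform e w"
    using assms by (auto simp: glocal_def)
  show ?thesis
  proof (intro exI[of _ n] allI impI)
    fix w :: "'x list" assume w: "n \<le> length w"
    obtain u g where ug: "g \<in> G" "e \<circ> conc (take n w) = conc u \<circ> act g"
      using n[of "take n w"] w by (auto elim: gformE)
    have "e \<circ> conc w = conc (u @ g (drop n w)) \<circ> act (sect g (drop n w))"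
    proof
      fix \<omega>
      have "(e \<circ> conc w) \<omega> = (e \<circ> conc (take n w)) (conc (drop n w) \<omega>)"
        by (simp flip: conc_append)
      also have "\<dots> = conc u (act g (conc (drop n w) \<omega>))" unfolding ug(2) by simp
      finally show "(e \<circ> conc w) \<omega> = (conc (u @ g (drop n w)) \<circ> act (sect g (drop n w))) \<omega>"
        by (simp add: act_conc[OF G_tree_aut[OF ug(1)]] conc_append)
    qed
    then show "gform e w" by (rule gformI[OF G_sect[OF ug(1)]])
  qed
qed

lemma glocal_finite:
  assumes "finite b" "\<forall>e\<in>b. glocal e"
  shows "\<exists>n. \<forall>e\<in>b. \<forall>w. length w \<ge> n \<longrightarrow> gform e w"
  using assms
proof (induction b rule: finite_induct)
  case (insert e b)
  obtain n where n: "\<forall>e\<in>b. \<forall>w. length w \<ge> n \<longrightarrow> gform e w"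
    using insert by auto
  obtain k where k: "\<forall>w. length w \<ge> k \<longrightarrow> gform e w"
    using glocal_deep[of e] insert.prems by auto
  show ?case by (rule exI[of _ "max n k"]) (use n k in auto)
qed simp

lemma glocal_sub: "glocal e \<Longrightarrow> glocal (sub e x)"
proof -
  assume "glocal e"
  then obtain n where n: "\<forall>w. length w \<ge> n \<longrightarrow> gform e w"
    using glocal_deep by blast
  have "sub e x \<circ> conc w = e \<circ> conc (x # w)" for w
    by (auto simp: fun_eq_iff sub_apply conc_Cons[of x w])
  then have "gform (sub e x) w = gform e (x # w)" for w by (simp add: gform_def)
  then show ?thesis unfolding glocal_def using n by (intro exI[of _ n]) auto
qed

lemma glocal_twist: "glocal e \<Longrightarrow> g \<in> G \<Longrightarrow> glocal (twist e g)"
proof -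
  assume "glocal e" and g: "g \<in> G"
  then obtain n where n: "\<forall>w. length w \<ge> n \<longrightarrow> gform e w"
    using glocal_deep by blast
  show ?thesis unfolding glocal_def
  proof (intro exI[of _ n] allI impI)
    fix w :: "'x list" assume "length w = n"
    then have "gform e (g w)" using n tree_aut_length[OF G_tree_aut[OF g], of w] by simp
    then obtain u k where u: "k \<in> G" "e \<circ> conc (g w) = conc u \<circ> act k" by (rule gformE)
    have "twist e g \<circ> conc w = conc u \<circ> act (k \<circ> sect g w)"
      using fun_cong[OF u(2)]
      by (auto simp: fun_eq_iff twist_apply act_conc[OF G_tree_aut[OF g]] act_comp G_tree_aut u(1) G_sect g)
    then show "gform (twist e g) w"
      by (rule gformI[OF G_comp[OF u(1) G_sect[OF g]]])
  qed
qed

lemma glocal_merge: "(\<And>x. glocal (z x)) \<Longrightarrow> glocal (merge z)"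
proof -
  assume "\<And>x. glocal (z x)"
  then obtain n where n: "\<forall>e\<in>range z. \<forall>w. length w \<ge> n \<longrightarrow> gform e w"
    using glocal_finite[of "range z"] by auto
  show ?thesis unfolding glocal_def
  proof (intro exI[of _ "Suc n"] allI impI)
    fix w :: "'x list" assume "length w = Suc n"
    then obtain x v where w: "w = x # v" "length v = n" by (cases w) auto
    have "merge z \<circ> conc w = z x \<circ> conc v"
      by (auto simp: fun_eq_iff w conc_Cons[of x v] merge_conc)
    then have "gform (merge z) w = gform (z x) v" by (simp add: gform_def)
    then show "gform (merge z) w" using n w(2) by auto
  qed
qed

lemma glocal_id: "glocal id"
  unfolding glocal_def by (intro exI[of _ 0]) (auto intro!: gformI[OF G_id, of id "[]" "[]"])

lemma glocal_conc: "glocal (conc u)"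
  unfolding glocal_def by (intro exI[of _ 0]) (auto intro!: gformI[OF G_id, of _ "[]" u])

definition basis :: "((nat \<Rightarrow> 'x) \<Rightarrow> (nat \<Rightarrow> 'x)) set \<Rightarrow> bool" where
  "basis b \<longleftrightarrow> finite b \<and> (\<forall>e\<in>b. glocal e)
     \<and> (\<forall>e\<in>b. \<forall>f\<in>b. \<forall>w w'. e w = f w' \<longrightarrow> e = f \<and> w = w')
     \<and> (\<forall>y. \<exists>e\<in>b. \<exists>w. y = e w)"

lemma basis_finite: "basis b \<Longrightarrow> finite b" unfolding basis_def by blast
lemma basis_glocal: "basis b \<Longrightarrow> e \<in> b \<Longrightarrow> glocal e" unfolding basis_def by blast
lemma basis_eq: "basis b \<Longrightarrow> e \<in> b \<Longrightarrow> f \<in> b \<Longrightarrow> e w = f w' \<Longrightarrow> e = f" unfolding basis_def by blast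
lemma basis_inj: "basis b \<Longrightarrow> e \<in> b \<Longrightarrow> e w = e w' \<Longrightarrow> w = w'" unfolding basis_def by blast
lemma basis_cover: "basis b \<Longrightarrow> \<exists>e\<in>b. \<exists>w. y = e w" unfolding basis_def by blast
lemma basis_nonempty: "basis b \<Longrightarrow> b \<noteq> {}" using basis_cover by blast

text \<open>The images already cover the space, so a further chart would overlap one of
  them.\<close>

lemma basis_subset: assumes "basis b" "basis b'" "b \<subseteq> b'" shows "b = b'"
proof
  show "b' \<subseteq> b"
  proof
    fix e assume e: "e \<in> b'"
    obtain f w where "f \<in> b" "e undefined = f w" using basis_cover[OF assms(1)] by blast
    then show "e \<in> b" using basis_eq[OF assms(2) e] assms(3) by blast
  qed
qed fact

section \<open>Subdivisions of charts and edges between bases\<close>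

definition subdiv where
  "subdiv e r \<longleftrightarrow> finite r \<and> (\<forall>f\<in>r. glocal f)
     \<and> (\<forall>f\<in>r. \<forall>f'\<in>r. \<forall>w w'. f w = f' w' \<longrightarrow> f = f' \<and> w = w')
     \<and> (\<forall>f\<in>r. range f \<subseteq> range e) \<and> (\<forall>w. \<exists>f\<in>r. \<exists>w'. e w = f w')"

lemma subdivD:
  assumes "subdiv e r"
  shows "finite r" "f \<in> r \<Longrightarrow> glocal f" "f \<in> r \<Longrightarrow> f' \<in> r \<Longrightarrow> f w = f' w' \<Longrightarrow> f = f' \<and> w = w'"
    "f \<in> r \<Longrightarrow> range f \<subseteq> range e" "\<exists>f\<in>r. \<exists>w'. e w = f w'"
  using assms unfolding subdiv_def by blast+

lemma basis_replace:
  assumes b: "basis b" and e: "e \<in> b" and r: "subdiv e r"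
  shows "basis (b - {e} \<union> r)" and "r \<inter> (b - {e}) = {}"
proof -
  have dis: False if "f \<in> r" "f' \<in> b" "f' \<noteq> e" "f w = f' w'" for f f' w w'
  proof -
    have "range f \<subseteq> range e" by (rule subdivD(4)[OF r that(1)])
    then obtain w'' where "f w = e w''" by blast
    then show False using basis_eq[OF b e that(2), of w'' w'] that(3,4) by simp
  qed
  show "r \<inter> (b - {e}) = {}"
  proof -
    have False if "f \<in> r" "f \<in> b - {e}" for f using dis[of f f undefined undefined] that by simp
    then show ?thesis by blast
  qed
  have rr: "f = f' \<and> w = w'" if "f \<in> r" "f' \<in> r" "f w = f' w'" for f f' w w'
    by (rule subdivD(3)[OF r that])
  have bb: "f = f' \<and> w = w'" if "f \<in> b" "f' \<in> b" "f w = f' w'" for f f' w w'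
    using b that unfolding basis_def by blast
  show "basis (b - {e} \<union> r)"
    unfolding basis_def
  proof (intro conjI ballI allI impI)
    show "finite (b - {e} \<union> r)" using basis_finite[OF b] subdivD(1)[OF r] by simp
    fix f assume f: "f \<in> b - {e} \<union> r"
    show "glocal f" using f basis_glocal[OF b] subdivD(2)[OF r] by blast
    fix f' w w' assume f': "f' \<in> b - {e} \<union> r" and eq: "f w = f' w'"
    have "f = f' \<and> w = w'"
      using f f' dis[of f f' w w', OF _ _ _ eq] dis[of f' f w' w, OF _ _ _ eq[symmetric]] bb[of f f' w w', OF _ _ eq] rr[of f f' w w', OF _ _ eq] by blast
    then show "f = f'" "w = w'" by auto
  next
    fix y
    obtain f w where f: "f \<in> b" "y = f w" using basis_cover[OF b] by blast
    show "\<exists>f\<in>b - {e} \<union> r. \<exists>w. y = f w"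
    proof (cases "f = e")
      case True
      then show ?thesis using subdivD(5)[OF r, of w] f by blast
    next
      case False
      then show ?thesis using f by blast
    qed
  qed
qed

text \<open>The pieces of a splitting may carry twists so that a twist followed by a plain splitting
  is again a single move. This closes the triangles on which \<open>val_edge\<close> rests.\<close>

definition leafmove where
  "leafmove e r \<longleftrightarrow> (\<exists>g\<in>N. r = {twist e g}) \<or>
     (\<exists>h. (\<forall>x. h x \<in> N) \<and> r = range (\<lambda>x. twist (sub e x) (h x)))"

lemma leafmove_twist: "g \<in> N \<Longrightarrow> leafmove e {twist e g}"
  by (auto simp: leafmove_def)

lemma leafmove_split: "(\<And>x. h x \<in> N) \<Longrightarrow> leafmove e (range (\<lambda>x. twist (sub e x) (h x)))"
  by (auto simp: leafmove_def)

lemma leafmove_sub: "leafmove e (range (sub e))"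
  using leafmove_split[of "\<lambda>_. id" e] id_N by simp

lemma inj_twist_sub:
  assumes "inj e" "h x \<in> N" "h y \<in> N" "twist (sub e x) (h x) w = twist (sub e y) (h y) w'"
  shows "x = y \<and> w = w'"
proof -
  have "conc [x] (act (h x) w) = conc [y] (act (h y) w')"
    using assms by (auto simp: twist_apply sub_apply dest: injD)
  then have "x = y \<and> act (h x) w = act (h y) w'" using conc_same_length[of "[x]" "[y]"] by auto
  then show ?thesis using act_inject[OF N_G] assms(2) by auto
qed

lemma leafmove_subdiv:
  assumes "glocal e" "inj e" "leafmove e r"
  shows "subdiv e r"
  using assms(3) unfolding leafmove_def
proof (elim disjE bexE exE conjE)
  fix g assume g: "g \<in> N" "r = {twist e g}"
  have "\<exists>w'. e w = e (act g w')" for w using act_inv_right[OF N_G[OF g(1)], of w] by metis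
  then show ?thesis unfolding subdiv_def g(2)
    using glocal_twist[OF assms(1) N_G[OF g(1)]] inj_eq[OF assms(2)] act_inject[OF N_G[OF g(1)]]
    by (auto simp: twist_apply)
next
  fix h assume h: "\<forall>x. h x \<in> N" "r = range (\<lambda>x. twist (sub e x) (h x))"
  show ?thesis unfolding subdiv_def
  proof (intro conjI ballI allI impI)
    show "finite r" using h by simp
    fix f assume "f \<in> r"
    then obtain x where f: "f = twist (sub e x) (h x)" using h by auto
    show "glocal f" unfolding f using h(1) by (simp add: glocal_twist glocal_sub assms(1) N_G)
    show "range f \<subseteq> range e" unfolding f by (auto simp: twist_apply sub_apply)
    fix f' w w' assume "f' \<in> r" and eq: "f w = f' w'"
    then obtain y where f': "f' = twist (sub e y) (h y)" using h by auto
    have "x = y \<and> w = w'" using inj_twist_sub[OF assms(2), of h x y w w'] h(1) eq f f' by auto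
    then show "f = f'" "w = w'" using f f' by auto
  next
    fix w :: "nat \<Rightarrow> 'x"
    obtain x v where w: "w = conc [x] v" by (rule conc_single_cases)
    have "e w = twist (sub e x) (h x) (act (Hilbert_Choice.inv (h x)) v)"
      using h(1) by (simp add: twist_apply sub_apply act_inv_right N_G w)
    then show "\<exists>f\<in>r. \<exists>w'. e w = f w'" using h(2) by blast
  qed
qed

lemma basis_is_inj: "basis b \<Longrightarrow> e \<in> b \<Longrightarrow> inj e"
  by (rule injI) (rule basis_inj)

lemma leafmove_subdiv_basis: "basis b \<Longrightarrow> e \<in> b \<Longrightarrow> leafmove e r \<Longrightarrow> subdiv e r"
  by (rule leafmove_subdiv) (auto intro: basis_glocal basis_is_inj)

definition edge where
  "edge b b' \<longleftrightarrow> basis b \<and> (\<exists>e\<in>b. \<exists>r. leafmove e r \<and> b' = b - {e} \<union> r)"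

lemma edgeI: "basis b \<Longrightarrow> e \<in> b \<Longrightarrow> leafmove e r \<Longrightarrow> edge b (b - {e} \<union> r)"
  by (auto simp: edge_def)

lemma edge_basis: "edge b b' \<Longrightarrow> basis b" "edge b b' \<Longrightarrow> basis b'"
  using basis_replace(1) leafmove_subdiv_basis by (auto simp: edge_def)

lemma edge_refl: "basis b \<Longrightarrow> edge b b"
proof -
  assume b: "basis b"
  then obtain e where "e \<in> b" using basis_nonempty by blast
  then show ?thesis using edgeI[OF b _ leafmove_twist[OF id_N]] by (metis insert_Diff Un_insert_right Un_empty_right twist_id)
qed

lemma card_split:
  assumes "basis b" "e \<in> b" "\<And>x. h x \<in> N"
  shows "card (range (\<lambda>x. twist (sub e x) (h x))) = card (UNIV :: 'x set)"
proof (rule card_image, rule injI)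
  fix x y assume "twist (sub e x) (h x) = twist (sub e y) (h y)"
  then show "x = y" using inj_twist_sub[OF basis_is_inj[OF assms(1,2)], of h x y undefined undefined] assms(3) by auto
qed

lemma card_replace:
  assumes "basis b" "e \<in> b" "leafmove e r"
  shows "card (b - {e} \<union> r) = card b - 1 + card r"
  using basis_replace(2)[OF assms(1,2) leafmove_subdiv_basis[OF assms]] basis_finite[OF assms(1)] subdivD(1)[OF leafmove_subdiv_basis[OF assms]] assms(2)
  by (subst card_Un_disjoint) (auto simp: card_Diff_singleton)

lemma card_leafmove:
  assumes "basis b" "e \<in> b" "leafmove e r"
  shows "card r = 1 \<or> card r = card (UNIV :: 'x set)"
  using assms(3) card_split[OF assms(1,2)] unfolding leafmove_def by auto

text \<open>The last bound drives the later counting: all but at most d charts of the larger end are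
  shared, where d is the size of the alphabet, and this leaves room for a block common to both
  ends.\<close>

lemma edge_card:
  assumes "edge b b'"
  shows "card b \<le> card b'" "card b' = card b \<or> card b' = card b + (card (UNIV :: 'x set) - 1)"
    "card (b' - b) \<le> card (UNIV :: 'x set)"
proof -
  obtain e r where e: "basis b" "e \<in> b" "leafmove e r" "b' = b - {e} \<union> r" using assms by (auto simp: edge_def)
  have p: "card b \<ge> 1" using e basis_finite[OF e(1)] by (metis One_nat_def Suc_leI card_gt_0_iff empty_iff)
  have "card b' = card b \<or> card b' = card b + (card (UNIV :: 'x set) - 1)"
    using card_replace[OF e(1-3)] card_leafmove[OF e(1-3)] p two unfolding e(4) by auto
  then show "card b' = card b \<or> card b' = card b + (card (UNIV :: 'x set) - 1)" .
  then show "card b \<le> card b'" by auto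
  have "finite r" by (rule subdivD(1)[OF leafmove_subdiv_basis[OF e(1-3)]])
  then have "card (b' - b) \<le> card r" unfolding e(4) by (intro card_mono) auto
  then show "card (b' - b) \<le> card (UNIV :: 'x set)" using card_leafmove[OF e(1-3)] two by auto
qed

section \<open>Merging d charts of a basis\<close>

definition block :: "((nat \<Rightarrow> 'x) \<Rightarrow> (nat \<Rightarrow> 'x)) set \<Rightarrow> ('x \<Rightarrow> (nat \<Rightarrow> 'x) \<Rightarrow> (nat \<Rightarrow> 'x)) \<Rightarrow> bool" where
  "block b z \<longleftrightarrow> inj z \<and> range z \<subseteq> b"

text \<open>The merged chart depends on the labelling \<open>z\<close> by letters and not only on
  its range; for this reason a block is an injective function instead of a set.\<close>

definition quo where
  "quo b z = b - range z \<union> {merge z}"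

text \<open>If \<open>merge z\<close> were a chart of \<open>b\<close>, it would overlap every
  \<open>z x\<close>, and all of these would be equal to it.\<close>

lemma merge_notin: assumes "basis b" "block b z" shows "merge z \<notin> b"
proof
  assume m: "merge z \<in> b"
  have "z x = merge z" for x
    using basis_eq[OF assms(1), of "z x" "merge z" undefined "conc [x] undefined"] m assms(2)
    by (auto simp: merge_conc block_def)
  then have "z x = z y" for x y by metis
  then have "x = y" for x y :: 'x using assms(2) by (auto simp: block_def dest: injD)
  then show False using ex_other_letter by blast
qed

lemma basis_quo: assumes "basis b" "block b z" shows "basis (quo b z)"
proof -
  have z: "z x \<in> b" for x using assms(2) by (auto simp: block_def)
  have iz: "z x = z y \<longleftrightarrow> x = y" for x y using assms(2) by (auto simp: block_def inj_eq)
  have mz: "\<exists>x v. w = conc [x] v \<and> merge z w = z x v" for w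
    by (metis conc_hd_tl merge_conc)
  show ?thesis unfolding basis_def
  proof (intro conjI ballI allI impI)
    show "finite (quo b z)" using basis_finite[OF assms(1)] by (simp add: quo_def)
    fix e assume e: "e \<in> quo b z"
    show "glocal e" using e glocal_merge[of z] basis_glocal[OF assms(1)] z by (auto simp: quo_def)
    fix f w w' assume f: "f \<in> quo b z" and eq: "e w = f w'"
    have "e = f \<and> w = w'"
    proof (cases "e = merge z")
      case True
      obtain x v where x: "w = conc [x] v" "merge z w = z x v" using mz by blast
      show ?thesis
      proof (cases "f = merge z")
        case f: True
        obtain y v' where y: "w' = conc [y] v'" "merge z w' = z y v'" using mz by blast
        have "z x v = z y v'" using True f eq x y by simp
        then have "x = y \<and> v = v'" using basis_eq[OF assms(1) z z] basis_inj[OF assms(1) z] iz by metis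
        then show ?thesis using True f x y by simp
      next
        case False
        then have "f \<in> b" "f \<notin> range z" using f by (auto simp: quo_def)
        then show ?thesis using basis_eq[OF assms(1) z, of f x v w'] True eq x by (metis rangeI)
      qed
    next
      case e1: False
      then have e2: "e \<in> b" "e \<notin> range z" using e by (auto simp: quo_def)
      show ?thesis
      proof (cases "f = merge z")
        case f: True
        obtain y v' where y: "w' = conc [y] v'" "merge z w' = z y v'" using mz by blast
        then show ?thesis using basis_eq[OF assms(1) e2(1) z, of w y v'] e2 f eq by (metis rangeI)
      next
        case False
        then have "f \<in> b" "f \<notin> range z" using f by (auto simp: quo_def)
        then show ?thesis using basis_eq[OF assms(1) e2(1), of f w w'] basis_inj[OF assms(1) e2(1), of w w'] eq by metis
      qed
    qed
    then show "e = f" "w = w'" by auto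
  next
    fix y
    obtain e w where e: "e \<in> b" "y = e w" using basis_cover[OF assms(1)] by blast
    show "\<exists>e\<in>quo b z. \<exists>w. y = e w"
    proof (cases "e \<in> range z")
      case True
      then obtain x where "e = z x" by auto
      then have "y = merge z (conc [x] w)" using e by (simp add: merge_conc)
      then show ?thesis by (auto simp: quo_def)
    next
      case False
      then show ?thesis using e by (auto simp: quo_def)
    qed
  qed
qed

lemma edge_quo: assumes "basis b" "block b z" shows "edge (quo b z) b"
proof -
  have "range (sub (merge z)) = range z" by auto
  moreover have "b = quo b z - {merge z} \<union> range z"
    using assms merge_notin[OF assms] by (auto simp: quo_def block_def)
  moreover have "edge (quo b z) (quo b z - {merge z} \<union> range (sub (merge z)))"
    by (rule edgeI[OF basis_quo[OF assms] _ leafmove_sub]) (simp add: quo_def)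
  ultimately show ?thesis by simp
qed

lemma card_quo: assumes "basis b" "block b z" shows "card (quo b z) < card b"
proof -
  have "card (range z) = card (UNIV :: 'x set)" using assms by (auto simp: block_def card_image)
  moreover have "card (range z) \<le> card b" using assms basis_finite[OF assms(1)] by (auto simp: block_def intro: card_mono)
  moreover have "card (b - range z) = card b - card (range z)"
    using assms by (intro card_Diff_subset) (auto simp: block_def)
  moreover have "card (quo b z) \<le> card (b - range z) + 1"
    unfolding quo_def by (metis card_Un_le card.empty card_insert_disjoint empty_iff finite.emptyI One_nat_def)
  ultimately show ?thesis using two by linarith
qed

lemma block_quo:
  assumes "block b z" "block b z'" "range z \<inter> range z' = {}"
  shows "block (quo b z) z'"
  using assms by (auto simp: block_def quo_def)

text \<open>Together with \<open>edge_quo\<close> this yields the basic square: \<open>b\<close>,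
  two of its quotients, and their common quotient.\<close>

lemma quo_quo:
  assumes "basis b" "block b z" "block b z'" "range z \<inter> range z' = {}"
  shows "quo (quo b z) z' = quo (quo b z') z"
proof -
  have "merge z \<notin> range z'" "merge z' \<notin> range z"
    using merge_notin[OF assms(1,2)] merge_notin[OF assms(1,3)] assms(2,3) unfolding block_def by blast+
  then show ?thesis by (auto simp: quo_def)
qed

text \<open>Unless the edge is trivial, a block present at both ends does not contain the chart that
  is replaced, so the same move can be made after merging.\<close>

lemma edge_quo_quo:
  assumes "edge b b'" "inj z" "range z \<subseteq> b \<inter> b'"
  shows "edge (quo b z) (quo b' z)"
proof -
  obtain e r where e: "basis b" "e \<in> b" "leafmove e r" "b' = b - {e} \<union> r" using assms(1) by (auto simp: edge_def)
  note sd = leafmove_subdiv_basis[OF e(1-3)]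
  have bz: "block b z" "block b' z" using assms by (auto simp: block_def)
  show ?thesis
  proof (cases "e \<in> b'")
    case True
    have "b \<subseteq> b'" using True e by auto
    then have "b = b'" using basis_subset edge_basis[OF assms(1)] by blast
    then show ?thesis using edge_refl basis_quo[OF e(1) bz(1)] by simp
  next
    case False
    then have ez: "e \<notin> range z" using assms(3) by auto
    have "r \<inter> range z = {}" using basis_replace(2)[OF e(1,2) sd] ez assms(3) by auto
    moreover have "merge z \<noteq> e" using merge_notin[OF e(1) bz(1)] e(2) by auto
    ultimately have "quo b' z = quo b z - {e} \<union> r" unfolding quo_def e(4) by auto
    moreover have "e \<in> quo b z" using e(2) ez by (simp add: quo_def)
    ultimately show ?thesis using edgeI[OF basis_quo[OF e(1) bz(1)] _ e(3)] by simp
  qed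
qed

lemma ex_block:
  assumes "basis b" "b' \<subseteq> b" "card b' \<ge> card (UNIV :: 'x set)"
  shows "\<exists>z. block b z \<and> range z \<subseteq> b'"
proof -
  have "finite b'" using assms basis_finite finite_subset by blast
  then obtain z where "z ` (UNIV :: 'x set) \<subseteq> b'" "inj z"
    using card_le_inj[of "UNIV :: 'x set" b'] assms(3) by auto
  then show ?thesis using assms(2) unfolding block_def by (intro exI[of _ z]) auto
qed

section \<open>Extending cocycles to larger bases\<close>

text \<open>Edges are reflexive, so that the quadrilaterals include all triangles of edges.\<close>

definition cocycle :: "nat \<Rightarrow> (((nat \<Rightarrow> 'x) \<Rightarrow> (nat \<Rightarrow> 'x)) set \<Rightarrow> ((nat \<Rightarrow> 'x) \<Rightarrow> (nat \<Rightarrow> 'x)) set \<Rightarrow> 'k::group_add) \<Rightarrow> bool" where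
  "cocycle m c \<longleftrightarrow> (\<forall>b. basis b \<longrightarrow> card b \<le> m \<longrightarrow> c b b = 0) \<and>
    (\<forall>b b1 b2 b3. edge b b1 \<longrightarrow> edge b1 b3 \<longrightarrow> edge b b2 \<longrightarrow> edge b2 b3 \<longrightarrow> card b3 \<le> m \<longrightarrow>
       c b b1 + c b1 b3 = c b b2 + c b2 b3)"

lemma cocycle_refl: "cocycle m c \<Longrightarrow> basis b \<Longrightarrow> card b \<le> m \<Longrightarrow> c b b = 0"
  by (simp add: cocycle_def)

lemma cocycle_square:
  "cocycle m c \<Longrightarrow> edge b b1 \<Longrightarrow> edge b1 b3 \<Longrightarrow> edge b b2 \<Longrightarrow> edge b2 b3 \<Longrightarrow> card b3 \<le> m \<Longrightarrow>
     c b b1 + c b1 b3 = c b b2 + c b2 b3"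
  unfolding cocycle_def by blast

lemma cocycle_triangle:
  assumes "cocycle m c" "edge b b1" "edge b1 b2" "edge b b2" "card b2 \<le> m"
  shows "c b b1 + c b1 b2 = c b b2"
proof -
  have "card b \<le> m" using edge_card(1)[OF assms(4)] assms(5) by simp
  then show ?thesis
    using cocycle_square[OF assms(1-3) edge_refl assms(4,5)] cocycle_refl[OF assms(1)] edge_basis(1)[OF assms(2)] by simp
qed

lemma block_avoiding:
  assumes "basis b" "A \<subseteq> b" "finite W" "card A \<ge> card W + card (UNIV :: 'x set)"
  shows "\<exists>z. block b z \<and> range z \<subseteq> A \<and> range z \<inter> W = {}"
proof -
  have "card (A - W) \<ge> card (UNIV :: 'x set)"
    using diff_card_le_card_Diff[OF assms(3), of A] assms(4) by linarith
  then obtain z where "block b z" "range z \<subseteq> A - W" using ex_block[OF assms(1), of "A - W"] assms(2) by auto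
  then show ?thesis by blast
qed

lemma card_range_block: "card (range (z :: 'x \<Rightarrow> 'b)) \<le> card (UNIV :: 'x set)"
  by (rule card_image_le) simp

text \<open>The unknowns are the values \<open>- a z\<close> on the edges from
  \<open>quo u z\<close> to the new basis \<open>u\<close>; the square over two disjoint blocks
  prescribes how two of them compare, namely by \<open>\<kappa> z w\<close>. Three disjoint blocks
  span a cube whose lower faces commute, so \<open>\<kappa>\<close> is additive on triangles and has
  a potential. The factor five comes from the need for a block that avoids four given ones.\<close>

lemma cocycle_extend_top:
  fixes c :: "((nat \<Rightarrow> 'x) \<Rightarrow> (nat \<Rightarrow> 'x)) set \<Rightarrow> ((nat \<Rightarrow> 'x) \<Rightarrow> (nat \<Rightarrow> 'x)) set \<Rightarrow> 'k::group_add"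
  assumes c: "cocycle m c" and u: "basis u" "card u = Suc m" and big: "Suc m \<ge> 5 * card (UNIV :: 'x set)"
  shows "\<exists>a. \<forall>z w. block u z \<longrightarrow> block u w \<longrightarrow> range z \<inter> range w = {} \<longrightarrow>
     c (quo (quo u z) w) (quo u z) + - a z = c (quo (quo u z) w) (quo u w) + - a w"
proof -
  define \<kappa> where "\<kappa> z w = - c (quo (quo u z) w) (quo u z) + c (quo (quo u z) w) (quo u w)" for z w
  let ?dis = "\<lambda>z w :: 'x \<Rightarrow> (nat \<Rightarrow> 'x) \<Rightarrow> (nat \<Rightarrow> 'x). range z \<inter> range w = {}"
  have sq: "c (quo (quo x z) w) (quo x z) + c (quo x z) x = c (quo (quo x z) w) (quo x w) + c (quo x w) x"
    if "basis x" "card x \<le> m" "block x z" "block x w" "?dis z w" for x z w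
  proof (rule cocycle_square[OF c])
    show "edge (quo (quo x z) w) (quo x z)"
      by (rule edge_quo[OF basis_quo block_quo]) (use that in auto)
    show "edge (quo x z) x" "edge (quo x w) x" using edge_quo that by auto
    have "?dis w z" using that by auto
    then show "edge (quo (quo x z) w) (quo x w)"
      unfolding quo_quo[OF that(1,3-5)] by (intro edge_quo[OF basis_quo block_quo]) (use that in auto)
  qed fact
  have "\<exists>a. \<forall>z\<in>{z. block u z}. \<forall>w\<in>{z. block u z}. ?dis z w \<longrightarrow> \<kappa> z w = - a z + a w"
  proof (rule potential_of_disjointness)
    fix z w assume "z \<in> {z. block u z}" "w \<in> {z. block u z}" "?dis z w"
    then show "\<kappa> w z = - \<kappa> z w" using quo_quo[OF u(1), of z w] by (simp add: \<kappa>_def minus_add)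
  next
    fix x y z assume "x \<in> {z. block u z}" "y \<in> {z. block u z}" "z \<in> {z. block u z}"
      and d: "?dis x y" "?dis y z" "?dis x z"
    then have bl: "block u x" "block u y" "block u z" by auto
    have d': "?dis y x" "?dis z y" "?dis z x" using d by auto
    have xy: "quo (quo u x) y = quo (quo u y) x" and yz: "quo (quo u y) z = quo (quo u z) y"
      and xz: "quo (quo u x) z = quo (quo u z) x" using quo_quo[OF u(1)] bl d by auto
    have bq: "basis (quo u t)" "card (quo u t) \<le> m" if "block u t" for t
      using basis_quo[OF u(1) that] card_quo[OF u(1) that] u(2) by auto
    note q = block_quo[of u]
    \<comment> \<open>The bottom of the cube. Its faces below \<open>quo u x\<close>,
      \<open>quo u y\<close> and \<open>quo u z\<close> involve only bases with at most
      \<open>m\<close> charts, where the squares of \<open>c\<close> commute.\<close>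
    define Y where "Y = quo (quo (quo u x) y) z"
    have Yx: "Y = quo (quo (quo u x) z) y"
      unfolding Y_def using quo_quo[OF bq(1)[OF bl(1)] q q] bl d by auto
    have Yy: "Y = quo (quo (quo u y) z) x"
      unfolding Y_def xy using quo_quo[OF bq(1)[OF bl(2)] q q] bl d d' by auto
    have 1: "c Y (quo (quo u x) y) + c (quo (quo u x) y) (quo u x) = c Y (quo (quo u x) z) + c (quo (quo u x) z) (quo u x)"
      unfolding Y_def by (rule sq[OF bq[OF bl(1)] q q]) (use bl d in auto)
    have 2: "c Y (quo (quo u x) y) + c (quo (quo u x) y) (quo u y) = c Y (quo (quo u y) z) + c (quo (quo u y) z) (quo u y)"
      unfolding Y_def xy by (rule sq[OF bq[OF bl(2)] q q]) (use bl d d' in auto)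
    have 3: "c Y (quo (quo u x) z) + c (quo (quo u x) z) (quo u z) = c Y (quo (quo u y) z) + c (quo (quo u y) z) (quo u z)"
      unfolding Yx xz yz by (rule sq[OF bq[OF bl(3)] q q]) (use bl d d' in auto)
    have *: "- p + p' = - (Yp + p) + (Yp + p')" for p p' Yp :: 'k by (metis minus_add add.assoc minus_add_cancel)
    have "\<kappa> x y = - (c Y (quo (quo u x) y) + c (quo (quo u x) y) (quo u x)) + (c Y (quo (quo u x) y) + c (quo (quo u x) y) (quo u y))"
      unfolding \<kappa>_def by (rule *)
    moreover have "\<kappa> y z = - (c Y (quo (quo u y) z) + c (quo (quo u y) z) (quo u y)) + (c Y (quo (quo u y) z) + c (quo (quo u y) z) (quo u z))"
      unfolding \<kappa>_def by (rule *)
    moreover have "\<kappa> x z = - (c Y (quo (quo u x) z) + c (quo (quo u x) z) (quo u x)) + (c Y (quo (quo u x) z) + c (quo (quo u x) z) (quo u z))"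
      unfolding \<kappa>_def by (rule *)
    moreover have "(- p + r) + (- r + s) = - p + s" for p r s :: 'k by (simp add: add.assoc)
    ultimately show "\<kappa> x y + \<kappa> y z = \<kappa> x z" unfolding 1 2 3 by (simp only:)
  next
    fix x y z w assume bl: "x \<in> {z. block u z}" "y \<in> {z. block u z}" "z \<in> {z. block u z}" "w \<in> {z. block u z}"
    let ?W = "range x \<union> range y \<union> range z \<union> range w"
    have "card ?W \<le> card (range x) + card (range y) + card (range z) + card (range w)"
      by (meson card_Un_le add_le_mono1 order_trans)
    then have "card ?W \<le> 4 * card (UNIV :: 'x set)"
      using card_range_block[of x] card_range_block[of y] card_range_block[of z] card_range_block[of w] by linarith
    then have "card ?W + card (UNIV :: 'x set) \<le> card u" using u(2) big by linarith
    then obtain v where "block u v" "range v \<inter> ?W = {}"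
      using block_avoiding[OF u(1) order_refl, of ?W] by auto
    then show "\<exists>v\<in>{z. block u z}. ?dis v x \<and> ?dis v y \<and> ?dis v z \<and> ?dis v w"
      by (intro bexI[of _ v]) auto
  qed auto
  then obtain a where a: "\<And>z w. block u z \<Longrightarrow> block u w \<Longrightarrow> ?dis z w \<Longrightarrow> \<kappa> z w = - a z + a w" by blast
  have "p + - r = p' + - s" if "- p + p' = - r + s" for p p' r s :: 'k
  proof -
    have "p' = p + (- r + s)" using that by (metis add_minus_cancel)
    then show ?thesis by (simp add: add.assoc del: add_uminus_conv_diff)
  qed
  then show ?thesis using a unfolding \<kappa>_def by blast
qed

text \<open>At most d charts of \<open>v\<close> are new, and d more are needed for the block
  itself; hence the factor two.\<close>

lemma common_block:
  assumes "edge u v" "finite W" "card v \<ge> card W + 2 * card (UNIV :: 'x set)"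
  shows "\<exists>z :: 'x \<Rightarrow> _. inj z \<and> range z \<subseteq> u \<inter> v \<and> range z \<inter> W = {}"
proof -
  have f: "finite v" using assms edge_basis basis_finite by blast
  have "v - (v - u) = u \<inter> v" by auto
  then have "card (u \<inter> v) \<ge> card v - card (v - u)"
    using diff_card_le_card_Diff[of "v - u" v] f by simp
  then have "card (u \<inter> v) \<ge> card W + card (UNIV :: 'x set)" using edge_card(3)[OF assms(1)] assms(3) by linarith
  then obtain z where "block u z" "range z \<subseteq> u \<inter> v" "range z \<inter> W = {}"
    using block_avoiding[OF edge_basis(1)[OF assms(1)], of "u \<inter> v" W] assms(2) by auto
  then show ?thesis unfolding block_def by blast
qed

text \<open>The extension is forced by the squares $u/z, v/z, u, v$: if $q(u,z)$ is the value on the edge from $u/z$ to $u$,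
  then $c'(u,v) = -q(u,z) + c(u/z,v/z) + q(v,z)$. The choice of $q(u,z)$ for $u$ of maximal size comes from
  \<open>cocycle_extend_top\<close>.\<close>

lemma cocycle_extend:
  fixes c :: "((nat \<Rightarrow> 'x) \<Rightarrow> (nat \<Rightarrow> 'x)) set \<Rightarrow> ((nat \<Rightarrow> 'x) \<Rightarrow> (nat \<Rightarrow> 'x)) set \<Rightarrow> 'k::group_add"
  assumes c: "cocycle m c" and big: "Suc m \<ge> 5 * card (UNIV :: 'x set)"
  shows "\<exists>c'. cocycle (Suc m) c' \<and> (\<forall>b b'. card b' \<le> m \<longrightarrow> c' b b' = c b b')"
proof -
  let ?d = "card (UNIV :: 'x set)"
  let ?dis = "\<lambda>z w :: 'x \<Rightarrow> (nat \<Rightarrow> 'x) \<Rightarrow> (nat \<Rightarrow> 'x). range z \<inter> range w = {}"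
  have "\<exists>a. \<forall>u. basis u \<and> card u = Suc m \<longrightarrow> (\<forall>z w. block u z \<longrightarrow> block u w \<longrightarrow> ?dis z w \<longrightarrow>
     c (quo (quo u z) w) (quo u z) + - a u z = c (quo (quo u z) w) (quo u w) + - a u w)"
    by (rule choice) (use cocycle_extend_top[OF c _ _ big] in blast)
  then obtain a where a: "\<And>u z w. basis u \<Longrightarrow> card u = Suc m \<Longrightarrow> block u z \<Longrightarrow> block u w \<Longrightarrow> ?dis z w \<Longrightarrow>
     c (quo (quo u z) w) (quo u z) + - a u z = c (quo (quo u z) w) (quo u w) + - a u w" by blast
  \<comment> \<open>On bases within the old range there is no choice: the value is that of
    \<open>c\<close>, and \<open>F\<close> then reproduces \<open>c\<close> by
    \<open>F_low\<close>.\<close>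
  define q where "q u z = (if card u \<le> m then c (quo u z) u else - a u z)" for u z
  have q: "c (quo (quo u z) w) (quo u z) + q u z = c (quo (quo u z) w) (quo u w) + q u w"
    if "basis u" "card u \<le> Suc m" "block u z" "block u w" "?dis z w" for u z w
  proof (cases "card u \<le> m")
    case True
    have w: "?dis w z" using that(5) by auto
    have "edge (quo (quo u z) w) (quo u z)"
      by (rule edge_quo[OF basis_quo block_quo]) (use that in auto)
    moreover have "edge (quo (quo u z) w) (quo u w)"
      unfolding quo_quo[OF that(1,3-5)] by (rule edge_quo[OF basis_quo block_quo]) (use that w in auto)
    ultimately have "c (quo (quo u z) w) (quo u z) + c (quo u z) u = c (quo (quo u z) w) (quo u w) + c (quo u w) u"
      by (intro cocycle_square[OF c _ edge_quo _ edge_quo True]) (use that in auto)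
    then show ?thesis using True by (simp add: q_def)
  next
    case False
    then show ?thesis using a[of u z w] that by (simp add: q_def)
  qed
  define F where "F u v z = - q u z + c (quo u z) (quo v z) + q v z" for u v z
  have bl: "block u z" "block v z" if "inj z" "range z \<subseteq> u \<inter> v" for u v z
    using that by (auto simp: block_def)
  \<comment> \<open>Passing down to the common quotient by both blocks rewrites
    \<open>F u v z\<close> with one side of equation \<open>q\<close> at either end;
    \<open>q\<close> then exchanges the terms of \<open>z\<close> for those of
    \<open>w\<close>.\<close>
  have F_dis: "F u v z = F u v w"
    if e: "edge u v" "card v \<le> Suc m" and z: "inj z" "range z \<subseteq> u \<inter> v" and w: "inj w" "range w \<subseteq> u \<inter> v"
      and d: "?dis z w" for u v z w
  proof -
    have d': "?dis w z" using d by auto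
    note b = edge_basis[OF e(1)]
    have cu: "card u \<le> Suc m" using edge_card(1)[OF e(1)] e(2) by simp
    have *: "F u v z = - (c (quo (quo u z) w) (quo u z) + q u z) + c (quo (quo u z) w) (quo (quo v z) w)
       + (c (quo (quo v z) w) (quo v z) + q v z)"
      if z: "inj z" "range z \<subseteq> u \<inter> v" and w: "inj w" "range w \<subseteq> u \<inter> v" and d: "?dis z w" for z w
    proof -
      have e1: "edge (quo u z) (quo v z)" by (rule edge_quo_quo[OF e(1) z])
      have "range w \<subseteq> quo u z \<inter> quo v z" using w d by (auto simp: quo_def)
      then have e2: "edge (quo (quo u z) w) (quo (quo v z) w)" using edge_quo_quo[OF e1 w(1)] by simp
      have e3: "edge (quo (quo u z) w) (quo u z)" "edge (quo (quo v z) w) (quo v z)"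
        by (rule edge_quo[OF basis_quo block_quo]; use bl[OF z] bl[OF w] b d in simp)+
      have "card (quo v z) \<le> m" using card_quo[OF b(2) bl(2)[OF z]] e(2) by simp
      then have "c (quo (quo u z) w) (quo u z) + c (quo u z) (quo v z)
         = c (quo (quo u z) w) (quo (quo v z) w) + c (quo (quo v z) w) (quo v z)"
        by (rule cocycle_square[OF c e3(1) e1 e2 e3(2)])
      then have "c (quo u z) (quo v z) = - c (quo (quo u z) w) (quo u z) +
         (c (quo (quo u z) w) (quo (quo v z) w) + c (quo (quo v z) w) (quo v z))"
        by (metis minus_add_cancel)
      then show ?thesis unfolding F_def by (simp add: minus_add add.assoc del: add_uminus_conv_diff)
    qed
    have "F u v z = - (c (quo (quo u z) w) (quo u w) + q u w) + c (quo (quo u z) w) (quo (quo v z) w)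
       + (c (quo (quo v z) w) (quo v w) + q v w)"
      unfolding *[OF z w d] q[OF b(1) cu bl(1)[OF z] bl(1)[OF w] d] q[OF b(2) e(2) bl(2)[OF z] bl(2)[OF w] d] ..
    also have "\<dots> = F u v w"
      unfolding *[OF w z d'] quo_quo[OF b(1) bl(1)[OF z] bl(1)[OF w] d] quo_quo[OF b(2) bl(2)[OF z] bl(2)[OF w] d] ..
    finally show ?thesis .
  qed
  \<comment> \<open>Overlapping blocks are compared through a third one disjoint from both. It has
    to avoid up to 2d charts, so \<open>common_block\<close> asks for 4d charts in
    \<open>v\<close>.\<close>
  have F_indep: "F u v z = F u v w"
    if e: "edge u v" "card v = Suc m" and z: "inj z" "range z \<subseteq> u \<inter> v" and w: "inj w" "range w \<subseteq> u \<inter> v" for u v z w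
  proof -
    have "card (range z \<union> range w) \<le> 2 * ?d"
      using card_Un_le[of "range z" "range w"] card_range_block[of z] card_range_block[of w] by linarith
    then obtain t :: "'x \<Rightarrow> _" where t: "inj t" "range t \<subseteq> u \<inter> v" "range t \<inter> (range z \<union> range w) = {}"
      using common_block[OF e(1), of "range z \<union> range w"] e(2) big by auto
    have "F u v z = F u v t" "F u v w = F u v t"
      by (rule F_dis[OF e(1)]; use e z w t in auto)+
    then show ?thesis by simp
  qed
  have F_low: "F u v z = c u v"
    if e: "edge u v" "card v \<le> m" and z: "inj z" "range z \<subseteq> u \<inter> v" for u v z
  proof -
    note b = edge_basis[OF e(1)]
    have cu: "card u \<le> m" using edge_card(1)[OF e(1)] e(2) by simp
    have sqr: "c (quo u z) u + c u v = c (quo u z) (quo v z) + c (quo v z) v"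
      by (rule cocycle_square[OF c edge_quo[OF b(1) bl(1)[OF z]] e(1) edge_quo_quo[OF e(1) z] edge_quo[OF b(2) bl(2)[OF z]] e(2)])
    show ?thesis unfolding F_def q_def using e(2) cu sqr[symmetric] by (simp add: add.assoc)
  qed
  define c' where "c' u v = (if card v \<le> m then c u v else F u v (SOME z. inj z \<and> range z \<subseteq> u \<inter> v))" for u v
  have c': "c' u v = F u v z" if e: "edge u v" "card v \<le> Suc m" and z: "inj z" "range z \<subseteq> u \<inter> v" for u v z
  proof (cases "card v \<le> m")
    case True
    then show ?thesis using F_low[OF e(1) _ z] by (simp add: c'_def)
  next
    case False
    let ?P = "\<lambda>z :: 'x \<Rightarrow> (nat \<Rightarrow> 'x) \<Rightarrow> (nat \<Rightarrow> 'x). inj z \<and> range z \<subseteq> u \<inter> v"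
    have P: "?P (SOME z. ?P z)" using someI[of ?P z] z by blast
    have "card v = Suc m" using False e(2) by simp
    then have "F u v (SOME z. ?P z) = F u v z"
      by (rule F_indep[OF e(1) _ conjunct1[OF P] conjunct2[OF P] z])
    then show ?thesis unfolding c'_def using False by (simp only: if_False)
  qed
  have "cocycle (Suc m) c'"
    unfolding cocycle_def
  proof (intro conjI allI impI)
    fix b assume b: "basis b" "card b \<le> Suc m"
    show "c' b b = 0"
    proof (cases "card b \<le> m")
      case True
      then show ?thesis using cocycle_refl[OF c b(1)] by (simp add: c'_def)
    next
      case False
      then obtain z :: "'x \<Rightarrow> _" where z: "inj z" "range z \<subseteq> b \<inter> b"
        using common_block[OF edge_refl[OF b(1)], of "{}"] big by auto
      have "c (quo b z) (quo b z) = 0"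
        using cocycle_refl[OF c basis_quo[OF b(1) bl(1)[OF z]]] card_quo[OF b(1) bl(1)[OF z]] b(2) by simp
      then show ?thesis using c'[OF edge_refl[OF b(1)] b(2) z] by (simp add: F_def)
    qed
  next
    fix b b1 b2 b3 assume e: "edge b b1" "edge b1 b3" "edge b b2" "edge b2 b3" and cd: "card b3 \<le> Suc m"
    note le = edge_card(1)[OF e(1)] edge_card(1)[OF e(2)] edge_card(1)[OF e(3)] edge_card(1)[OF e(4)]
    show "c' b b1 + c' b1 b3 = c' b b2 + c' b2 b3"
    proof (cases "card b3 \<le> m")
      case True
      then show ?thesis using cocycle_square[OF c e True] le by (simp add: c'_def)
    next
      case False
      \<comment> \<open>A block in \<open>b1 \<inter> b3\<close> that avoids the charts of
        \<open>b3\<close> missing from \<open>b2\<close> and those of \<open>b1\<close> missing from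
        \<open>b\<close> lies in all four corners. The whole square then descends to quotients with
        at most \<open>m\<close> charts.\<close>
      let ?W = "(b3 - b2) \<union> (b1 - b)"
      have "card ?W \<le> 2 * ?d"
        using card_Un_le[of "b3 - b2" "b1 - b"] edge_card(3)[OF e(4)] edge_card(3)[OF e(1)] by linarith
      moreover have "finite ?W" using edge_basis e basis_finite by blast
      ultimately obtain z :: "'x \<Rightarrow> _" where z: "inj z" "range z \<subseteq> b1 \<inter> b3" "range z \<inter> ?W = {}"
        using common_block[OF e(2), of ?W] False big by auto
      then have zz: "range z \<subseteq> b \<inter> b1" "range z \<subseteq> b1 \<inter> b3" "range z \<subseteq> b \<inter> b2" "range z \<subseteq> b2 \<inter> b3" by auto
      have "card (quo b3 z) \<le> m"
        using card_quo[OF edge_basis(2)[OF e(2)] bl(2)[OF z(1,2)]] cd by simp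
      then have "c (quo b z) (quo b1 z) + c (quo b1 z) (quo b3 z) = c (quo b z) (quo b2 z) + c (quo b2 z) (quo b3 z)"
        by (rule cocycle_square[OF c edge_quo_quo[OF e(1) z(1) zz(1)] edge_quo_quo[OF e(2) z(1) zz(2)]
              edge_quo_quo[OF e(3) z(1) zz(3)] edge_quo_quo[OF e(4) z(1) zz(4)]])
      moreover have "F b b' z + F b' b3 z = - q b z + (c (quo b z) (quo b' z) + c (quo b' z) (quo b3 z)) + q b3 z" for b'
        by (simp add: F_def add.assoc)
      ultimately have "F b b1 z + F b1 b3 z = F b b2 z + F b2 b3 z" by simp
      moreover have "c' b b1 = F b b1 z" "c' b1 b3 = F b1 b3 z" "c' b b2 = F b b2 z" "c' b2 b3 = F b2 b3 z"
        using c' e z(1) zz cd le by auto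
      ultimately show ?thesis by simp
    qed
  qed
  then show ?thesis by (auto simp: c'_def intro!: exI[of _ c'])
qed

lemma cocycle_extend_far:
  fixes c :: "((nat \<Rightarrow> 'x) \<Rightarrow> (nat \<Rightarrow> 'x)) set \<Rightarrow> ((nat \<Rightarrow> 'x) \<Rightarrow> (nat \<Rightarrow> 'x)) set \<Rightarrow> 'k::group_add"
  assumes c: "cocycle m c" and big: "Suc m \<ge> 5 * card (UNIV :: 'x set)" and "m \<le> n"
  shows "\<exists>c'. cocycle n c' \<and> (\<forall>b b'. card b' \<le> m \<longrightarrow> c' b b' = c b b')"
  using assms(3)
proof (induction n rule: dec_induct)
  case base
  then show ?case using c by blast
next
  case (step n)
  then obtain c' where c': "cocycle n c'" "\<forall>b b'. card b' \<le> m \<longrightarrow> c' b b' = c b b'" by blast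
  have "Suc n \<ge> 5 * card (UNIV :: 'x set)" using step big by linarith
  then obtain c'' where "cocycle (Suc n) c''" "\<forall>b b'. card b' \<le> n \<longrightarrow> c'' b b' = c' b b'"
    using cocycle_extend[OF c'(1)] by blast
  then show ?case using c' step by (intro exI[of _ c'']) auto
qed

section \<open>Functions constant along edges\<close>

definition invariant :: "nat \<Rightarrow> (((nat \<Rightarrow> 'x) \<Rightarrow> (nat \<Rightarrow> 'x)) set \<Rightarrow> 't) \<Rightarrow> bool" where
  "invariant m F \<longleftrightarrow> (\<forall>b b'. edge b b' \<longrightarrow> card b' \<le> m \<longrightarrow> F b = F b')"

text \<open>The value at a new basis is forced to be that of any of its quotients, and two quotients
  are compared through a block disjoint from both.\<close>

lemma invariant_extend:
  assumes F: "invariant m F" and big: "Suc m \<ge> 5 * card (UNIV :: 'x set)"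
  shows "\<exists>F'. invariant (Suc m) F' \<and> (\<forall>b. card b \<le> m \<longrightarrow> F' b = F b)"
proof -
  have Fe: "F b = F b'" if "edge b b'" "card b' \<le> m" for b b' using F that by (auto simp: invariant_def)
  have dis: "F (quo u z) = F (quo u w)"
    if "basis u" "card u \<le> Suc m" "block u z" "block u w" "range z \<inter> range w = {}" for u z w
  proof -
    have w: "range w \<inter> range z = {}" using that(5) by auto
    have "edge (quo (quo u z) w) (quo u z)"
      by (rule edge_quo[OF basis_quo block_quo]) (use that in auto)
    moreover have "edge (quo (quo u z) w) (quo u w)"
      unfolding quo_quo[OF that(1,3-5)] by (rule edge_quo[OF basis_quo block_quo]) (use that w in auto)
    ultimately show ?thesis using Fe card_quo[OF that(1,3)] card_quo[OF that(1,4)] that(2)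
      by (metis less_Suc_eq_le order_less_le_trans)
  qed
  have indep: "F (quo u z) = F (quo u w)"
    if zw: "basis u" "card u = Suc m" "block u z" "block u w" for u z w
  proof -
    have "card (range z \<union> range w) \<le> 2 * card (UNIV :: 'x set)"
      using card_Un_le[of "range z" "range w"] card_range_block[of z] card_range_block[of w] by linarith
    then obtain t where t: "block u t" "range t \<inter> (range z \<union> range w) = {}"
      using block_avoiding[OF zw(1) order_refl, of "range z \<union> range w"] zw(2) big by auto
    have "F (quo u z) = F (quo u t)" "F (quo u w) = F (quo u t)"
      by (rule dis; use zw t in auto)+
    then show ?thesis by simp
  qed
  define F' where "F' u = (if card u \<le> m then F u else F (quo u (SOME z. block u z)))" for u
  have F': "F' u = F (quo u z)" if "basis u" "card u \<le> Suc m" "block u z" for u z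
  proof (cases "card u \<le> m")
    case True
    then show ?thesis using Fe[OF edge_quo[OF that(1,3)]] by (simp add: F'_def)
  next
    case False
    have "block u (SOME z. block u z)" using someI[of "block u" z] that by blast
    then show ?thesis using indep[OF that(1) _ _ that(3)] False that(2) by (simp add: F'_def)
  qed
  have "invariant (Suc m) F'" unfolding invariant_def
  proof (intro allI impI)
    fix b b' assume e: "edge b b'" "card b' \<le> Suc m"
    note le = edge_card(1)[OF e(1)]
    show "F' b = F' b'"
    proof (cases "card b' \<le> m")
      case True
      then show ?thesis using Fe[OF e(1)] le by (simp add: F'_def)
    next
      case False
      then obtain z :: "'x \<Rightarrow> _" where z: "inj z" "range z \<subseteq> b \<inter> b'" using common_block[OF e(1), of "{}"] big by auto
      then have bl: "block b z" "block b' z" by (auto simp: block_def)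
      have "F (quo b z) = F (quo b' z)"
        using Fe[OF edge_quo_quo[OF e(1) z]] card_quo[OF edge_basis(2)[OF e(1)] bl(2)] e(2) by simp
      then show ?thesis using F'[OF edge_basis(1)[OF e(1)] _ bl(1)] F'[OF edge_basis(2)[OF e(1)] _ bl(2)] e(2) le by simp
    qed
  qed
  then show ?thesis by (auto simp: F'_def intro!: exI[of _ F'])
qed

lemma invariant_extend_far:
  assumes F: "invariant m F" and big: "Suc m \<ge> 5 * card (UNIV :: 'x set)" and "m \<le> n"
  shows "\<exists>F'. invariant n F' \<and> (\<forall>b. card b \<le> m \<longrightarrow> F' b = F b)"
  using assms(3)
proof (induction n rule: dec_induct)
  case base
  then show ?case using F by blast
next
  case (step n)
  then obtain F' where F': "invariant n F'" "\<forall>b. card b \<le> m \<longrightarrow> F' b = F b" by blast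
  have "Suc n \<ge> 5 * card (UNIV :: 'x set)" using step big by linarith
  then obtain F'' where "invariant (Suc n) F''" "\<forall>b. card b \<le> n \<longrightarrow> F'' b = F' b"
    using invariant_extend[OF F'(1)] by blast
  then show ?case using F' step by (intro exI[of _ F'']) auto
qed

section \<open>Triviality of cocycles\<close>

text \<open>The chart $e$ can be cut, by repeated splitting, into charts that belong to $v$ up to a twist by $N$.\<close>

inductive rsv :: "((nat \<Rightarrow> 'x) \<Rightarrow> (nat \<Rightarrow> 'x)) set \<Rightarrow> ((nat \<Rightarrow> 'x) \<Rightarrow> (nat \<Rightarrow> 'x)) \<Rightarrow> bool"
  for v where
  rsv_hit: "g \<in> N \<Longrightarrow> twist e g \<in> v \<Longrightarrow> rsv v e"
| rsv_split: "(\<And>x. rsv v (sub e x)) \<Longrightarrow> rsv v e"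

lemma range_sub: "range (sub e x) \<subseteq> range e"
  by (auto simp: sub_apply)

lemma range_twist: "g \<in> G \<Longrightarrow> range (twist e g) = range e"
proof -
  assume g: "g \<in> G"
  have "e w = twist e g (act (Hilbert_Choice.inv g) w)" for w by (simp add: twist_apply act_inv_right g)
  then show ?thesis by (auto simp: twist_apply)
qed

lemma rsv_leaf: "rsv v e \<Longrightarrow> \<exists>p\<in>v. range p \<subseteq> range e"
proof (induction rule: rsv.induct)
  case (rsv_hit g e)
  then show ?case by (intro bexI[of _ "twist e g"]) (auto simp: range_twist N_G)
next
  case (rsv_split e)
  then obtain p where "p \<in> v" "range p \<subseteq> range (sub e undefined)" by blast
  then show ?case using range_sub[of e undefined] by (intro bexI[of _ p]) auto
qed

lemma range_meet: "basis v \<Longrightarrow> p \<in> v \<Longrightarrow> q \<in> v \<Longrightarrow> range p \<subseteq> range q \<Longrightarrow> p = q"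
proof -
  assume v: "basis v" "p \<in> v" "q \<in> v" "range p \<subseteq> range q"
  then obtain w where "p undefined = q w" by blast
  then show ?thesis by (rule basis_eq[OF v(1-3)])
qed

text \<open>Otherwise \<open>f\<close> would contain a whole chart of \<open>v\<close>, whose image
  would lie strictly inside that of \<open>twist e k\<close>. So a chart that matches
  \<open>v\<close> up to a twist in \<open>G\<close>, not only in \<open>N\<close>, has no resolved
  pieces.\<close>

lemma no_rsv_below_hit:
  assumes "basis v" "inj e" "k \<in> G" "twist e k \<in> v" "rsv v f" "range f \<subseteq> range (sub e x)"
  shows False
proof -
  obtain p where p: "p \<in> v" "range p \<subseteq> range f" using rsv_leaf[OF assms(5)] by blast
  have "range p \<subseteq> range (twist e k)"
    unfolding range_twist[OF assms(3)] using p(2) assms(6) range_sub[of e x] by (meson order_trans)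
  then have "p = twist e k" by (rule range_meet[OF assms(1) p(1) assms(4)])
  then have "range p = range e" by (simp add: range_twist[OF assms(3)])
  then have sub: "range e \<subseteq> range (sub e x)" using p(2) assms(6) by (metis order_trans)
  obtain \<omega> where \<omega>: "\<forall>w. conc [x] w \<noteq> \<omega>" using conc_Cons_not_surj[of x "[]"] by blast
  have "e \<omega> \<in> range (sub e x)" using sub by (rule subsetD) simp
  then obtain w where "e \<omega> = sub e x w" by (rule rangeE)
  then show False using \<omega> assms(2) by (auto simp: sub_apply inj_eq)
qed

section \<open>Canonical moves towards a refinement\<close>

definition hit where "hit v e \<longleftrightarrow> (\<exists>g\<in>N. twist e g \<in> v)"

lemma rsv_cases: "rsv v e \<Longrightarrow> hit v e \<or> (\<forall>x. rsv v (sub e x))"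
  by (erule rsv.cases) (auto simp: hit_def)

lemma hit_unique:
  assumes "basis v" "g \<in> G" "h \<in> G" "twist e g \<in> v" "twist e h \<in> v"
  shows "twist e g = twist e h"
  by (rule range_meet[OF assms(1,4,5)]) (simp add: range_twist assms(2,3))

text \<open>The next move towards \<open>v\<close>: finish if a twist in \<open>N\<close> leads into
  \<open>v\<close>, otherwise split without twists. The choice by \<open>SOME\<close> is harmless,
  since by \<open>hit_unique\<close> all admissible \<open>g\<close> give the same chart.\<close>

definition can where
  "can v e = (if hit v e then {twist e (SOME g. g \<in> N \<and> twist e g \<in> v)} else range (sub e))"

lemma can_some: "hit v e \<Longrightarrow> (SOME g. g \<in> N \<and> twist e g \<in> v) \<in> N \<and> twist e (SOME g. g \<in> N \<and> twist e g \<in> v) \<in> v"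
  by (rule someI_ex[of "\<lambda>g. g \<in> N \<and> twist e g \<in> v"]) (auto simp: hit_def)

lemma can_hit: "basis v \<Longrightarrow> hit v e \<Longrightarrow> g \<in> G \<Longrightarrow> twist e g \<in> v \<Longrightarrow> can v e = {twist e g}"
proof -
  assume a: "basis v" "hit v e" "g \<in> G" "twist e g \<in> v"
  note s = can_some[OF a(2)]
  show ?thesis using hit_unique[OF a(1) N_G[OF conjunct1[OF s]] a(3) conjunct2[OF s] a(4)] a(2) by (simp add: can_def)
qed

lemma can_leafmove: "leafmove e (can v e)"
  unfolding can_def using leafmove_twist[OF conjunct1[OF can_some[of v e]]] leafmove_sub by simp

lemma can_rsv: "rsv v e \<Longrightarrow> f \<in> can v e \<Longrightarrow> rsv v f"
proof (cases "hit v e")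
  case True
  assume "f \<in> can v e"
  then have "f \<in> v" using True conjunct2[OF can_some[OF True]] by (simp add: can_def)
  then show "rsv v f" using rsv_hit[OF id_N, of f v] by simp
next
  case False
  assume "rsv v e" "f \<in> can v e"
  then show "rsv v f" using False rsv_cases[of v e] by (auto simp: can_def)
qed

definition resolved where
  "resolved b v \<longleftrightarrow> basis b \<and> basis v \<and> (\<forall>e\<in>b. rsv v e)"

lemma resolvedD: "resolved b v \<Longrightarrow> basis b" "resolved b v \<Longrightarrow> basis v" "resolved b v \<Longrightarrow> e \<in> b \<Longrightarrow> rsv v e"
  by (auto simp: resolved_def)

definition cstep where "cstep v b e = b - {e} \<union> can v e"

lemma edge_cstep: "resolved b v \<Longrightarrow> e \<in> b \<Longrightarrow> edge b (cstep v b e)"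
  unfolding cstep_def by (rule edgeI[OF _ _ can_leafmove]) (auto simp: resolved_def)

lemma resolved_cstep: "resolved b v \<Longrightarrow> e \<in> b \<Longrightarrow> resolved (cstep v b e) v"
  using edge_basis(2)[OF edge_cstep[of b v e]] can_rsv[of v e] by (auto simp: resolved_def cstep_def)

text \<open>Different charts of \<open>b\<close> contain different charts of \<open>v\<close>. Hence
  the bases met on the way to \<open>v\<close> stay in the range where the cocycle is known.\<close>

lemma resolved_card: assumes "resolved b v" shows "card b \<le> card v"
proof -
  have "\<forall>e\<in>b. \<exists>p. p \<in> v \<and> range p \<subseteq> range e" using rsv_leaf resolvedD(3)[OF assms] by blast
  then obtain p where p: "\<And>e. e \<in> b \<Longrightarrow> p e \<in> v \<and> range (p e) \<subseteq> range e" by metis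
  have "inj_on p b"
  proof (rule inj_onI)
    fix e f assume ef: "e \<in> b" "f \<in> b" "p e = p f"
    have "p e undefined \<in> range e" "p e undefined \<in> range f" using p[of e] p[of f] ef by auto
    then obtain w w' where "p e undefined = e w" "p e undefined = f w'" by blast
    then show "e = f" using basis_eq[OF resolvedD(1)[OF assms] ef(1,2)] by metis
  qed
  then show ?thesis using card_inj_on_le[of p b v] p basis_finite[OF resolvedD(2)[OF assms]] by blast
qed

text \<open>A lexicographic order in one number: the charts still missing count first, then those
  outside \<open>v\<close>. For resolved \<open>b\<close> the second entry is at most
  \<open>card v\<close>, so the weight \<open>Suc (card v)\<close> dominates it.\<close>

definition mu where "mu v b = (card v - card b) * Suc (card v) + card (b - v)"

lemma mu_card:
  assumes "resolved b v" "resolved b' v" "card b < card b'"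
  shows "mu v b' < mu v b"
proof -
  have "card (b' - v) \<le> card v"
    using card_mono[of b' "b' - v"] basis_finite[OF resolvedD(1)[OF assms(2)]] resolved_card[OF assms(2)] by auto
  moreover have "card v - card b \<ge> Suc (card v - card b')" using resolved_card[OF assms(2)] assms(3) by linarith
  then have "(card v - card b) * Suc (card v) \<ge> Suc (card v - card b') * Suc (card v)" by (rule mult_le_mono1)
  ultimately show ?thesis unfolding mu_def by simp
qed

lemma mu_cstep:
  assumes "resolved b v" "e \<in> b" "e \<notin> v"
  shows "mu v (cstep v b e) < mu v b"
proof (cases "hit v e")
  case True
  then obtain g where g: "g \<in> N" "twist e g \<in> v" by (auto simp: hit_def)
  have c: "can v e = {twist e g}" using can_hit[OF resolvedD(2)[OF assms(1)] True N_G g(2)] g(1) by simp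
  have "card (cstep v b e) = card b - 1 + 1"
    using card_replace[OF resolvedD(1)[OF assms(1)] assms(2) can_leafmove[of e v]] by (simp add: cstep_def c)
  moreover have "card b > 0" using assms(2) basis_finite[OF resolvedD(1)[OF assms(1)]] card_gt_0_iff by blast
  moreover have "cstep v b e - v \<subset> b - v" using assms g(2) by (auto simp: cstep_def c)
  then have "card (cstep v b e - v) < card (b - v)"
    using basis_finite[OF resolvedD(1)[OF assms(1)]] by (intro psubset_card_mono) auto
  ultimately show ?thesis by (simp add: mu_def)
next
  case False
  have "card (range (sub e)) = card (UNIV :: 'x set)"
    using card_split[OF resolvedD(1)[OF assms(1)] assms(2), of "\<lambda>_. id"] id_N by simp
  then have "card (cstep v b e) = card b - 1 + card (UNIV :: 'x set)"
    using card_replace[OF resolvedD(1)[OF assms(1)] assms(2) can_leafmove[of e v]] False by (simp add: cstep_def can_def)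
  then have "card b < card (cstep v b e)" using two by linarith
  then show ?thesis by (rule mu_card[OF assms(1) resolved_cstep[OF assms(1,2)]])
qed

lemma resolved_induct [consumes 1, case_names start step]:
  assumes "resolved b v" "P v"
    and "\<And>b e. resolved b v \<Longrightarrow> e \<in> b \<Longrightarrow> e \<notin> v \<Longrightarrow> P (cstep v b e) \<Longrightarrow> P b"
  shows "P b"
  using assms(1)
proof (induction b rule: measure_induct_rule[of "mu v"])
  case (less b)
  show ?case
  proof (cases "b \<subseteq> v")
    case True
    then show ?thesis using basis_subset resolvedD[OF less.prems] assms(2) by blast
  next
    case False
    then obtain e where "e \<in> b" "e \<notin> v" by blast
    then show ?thesis
      using assms(3)[OF less.prems] less.IH mu_cstep[OF less.prems] resolved_cstep[OF less.prems] by blast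
  qed
qed

lemma replace_commute:
  assumes "basis b" "e \<in> b" "f \<in> b" "e \<noteq> f" "leafmove e r" "leafmove f s"
  shows "b - {e} \<union> r - {f} \<union> s = b - {f} \<union> s - {e} \<union> r"
proof -
  have "f \<notin> r" using basis_replace(2)[OF assms(1,2) leafmove_subdiv_basis[OF assms(1,2,5)]] assms by auto
  moreover have "e \<notin> s" using basis_replace(2)[OF assms(1,3) leafmove_subdiv_basis[OF assms(1,3,6)]] assms by auto
  ultimately show ?thesis using assms(4) by auto
qed

text \<open>Sums of $c$ along paths from $b$ to $v$ that only use the canonical steps; they depend on $b$ and $v$ only.\<close>

inductive pathval :: "_ \<Rightarrow> _ \<Rightarrow> _ \<Rightarrow> 'k::group_add \<Rightarrow> bool" for c v where
  pathval_done: "pathval c v v 0"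
| pathval_step: "e \<in> b \<Longrightarrow> e \<notin> v \<Longrightarrow> pathval c v (cstep v b e) k \<Longrightarrow> pathval c v b (c b (cstep v b e) + k)"

lemma pathval_ex: "resolved b v \<Longrightarrow> \<exists>k. pathval c v b k"
  by (induction rule: resolved_induct) (blast intro: pathval.intros)+

text \<open>Newman's argument: canonical moves at different charts commute and span a square of
  edges, and \<open>mu\<close> decreases along them.\<close>

lemma pathval_unique:
  assumes c: "cocycle m c" and v: "card v \<le> m"
  shows "resolved b v \<Longrightarrow> pathval c v b k \<Longrightarrow> pathval c v b k' \<Longrightarrow> k = k'"
proof (induction b arbitrary: k k' rule: measure_induct_rule[of "mu v"])
  case (less b)
  note b = resolvedD(1)[OF less.prems(1)]
  show ?case
  proof (cases "b = v")
    case True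
    then show ?thesis using less.prems(2,3) by (auto elim: pathval.cases)
  next
    case False
    from less.prems(2) False obtain e l where e: "e \<in> b" "e \<notin> v" "pathval c v (cstep v b e) l" "k = c b (cstep v b e) + l"
      by (cases rule: pathval.cases) auto
    from less.prems(3) False obtain f l' where f: "f \<in> b" "f \<notin> v" "pathval c v (cstep v b f) l'" "k' = c b (cstep v b f) + l'"
      by (cases rule: pathval.cases) auto
    note re = resolved_cstep[OF less.prems(1) e(1)] and rf = resolved_cstep[OF less.prems(1) f(1)]
    show ?thesis
    proof (cases "e = f")
      case True
      then show ?thesis using less.IH[OF mu_cstep[OF less.prems(1) e(1,2)] re e(3)] e f by blast
    next
      case ef: False
      have fe: "f \<in> cstep v b e" "e \<in> cstep v b f" using e f ef by (auto simp: cstep_def)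
      have com: "cstep v (cstep v b e) f = cstep v (cstep v b f) e"
        unfolding cstep_def using replace_commute[OF b e(1) f(1) ef can_leafmove can_leafmove] by blast
      note ref = resolved_cstep[OF re fe(1)]
      obtain l0 where l0: "pathval c v (cstep v (cstep v b e) f) l0" using pathval_ex[OF ref] by blast
      have "l = c (cstep v b e) (cstep v (cstep v b e) f) + l0"
        by (rule less.IH[OF mu_cstep[OF less.prems(1) e(1,2)] re e(3)]) (rule pathval_step[OF fe(1) f(2) l0])
      moreover have "l' = c (cstep v b f) (cstep v (cstep v b e) f) + l0"
        unfolding com
        by (rule less.IH[OF mu_cstep[OF less.prems(1) f(1,2)] rf f(3)]) (rule pathval_step[OF fe(2) e(2) l0[unfolded com]])
      moreover have "c b (cstep v b e) + c (cstep v b e) (cstep v (cstep v b e) f)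
           = c b (cstep v b f) + c (cstep v b f) (cstep v (cstep v b e) f)"
      proof (rule cocycle_square[OF c])
        show "edge b (cstep v b e)" "edge b (cstep v b f)" using edge_cstep less.prems(1) e f by auto
        show "edge (cstep v b e) (cstep v (cstep v b e) f)" by (rule edge_cstep[OF re fe(1)])
        show "edge (cstep v b f) (cstep v (cstep v b e) f)" unfolding com by (rule edge_cstep[OF rf fe(2)])
        show "card (cstep v (cstep v b e) f) \<le> m" using resolved_card[OF ref] v by simp
      qed
      ultimately show ?thesis using e(4) f(4) by (metis add.assoc)
    qed
  qed
qed

definition val where "val c v b = (THE k. pathval c v b k)"

lemma val_eq: "cocycle m c \<Longrightarrow> card v \<le> m \<Longrightarrow> resolved b v \<Longrightarrow> pathval c v b k \<Longrightarrow> val c v b = k"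
  unfolding val_def by (rule the_equality) (auto dest: pathval_unique)

text \<open>Charts already in \<open>v\<close> are included, although \<open>pathval\<close> allows
  no step there: the canonical move leaves \<open>b\<close> unchanged and
  \<open>c b b = 0\<close>.\<close>

lemma val_step:
  assumes "cocycle m c" "card v \<le> m" "resolved b v" "e \<in> b"
  shows "val c v b = c b (cstep v b e) + val c v (cstep v b e)"
proof (cases "e \<in> v")
  case True
  have "hit v e" unfolding hit_def using True id_N by (intro bexI[of _ id]) auto
  then have "can v e = {e}"
    using can_hit[OF resolvedD(2)[OF assms(3)] _ G_id] True by simp
  then have "cstep v b e = b" using assms(4) by (auto simp: cstep_def)
  moreover have "c b b = 0"
    using cocycle_refl[OF assms(1) resolvedD(1)[OF assms(3)]] resolved_card[OF assms(3)] assms(2) by simp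
  ultimately show ?thesis by simp
next
  case False
  obtain k where k: "pathval c v (cstep v b e) k" using pathval_ex[OF resolved_cstep[OF assms(3,4)]] by blast
  show ?thesis
    using val_eq[OF assms(1,2) resolved_cstep[OF assms(3,4)] k] val_eq[OF assms(1-3) pathval_step[OF assms(4) False k]] by simp
qed

text \<open>Canonical paths define \<open>val\<close>; the point is that arbitrary edges respect it
  too. A twisted splitting is reached from the canonical one by twisting the pieces one at a time,
  and a twist edge is compared by moving canonically from its far end. In both cases the auxiliary
  edges close triangles at \<open>b\<close>.\<close>

lemma val_edge:
  assumes c: "cocycle m c" and v: "card v \<le> m"
  shows "edge b b' \<Longrightarrow> resolved b v \<Longrightarrow> resolved b' v \<Longrightarrow> val c v b = c b b' + val c v b'"
proof (induction b arbitrary: b' rule: measure_induct_rule[of "mu v"])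
  case (less b)
  note bas = resolvedD(1)[OF less.prems(2)]
  have cm: "card b'' \<le> m" if "resolved b'' v" for b'' using resolved_card[OF that] v by simp
  have split: "val c v b = c b b' + val c v b'"
    if e: "e \<in> b" "\<not> hit v e" and h: "\<And>x. h x \<in> N" and b': "b' = b - {e} \<union> range (\<lambda>x. twist (sub e x) (h x))"
      and ref: "resolved b' v" for e h b'
  proof -
    \<comment> \<open>Only the letters in \<open>Y\<close> are twisted: \<open>a {}\<close> is the
      canonical step and \<open>a UNIV\<close> the given splitting.\<close>
    define a where "a Y = b - {e} \<union> range (\<lambda>x. twist (sub e x) (if x \<in> Y then h x else id))" for Y
    have ed: "edge b (a Y)" for Y
      unfolding a_def by (rule edgeI[OF bas e(1) leafmove_split]) (use h id_N in auto)
    have sx: "rsv v (sub e x)" for x using rsv_cases[OF resolvedD(3)[OF less.prems(2) e(1)]] e(2) by blast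
    have tx: "rsv v (twist (sub e x) (h x))" for x using resolvedD(3)[OF ref] b' by blast
    have ra: "resolved (a Y) v" for Y
      using edge_basis(2)[OF ed[of Y]] resolvedD[OF less.prems(2)] sx tx by (auto simp: resolved_def a_def)
    have cb: "card (a Y) > card b" for Y
    proof -
      have "card (a Y) = card b - 1 + card (UNIV :: 'x set)"
        unfolding a_def
        using card_replace[OF bas e(1) leafmove_split, of "\<lambda>x. if x \<in> Y then h x else id"]
          card_split[OF bas e(1), of "\<lambda>x. if x \<in> Y then h x else id"] h id_N by simp
      moreover have "card b > 0" using e(1) basis_finite[OF bas] card_gt_0_iff by blast
      ultimately show ?thesis using two by linarith
    qed
    have "val c v b = c b (a Y) + val c v (a Y)" for Y
      using finite[of Y]
    proof (induction Y rule: finite_induct)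
      case empty
      have "cstep v b e = a {}" using e(2) by (simp add: cstep_def can_def a_def)
      then show ?case using val_step[OF c v less.prems(2) e(1)] by simp
    next
      case (insert x Y)
      have se: "sub e x \<in> a Y" using insert(2) by (auto simp: a_def intro!: image_eqI[of _ _ x])
      have nb: "sub e x \<notin> b - {e}"
        using basis_replace(2)[OF bas e(1) leafmove_subdiv_basis[OF bas e(1) leafmove_sub]] by blast
      have other: "twist (sub e y) (if y \<in> Y then h y else id) \<noteq> sub e x" if "y \<noteq> x" for y
      proof
        let ?h = "\<lambda>y. if y \<in> Y then h y else id"
        assume "twist (sub e y) (?h y) = sub e x"
        then have eq: "twist (sub e y) (?h y) undefined = twist (sub e x) (?h x) undefined" using insert(2) by simp
        have hN: "?h t \<in> N" for t using h id_N by simp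
        show False using inj_twist_sub[OF basis_is_inj[OF bas e(1)] hN hN eq] \<open>y \<noteq> x\<close> by blast
      qed
      have "a (insert x Y) = a Y - {sub e x} \<union> {twist (sub e x) (h x)}"
      proof (intro equalityI subsetI)
        fix f assume "f \<in> a (insert x Y)"
        then consider "f \<in> b - {e}" | y where "f = twist (sub e y) (if y \<in> insert x Y then h y else id)"
          by (auto simp: a_def)
        then show "f \<in> a Y - {sub e x} \<union> {twist (sub e x) (h x)}"
        proof cases
          case 1
          then show ?thesis using nb by (auto simp: a_def)
        next
          case 2
          show ?thesis
          proof (cases "y = x")
            case False
            then have "f = twist (sub e y) (if y \<in> Y then h y else id)" using 2 by simp
            then show ?thesis using other[OF False] by (auto simp: a_def)
          qed (use 2 in simp)
        qed
      next
        fix f assume "f \<in> a Y - {sub e x} \<union> {twist (sub e x) (h x)}"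
        then consider "f = twist (sub e x) (h x)" | "f \<in> b - {e}"
          | y where "f = twist (sub e y) (if y \<in> Y then h y else id)" "f \<noteq> sub e x"
          by (auto simp: a_def)
        then show "f \<in> a (insert x Y)"
        proof cases
          case 1
          then show ?thesis by (auto simp: a_def intro!: image_eqI[of _ _ x])
        next
          case 2
          then show ?thesis by (simp add: a_def)
        next
          case 3
          then have "y \<noteq> x" using insert(2) by auto
          then show ?thesis using 3 by (auto simp: a_def intro!: image_eqI[of _ _ y])
        qed
      qed
      then have e2: "edge (a Y) (a (insert x Y))"
        using edgeI[OF edge_basis(2)[OF ed] se leafmove_twist[OF h]] by simp
      \<comment> \<open>Splitting has raised the number of charts, so \<open>mu\<close> has dropped
        and the induction hypothesis covers this twist edge.\<close>
      have "val c v (a Y) = c (a Y) (a (insert x Y)) + val c v (a (insert x Y))"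
        by (rule less.IH[OF mu_card[OF less.prems(2) ra cb] e2 ra ra])
      moreover have "c b (a Y) + c (a Y) (a (insert x Y)) = c b (a (insert x Y))"
        by (rule cocycle_triangle[OF c ed e2 ed cm[OF ra]])
      ultimately show ?case using insert(3) by (metis add.assoc)
    qed
    from this[of UNIV] show ?thesis by (simp add: a_def b')
  qed
  obtain e r where e: "e \<in> b" "leafmove e r" "b' = b - {e} \<union> r" using less.prems(1) by (auto simp: edge_def)
  note ie = basis_is_inj[OF bas e(1)]
  from e(2) consider g where "g \<in> N" "r = {twist e g}"
    | h where "\<And>x. h x \<in> N" "r = range (\<lambda>x. twist (sub e x) (h x))" unfolding leafmove_def by blast
  then show ?case
  proof cases
    case 2
    \<comment> \<open>The pieces of \<open>e\<close> in \<open>b'\<close> are resolved by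
      \<open>v\<close>, so \<open>e\<close> itself cannot match a chart of \<open>v\<close>; the
      canonical move at \<open>e\<close> is therefore a splitting as well.\<close>
    have "\<not> hit v e"
    proof
      assume "hit v e"
      then obtain k where k: "k \<in> N" "twist e k \<in> v" by (auto simp: hit_def)
      have "rsv v (twist (sub e undefined) (h undefined))" using resolvedD(3)[OF less.prems(3)] e(3) 2(2) by blast
      then show False
        using no_rsv_below_hit[OF resolvedD(2)[OF less.prems(2)] ie N_G[OF k(1)] k(2)] range_twist[OF N_G[OF 2(1)]] by blast
    qed
    then show ?thesis using split[OF e(1) _ 2(1) _ less.prems(3)] e(3) 2(2) by simp
  next
    case 1
    let ?f = "twist e g"
    have gG: "g \<in> G" using N_G 1(1) by blast
    have fb: "?f \<in> b'" using e(3) 1(2) by simp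
    have nf: "?f \<notin> b - {e}"
      using basis_replace(2)[OF bas e(1) leafmove_subdiv_basis[OF bas e(1) leafmove_twist[OF 1(1)]]] by blast
    have b'f: "b' - {?f} = b - {e}" using e(3) 1(2) nf by auto
    note s = val_step[OF c v less.prems(2) e(1)] and s' = val_step[OF c v less.prems(3) fb]
    note re' = resolved_cstep[OF less.prems(3) fb]
    show ?thesis
    proof (cases "hit v e")
      case True
      then obtain k where k: "k \<in> N" "twist e k \<in> v" by (auto simp: hit_def)
      let ?k = "Hilbert_Choice.inv g \<circ> k"
      have kG: "?k \<in> G" by (intro G_comp G_inv gG N_G k(1))
      have "g \<circ> ?k = k"
        using tree_aut_bij[OF G_tree_aut[OF gG]] by (simp add: fun_eq_iff bij_is_surj surj_f_inv_f)
      then have tk: "twist ?f ?k = twist e k" using twist_twist[OF gG kG, of e] by simp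
      \<comment> \<open>The element \<open>?k\<close> is only known to lie in \<open>G\<close>, so
        it does not witness \<open>hit\<close> by itself. But if \<open>?f\<close> had to be split,
        its pieces would be resolved inside a chart that already matches \<open>v\<close> up to
        \<open>G\<close>.\<close>
      have "hit v ?f"
      proof (rule ccontr)
        assume "\<not> hit v ?f"
        then have "rsv v (sub ?f undefined)" using rsv_cases[OF resolvedD(3)[OF less.prems(3) fb]] by blast
        then show False
          using no_rsv_below_hit[OF resolvedD(2)[OF less.prems(2)] basis_is_inj[OF resolvedD(1)[OF less.prems(3)] fb] kG]
            tk k(2) by (metis order_refl)
      qed
      then have "can v ?f = {twist e k}"
        using can_hit[OF resolvedD(2)[OF less.prems(2)] _ kG, of ?f] tk k(2) by simp
      moreover have "can v e = {twist e k}"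
        using can_hit[OF resolvedD(2)[OF less.prems(2)] True N_G[OF k(1)] k(2)] .
      ultimately have eq: "cstep v b' ?f = cstep v b e" unfolding cstep_def b'f by simp
      have "c b b' + c b' (cstep v b' ?f) = c b (cstep v b e)"
        unfolding eq
        using cocycle_triangle[OF c less.prems(1) _ edge_cstep[OF less.prems(2) e(1)] cm[OF resolved_cstep[OF less.prems(2) e(1)]]]
          edge_cstep[OF less.prems(3) fb] eq by simp
      then show ?thesis using s s' eq by (metis add.assoc)
    next
      case False
      have nhf: "\<not> hit v ?f"
      proof
        assume "hit v ?f"
        then obtain k where k: "k \<in> N" "twist ?f k \<in> v" by (auto simp: hit_def)
        have "twist e (g \<circ> k) \<in> v" using twist_twist[OF gG N_G[OF k(1)], of e] k(2) by simp
        moreover have "rsv v (sub e undefined)" using rsv_cases[OF resolvedD(3)[OF less.prems(2) e(1)]] False by blast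
        ultimately show False
          using no_rsv_below_hit[OF resolvedD(2)[OF less.prems(2)] ie G_comp[OF gG N_G[OF k(1)]]] by blast
      qed
      \<comment> \<open>The pieces of \<open>twist e g\<close>, relisted by the letters of
        \<open>e\<close>, which \<open>g\<close> permutes.\<close>
      define h where "h y = sect g [Hilbert_Choice.inv (lact g) y]" for y
      have hN: "h y \<in> N" for y unfolding h_def by (rule N_sect[OF 1(1)])
      have "sub ?f x = twist (sub e (lact g x)) (h (lact g x))" for x
        unfolding h_def using bij_lact[OF gG] by (simp add: sub_twist[OF gG] bij_is_inj inv_f_f)
      then have "range (sub ?f) = (\<lambda>y. twist (sub e y) (h y)) ` range (lact g)" by auto
      also have "range (lact g) = UNIV" using bij_lact[OF gG] by (rule bij_is_surj)
      finally have eq: "cstep v b' ?f = b - {e} \<union> range (\<lambda>y. twist (sub e y) (h y))"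
        unfolding cstep_def b'f can_def using nhf by simp
      have "edge b (cstep v b' ?f)" unfolding eq by (rule edgeI[OF bas e(1) leafmove_split[OF hN]])
      then have "c b b' + c b' (cstep v b' ?f) = c b (cstep v b' ?f)"
        using cocycle_triangle[OF c less.prems(1) edge_cstep[OF less.prems(3) fb] _ cm[OF re']] by blast
      moreover have "val c v b = c b (cstep v b' ?f) + val c v (cstep v b' ?f)"
        by (rule split[OF e(1) False hN eq re'])
      ultimately show ?thesis using s' by (metis add.assoc)
    qed
  qed
qed

section \<open>Refinement into a level of the tree\<close>

lemma rsv_deep: "(\<And>w. length w = n \<Longrightarrow> rsv v (e \<circ> conc w)) \<Longrightarrow> rsv v e"
proof (induction n arbitrary: e)
  case 0
  have "e \<circ> conc [] = e" by (auto simp: fun_eq_iff)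
  then show ?case using 0[of "[]"] by simp
next
  case (Suc n)
  have "rsv v (sub e x)" for x
  proof (rule Suc.IH)
    fix w :: "'x list" assume w: "length w = n"
    have eq: "sub e x \<circ> conc w = e \<circ> conc (x # w)" by (auto simp: fun_eq_iff sub_apply conc_Cons[of x w])
    show "rsv v (sub e x \<circ> conc w)" unfolding eq by (rule Suc.prems) (simp add: w)
  qed
  then show ?case by (rule rsv_split)
qed

definition lev :: "nat \<Rightarrow> ((nat \<Rightarrow> 'x) \<Rightarrow> (nat \<Rightarrow> 'x)) set" where
  "lev n = conc ` {w. length w = n}"

lemma basis_lev: "basis (lev n)"
  unfolding basis_def
proof (intro conjI ballI allI impI)
  show "finite (lev n)" unfolding lev_def using finite_lists_length_eq[of "UNIV :: 'x set" n] by simp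
  fix e assume "e \<in> lev n"
  then obtain u where u: "e = conc u" "length u = n" by (auto simp: lev_def)
  show "glocal e" unfolding u by (rule glocal_conc)
  fix f w w' assume "f \<in> lev n" and eq: "e w = f w'"
  then obtain u' where u': "f = conc u'" "length u' = n" by (auto simp: lev_def)
  have "u = u' \<and> w = w'" by (rule conc_same_length) (use u u' eq in auto)
  then show "e = f" "w = w'" using u u' by auto
next
  fix y :: "nat \<Rightarrow> 'x"
  show "\<exists>e\<in>lev n. \<exists>w. y = e w" using conc_split[of n y] by (auto simp: lev_def)
qed

text \<open>Contraction at work: on deep cylinders the chart is a word followed by an element of
  \<open>N\<close>, and one twist by its inverse leaves exactly a chart of
  \<open>lev n\<close>.\<close>

lemma rsv_lev_gform:
  assumes "gform e w"
  shows "\<exists>n0. \<forall>n\<ge>n0. rsv (lev n) (e \<circ> conc w)"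
proof -
  obtain u g where g: "g \<in> G" "e \<circ> conc w = conc u \<circ> act g" using assms by (rule gformE)
  obtain k where k: "\<forall>v. length v \<ge> k \<longrightarrow> sect g v \<in> N" using absorb[OF g(1)] by blast
  show ?thesis
  proof (intro exI[of _ "length u + k"] allI impI)
    fix n assume n: "n \<ge> length u + k"
    show "rsv (lev n) (e \<circ> conc w)"
    \<comment> \<open>The output prefix is \<open>u @ g t\<close>, so words \<open>t\<close> of
      length \<open>n - length u\<close>, which is at least \<open>k\<close>, land exactly on level
      \<open>n\<close>.\<close>
    proof (rule rsv_deep[of "n - length u"])
      fix t :: "'x list" assume t: "length t = n - length u"
      have s: "sect g t \<in> N" using k t n by simp
      have "twist (e \<circ> conc w \<circ> conc t) (Hilbert_Choice.inv (sect g t)) = conc (u @ g t)"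
      proof
        fix \<omega>
        have "twist (e \<circ> conc w \<circ> conc t) (Hilbert_Choice.inv (sect g t)) \<omega>
            = conc u (act g (conc t (act (Hilbert_Choice.inv (sect g t)) \<omega>)))"
          by (simp add: twist_apply g(2))
        then show "twist (e \<circ> conc w \<circ> conc t) (Hilbert_Choice.inv (sect g t)) \<omega> = conc (u @ g t) \<omega>"
          by (simp add: act_conc[OF G_tree_aut[OF g(1)]] act_inv_right N_G s conc_append)
      qed
      moreover have "length (u @ g t) = n" using t n tree_aut_length[OF G_tree_aut[OF g(1)]] by simp
      ultimately have "twist (e \<circ> conc w \<circ> conc t) (Hilbert_Choice.inv (sect g t)) \<in> lev n" by (simp add: lev_def)
      then show "rsv (lev n) (e \<circ> conc w \<circ> conc t)" by (rule rsv_hit[OF N_inv[OF s]])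
    qed
  qed
qed

lemma eventually_finite:
  assumes "finite A" "\<And>a. a \<in> A \<Longrightarrow> \<exists>n0::nat. \<forall>n\<ge>n0. P a n"
  shows "\<exists>n0. \<forall>n\<ge>n0. \<forall>a\<in>A. P a n"
  using eventually_ball_finite[of A "\<lambda>n a. P a n" sequentially] assms by (auto simp: eventually_sequentially)

lemma resolved_lev:
  assumes "basis b"
  shows "\<exists>n0. \<forall>n\<ge>n0. resolved b (lev n)"
proof -
  have ev: "\<exists>n0. \<forall>n\<ge>n0. rsv (lev n) e" if e: "e \<in> b" for e
  proof -
    obtain k where k: "\<forall>w. length w = k \<longrightarrow> gform e w"
      using basis_glocal[OF assms e] by (auto simp: glocal_def)
    have "\<exists>n0. \<forall>n\<ge>n0. \<forall>w\<in>{w. length w = k}. rsv (lev n) (e \<circ> conc w)"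
    proof (rule eventually_finite)
      show "finite {w :: 'x list. length w = k}" using finite_lists_length_eq[of "UNIV :: 'x set" k] by simp
      fix w :: "'x list" assume "w \<in> {w. length w = k}"
      then have "gform e w" using k by blast
      then show "\<exists>n0. \<forall>n\<ge>n0. rsv (lev n) (e \<circ> conc w)" by (rule rsv_lev_gform)
    qed
    then obtain n0 where n0: "\<forall>n\<ge>n0. \<forall>w\<in>{w. length w = k}. rsv (lev n) (e \<circ> conc w)" by (elim exE)
    show ?thesis
    proof (intro exI[of _ n0] allI impI)
      fix n assume n: "n \<ge> n0"
      show "rsv (lev n) e"
        by (rule rsv_deep[of k]) (rule n0[rule_format, OF n], simp)
    qed
  qed
  have "\<exists>n0. \<forall>n\<ge>n0. \<forall>e\<in>b. rsv (lev n) e"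
    by (rule eventually_finite[OF basis_finite[OF assms] ev])
  then show ?thesis using assms basis_lev by (auto simp: resolved_def)
qed

lemma common_lev:
  assumes "finite B" "\<And>b. b \<in> B \<Longrightarrow> basis b"
  shows "\<exists>n. \<forall>b\<in>B. resolved b (lev n)"
  using eventually_finite[OF assms(1) resolved_lev[OF assms(2)]] by (meson order_refl)

text \<open>The level depends on \<open>B\<close> and may have far more than \<open>m\<close>
  charts; this is why \<open>c\<close> is extended beyond its range before \<open>val\<close> is
  used. Potentials for different \<open>B\<close> need not be compatible.\<close>

theorem local_potential:
  fixes c :: "((nat \<Rightarrow> 'x) \<Rightarrow> (nat \<Rightarrow> 'x)) set \<Rightarrow> ((nat \<Rightarrow> 'x) \<Rightarrow> (nat \<Rightarrow> 'x)) set \<Rightarrow> 'k::group_add"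
  assumes c: "cocycle m c" and big: "Suc m \<ge> 5 * card (UNIV :: 'x set)"
    and B: "finite B" "\<And>b. b \<in> B \<Longrightarrow> basis b"
  shows "\<exists>\<phi>. \<forall>b\<in>B. \<forall>b'\<in>B. edge b b' \<longrightarrow> card b' \<le> m \<longrightarrow> c b b' = - \<phi> b + \<phi> b'"
proof -
  obtain n where n: "\<forall>b\<in>B. resolved b (lev n)" using common_lev[OF B] by blast
  obtain c' where c': "cocycle (max m (card (lev n))) c'" "\<forall>b b'. card b' \<le> m \<longrightarrow> c' b b' = c b b'"
    using cocycle_extend_far[OF c big, of "max m (card (lev n))"] by auto
  have "c b b' = - (- val c' (lev n) b) + - val c' (lev n) b'"
    if "b \<in> B" "b' \<in> B" "edge b b'" "card b' \<le> m" for b b'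
    using val_edge[OF c'(1) _ that(3), of "lev n"] n that c'(2) by simp
  then show ?thesis by (intro exI[of _ "\<lambda>b. - val c' (lev n) b"]) blast
qed

lemma invariant_resolved:
  assumes "resolved b v" "invariant m F" "card v \<le> m"
  shows "F b = F v"
  using assms(1)
proof (induction rule: resolved_induct)
  case (step b e)
  have "card (cstep v b e) \<le> m" using resolved_card[OF resolved_cstep[OF step(1,2)]] assms(3) by simp
  then show ?case using assms(2) edge_cstep[OF step(1,2)] step(4) by (auto simp: invariant_def)
qed simp

text \<open>Both bases refine into one level, and after extension their values are the value at that
  level.\<close>

theorem invariant_constant:
  assumes F: "invariant m F" and big: "Suc m \<ge> 5 * card (UNIV :: 'x set)"
    and b: "basis b" "card b \<le> m" "basis b'" "card b' \<le> m"
  shows "F b = F b'"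
proof -
  obtain n where n: "resolved b (lev n)" "resolved b' (lev n)" using common_lev[of "{b, b'}"] b by auto
  obtain F' where F': "invariant (max m (card (lev n))) F'" "\<forall>b. card b \<le> m \<longrightarrow> F' b = F b"
    using invariant_extend_far[OF F big, of "max m (card (lev n))"] by auto
  show ?thesis using invariant_resolved[OF n(1) F'(1)] invariant_resolved[OF n(2) F'(1)] F'(2) b by auto
qed

text \<open>Each canonical move changes the size by 0 or by d - 1, so sizes are invariant modulo d -
  1 under refinement.\<close>

lemma resolved_card_mod:
  assumes "resolved b v"
  shows "\<exists>j. card v = card b + j * (card (UNIV :: 'x set) - 1)"
  using assms
proof (induction rule: resolved_induct)
  case (step b e)
  then obtain j where j: "card v = card (cstep v b e) + j * (card (UNIV :: 'x set) - 1)" by blast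
  from edge_card(2)[OF edge_cstep[OF step(1,2)]] show ?case
  proof
    assume "card (cstep v b e) = card b"
    then show ?thesis using j by auto
  next
    assume "card (cstep v b e) = card b + (card (UNIV :: 'x set) - 1)"
    then show ?thesis using j by (intro exI[of _ "Suc j"]) simp
  qed
qed simp

section \<open>The action on bases and the generating set\<close>

lemma glocal_comp: assumes "glocal f" "glocal e" shows "glocal (f \<circ> e)"
proof -
  obtain n where n: "\<forall>w. length w \<ge> n \<longrightarrow> gform f w" using glocal_deep[OF assms(1)] by blast
  obtain k where k: "\<forall>w. length w = k \<longrightarrow> gform e w" using assms(2) by (auto simp: glocal_def)
  show ?thesis unfolding glocal_def
  proof (intro exI[of _ "k + n"] allI impI)
    fix w :: "'x list" assume w: "length w = k + n"
    define w1 w2 where "w1 = take k w" and "w2 = drop k w"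
    have ww: "w = w1 @ w2" "length w1 = k" "length w2 = n" using w by (auto simp: w1_def w2_def)
    have "gform e w1" using k ww by simp
    then obtain u g where g: "g \<in> G" "e \<circ> conc w1 = conc u \<circ> act g" by (rule gformE)
    \<comment> \<open>Reading \<open>n\<close> letters after \<open>w1\<close> makes the output
      prefix of \<open>e\<close> long enough for \<open>f\<close>.\<close>
    have "length (u @ g w2) \<ge> n" using ww tree_aut_length[OF G_tree_aut[OF g(1)]] by simp
    then have "gform f (u @ g w2)" using n by blast
    then obtain u' g' where g': "g' \<in> G" "f \<circ> conc (u @ g w2) = conc u' \<circ> act g'" by (rule gformE)
    have "(f \<circ> e \<circ> conc w) \<omega> = (conc u' \<circ> act (g' \<circ> sect g w2)) \<omega>" for \<omega>
    proof -
      have "(f \<circ> e \<circ> conc w) \<omega> = f ((e \<circ> conc w1) (conc w2 \<omega>))" by (simp add: ww(1) conc_append)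
      also have "\<dots> = (f \<circ> conc (u @ g w2)) (act (sect g w2) \<omega>)"
        unfolding g(2) by (simp add: act_conc[OF G_tree_aut[OF g(1)]] conc_append)
      also have "\<dots> = (conc u' \<circ> act (g' \<circ> sect g w2)) \<omega>"
        unfolding g'(2) using act_comp[OF G_tree_aut[OF g'(1)] G_tree_aut[OF G_sect[OF g(1)]]] by simp
      finally show ?thesis .
    qed
    then have "f \<circ> e \<circ> conc w = conc u' \<circ> act (g' \<circ> sect g w2)" by blast
    then show "gform (f \<circ> e) w" by (rule gformI[OF G_comp[OF g'(1) G_sect[OF g(1)]]])
  qed
qed

text \<open>Transitivity on bases of equal size. The map \<open>h\<close> is defined chart by chart;
  only its local form needs work, since a cylinder in its source must be small enough to lie in the
  image of one chart.\<close>

lemma basis_transport: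
  assumes b: "basis b" and b': "basis b'" and \<beta>: "bij_betw \<beta> b b'"
  shows "\<exists>h. basis {h} \<and> (\<forall>e\<in>b. h \<circ> e = \<beta> e)"
proof -
  have "\<forall>y. \<exists>p. fst p \<in> b \<and> y = fst p (snd p)" using basis_cover[OF b] by (metis fst_conv snd_conv)
  then obtain p where p: "\<And>y. fst (p y) \<in> b" "\<And>y. y = fst (p y) (snd (p y))" by metis
  define h where "h y = \<beta> (fst (p y)) (snd (p y))" for y
  have \<beta>b: "\<beta> e \<in> b'" if "e \<in> b" for e using \<beta> that by (auto simp: bij_betw_def)
  have he: "h (e w) = \<beta> e w" if "e \<in> b" for e w
  proof -
    have "fst (p (e w)) = e" by (rule basis_eq[OF b p(1) that p(2)[symmetric]])
    moreover from this have "snd (p (e w)) = w" using basis_inj[OF b that] p(2)[of "e w"] by metis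
    ultimately show ?thesis by (simp add: h_def)
  qed
  have inj: "y = y'" if "h y = h y'" for y y'
  proof -
    have eq: "\<beta> (fst (p y)) (snd (p y)) = \<beta> (fst (p y')) (snd (p y'))" using that by (simp add: h_def)
    have 1: "\<beta> (fst (p y)) = \<beta> (fst (p y'))" by (rule basis_eq[OF b' \<beta>b[OF p(1)] \<beta>b[OF p(1)] eq])
    then have "fst (p y) = fst (p y')" using \<beta> p(1) by (auto simp: bij_betw_def dest: inj_onD)
    moreover have "\<beta> (fst (p y)) (snd (p y)) = \<beta> (fst (p y)) (snd (p y'))"
      using eq by (simp only: 1)
    then have "snd (p y) = snd (p y')" by (rule basis_inj[OF b' \<beta>b[OF p(1)[of y]]])
    ultimately show ?thesis using p(2) by metis
  qed
  have surj: "\<exists>w. y = h w" for y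
  proof -
    obtain f w where f: "f \<in> b'" "y = f w" using basis_cover[OF b'] by blast
    then obtain e where "e \<in> b" "f = \<beta> e" using \<beta> by (auto simp: bij_betw_def)
    then show ?thesis using he f by metis
  qed
  obtain n1 where n1: "\<forall>e\<in>b. \<forall>w. length w \<ge> n1 \<longrightarrow> gform e w"
    using glocal_finite[of b] basis_finite[OF b] basis_glocal[OF b] by blast
  obtain n2 where n2: "\<forall>e\<in>b'. \<forall>w. length w \<ge> n2 \<longrightarrow> gform e w"
    using glocal_finite[of b'] basis_finite[OF b'] basis_glocal[OF b'] by blast
  define n where "n = max n1 n2"
  let ?W = "{w :: 'x list. length w = n}"
  have "\<forall>q\<in>b \<times> ?W. \<exists>ug. snd ug \<in> G \<and> fst q \<circ> conc (snd q) = conc (fst ug) \<circ> act (snd ug)"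
  proof
    fix q assume "q \<in> b \<times> ?W"
    then have "gform (fst q) (snd q)" using n1 by (auto simp: n_def)
    then obtain u g where "g \<in> G" "fst q \<circ> conc (snd q) = conc u \<circ> act g" by (rule gformE)
    then show "\<exists>ug. snd ug \<in> G \<and> fst q \<circ> conc (snd q) = conc (fst ug) \<circ> act (snd ug)"
      by (intro exI[of _ "(u, g)"]) simp
  qed
  from bchoice[OF this] obtain ug where ug: "\<And>e w. e \<in> b \<Longrightarrow> length w = n \<Longrightarrow> snd (ug (e, w)) \<in> G"
    "\<And>e w. e \<in> b \<Longrightarrow> length w = n \<Longrightarrow> e \<circ> conc w = conc (fst (ug (e, w))) \<circ> act (snd (ug (e, w)))" by auto
  have finW: "finite (b \<times> ?W)" using basis_finite[OF b] finite_lists_length_eq[of "UNIV :: 'x set" n] by simp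
  \<comment> \<open>A cylinder of this depth that meets a piece
    \<open>range (e \<circ> conc w)\<close> lies inside it, because the prefix \<open>u\<close>
    describing that piece is no longer than \<open>m\<close>.\<close>
  define m where "m = Max (insert 0 ((\<lambda>q. length (fst (ug q))) ` (b \<times> ?W)))"
  have m: "length (fst (ug (e, w))) \<le> m" if "e \<in> b" "length w = n" for e w
    unfolding m_def by (rule Max_ge) (use finW that in auto)
  have "glocal h" unfolding glocal_def
  proof (intro exI[of _ m] allI impI)
    fix t :: "'x list" assume t: "length t = m"
    obtain e \<rho> where e: "e \<in> b" "conc t undefined = e \<rho>" using basis_cover[OF b] by blast
    obtain w \<rho>' where w: "length w = n" "\<rho> = conc w \<rho>'" using conc_split[of n \<rho>] by blast
    define u g where "u = fst (ug (e, w))" and "g = snd (ug (e, w))"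
    have g: "g \<in> G" "e \<circ> conc w = conc u \<circ> act g" using ug[OF e(1) w(1)] by (auto simp: u_def g_def)
    have "conc u (act g \<rho>') = conc t undefined" using e(2) fun_cong[OF g(2), of \<rho>'] w(2) by simp
    moreover have "length u \<le> length t" using m[OF e(1) w(1)] t by (simp add: u_def)
    ultimately obtain s where s: "t = u @ s" using conc_comparable by blast
    let ?i = "Hilbert_Choice.inv g"
    have iG: "?i \<in> G" by (rule G_inv[OF g(1)])
    have key: "(h \<circ> conc t) \<omega> = (\<beta> e \<circ> conc (w @ ?i s)) (act (sect ?i s) \<omega>)" for \<omega>
    proof -
      have "conc t \<omega> = (conc u \<circ> act g) (act ?i (conc s \<omega>))" by (simp add: s conc_append act_inv_right[OF g(1)])
      also have "\<dots> = e (conc w (act ?i (conc s \<omega>)))" unfolding g(2)[symmetric] by simp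
      finally have "h (conc t \<omega>) = \<beta> e (conc w (act ?i (conc s \<omega>)))" using he[OF e(1)] by simp
      then show ?thesis by (simp add: act_conc[OF G_tree_aut[OF iG]] conc_append)
    qed
    have "gform (\<beta> e) (w @ ?i s)" using n2 \<beta>b[OF e(1)] w(1) by (auto simp: n_def)
    then obtain u' g' where g': "g' \<in> G" "\<beta> e \<circ> conc (w @ ?i s) = conc u' \<circ> act g'" by (rule gformE)
    have "h \<circ> conc t = conc u' \<circ> act (g' \<circ> sect ?i s)"
    proof
      fix \<omega>
      show "(h \<circ> conc t) \<omega> = (conc u' \<circ> act (g' \<circ> sect ?i s)) \<omega>"
        unfolding key g'(2) using act_comp[OF G_tree_aut[OF g'(1)] G_tree_aut[OF G_sect[OF iG]]] by simp
    qed
    then show "gform h t" by (rule gformI[OF G_comp[OF g'(1) G_sect[OF iG]]])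
  qed
  then have "basis {h}" unfolding basis_def using inj surj by simp
  moreover have "\<forall>e\<in>b. h \<circ> e = \<beta> e" using he by (auto simp: fun_eq_iff)
  ultimately show ?thesis by blast
qed

section \<open>The group of one-element bases and its action\<close>

definition img :: "((nat \<Rightarrow> 'x) \<Rightarrow> (nat \<Rightarrow> 'x)) \<Rightarrow> ((nat \<Rightarrow> 'x) \<Rightarrow> (nat \<Rightarrow> 'x)) set \<Rightarrow> ((nat \<Rightarrow> 'x) \<Rightarrow> (nat \<Rightarrow> 'x)) set" where
  "img h b = (\<lambda>e. h \<circ> e) ` b"

definition H where "H = {h. basis {h}}"

lemma H_inj: "h \<in> H \<Longrightarrow> inj h" by (rule basis_is_inj[of "{h}"]) (simp_all add: H_def)

lemma H_surj: "h \<in> H \<Longrightarrow> surj h"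
  using basis_cover[of "{h}"] by (simp add: H_def surj_def)

lemma H_glocal: "h \<in> H \<Longrightarrow> glocal h" by (rule basis_glocal[of "{h}"]) (simp_all add: H_def)

lemma H_I: "inj h \<Longrightarrow> surj h \<Longrightarrow> glocal h \<Longrightarrow> h \<in> H"
  unfolding H_def basis_def surj_def by (simp add: inj_eq)

lemma H_id: "id \<in> H"
  by (rule H_I) (auto simp: glocal_id)

lemma H_comp: "h \<in> H \<Longrightarrow> k \<in> H \<Longrightarrow> h \<circ> k \<in> H"
  by (rule H_I[OF inj_compose[OF H_inj H_inj] comp_surj[OF H_surj H_surj] glocal_comp[OF H_glocal H_glocal]])

lemma H_inv_left: "h \<in> H \<Longrightarrow> Hilbert_Choice.inv h \<circ> h = id"
  by (simp add: H_inj)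

lemma H_inv_right: "h \<in> H \<Longrightarrow> h \<circ> Hilbert_Choice.inv h = id"
  using H_surj by (simp add: fun_eq_iff surj_f_inv_f)

text \<open>Transport from the basis \<open>{h}\<close> to \<open>{id}\<close> produces the inverse
  together with its local form.\<close>

lemma H_inv: assumes "h \<in> H" shows "Hilbert_Choice.inv h \<in> H"
proof -
  obtain k where k: "basis {k}" "k \<circ> h = id"
    using basis_transport[of "{h}" "{id}" "\<lambda>_. id"] assms H_id by (auto simp: H_def bij_betw_def)
  have "k = Hilbert_Choice.inv h"
    using k(2) H_inv_right[OF assms] by (metis comp_assoc comp_id id_comp)
  then show ?thesis using k(1) by (simp add: H_def)
qed

lemma img_img: "img h (img k b) = img (h \<circ> k) b"
  by (auto simp: img_def image_image comp_assoc)

lemma img_id [simp]: "img id b = b"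
  by (simp add: img_def)

lemma inj_comp_left: "h \<in> H \<Longrightarrow> h \<circ> e = h \<circ> f \<longleftrightarrow> e = f"
  using H_inv_left by (metis comp_assoc id_comp)

lemma card_img: "h \<in> H \<Longrightarrow> card (img h b) = card b"
  unfolding img_def by (rule card_image) (auto simp: inj_on_def inj_comp_left)

lemma basis_img: assumes "h \<in> H" "basis b" shows "basis (img h b)"
  unfolding basis_def
proof (intro conjI ballI allI impI)
  show "finite (img h b)" using basis_finite[OF assms(2)] by (simp add: img_def)
  fix e assume "e \<in> img h b"
  then obtain e' where e: "e = h \<circ> e'" "e' \<in> b" by (auto simp: img_def)
  show "glocal e" unfolding e(1) by (intro glocal_comp H_glocal assms(1) basis_glocal[OF assms(2) e(2)])
  fix f w w' assume "f \<in> img h b" and eq: "e w = f w'"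
  then obtain f' where f: "f = h \<circ> f'" "f' \<in> b" by (auto simp: img_def)
  have "e' w = f' w'" using eq H_inj[OF assms(1)] unfolding e f by (simp add: inj_eq)
  then have "e' = f'" by (rule basis_eq[OF assms(2) e(2) f(2)])
  moreover from this have "w = w'" using basis_inj[OF assms(2) e(2)] \<open>e' w = f' w'\<close> by blast
  ultimately show "e = f" "w = w'" using e f by auto
next
  fix y
  obtain e w where e: "e \<in> b" "Hilbert_Choice.inv h y = e w" using basis_cover[OF assms(2)] by blast
  have "y = h (Hilbert_Choice.inv h y)" using H_surj[OF assms(1)] by (simp add: surj_f_inv_f)
  then show "\<exists>e\<in>img h b. \<exists>w. y = e w" using e by (auto simp: img_def)
qed

lemma twist_comp: "twist (h \<circ> e) g = h \<circ> twist e g" by (simp add: twist_def comp_assoc)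
lemma sub_comp: "sub (h \<circ> e) x = h \<circ> sub e x" by (simp add: sub_def comp_assoc)

lemma leafmove_img: "leafmove e r \<Longrightarrow> leafmove (h \<circ> e) (img h r)"
  unfolding leafmove_def
proof (elim disjE bexE exE conjE)
  fix g assume "g \<in> N" "r = {twist e g}"
  then show "(\<exists>g\<in>N. img h r = {twist (h \<circ> e) g}) \<or> (\<exists>k. (\<forall>x. k x \<in> N) \<and> img h r = range (\<lambda>x. twist (sub (h \<circ> e) x) (k x)))"
    by (intro disjI1 bexI[of _ g]) (simp add: img_def twist_comp)
next
  fix k assume "\<forall>x. k x \<in> N" "r = range (\<lambda>x. twist (sub e x) (k x))"
  then show "(\<exists>g\<in>N. img h r = {twist (h \<circ> e) g}) \<or> (\<exists>k. (\<forall>x. k x \<in> N) \<and> img h r = range (\<lambda>x. twist (sub (h \<circ> e) x) (k x)))"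
    by (intro disjI2 exI[of _ k]) (simp add: img_def twist_comp sub_comp image_image)
qed

lemma edge_img: assumes "h \<in> H" "edge b b'" shows "edge (img h b) (img h b')"
proof -
  obtain e r where e: "basis b" "e \<in> b" "leafmove e r" "b' = b - {e} \<union> r" using assms(2) by (auto simp: edge_def)
  have "img h b' = img h b - {h \<circ> e} \<union> img h r"
    unfolding e(4) img_def using inj_comp_left[OF assms(1)] by auto
  moreover have "h \<circ> e \<in> img h b" using e(2) by (simp add: img_def)
  ultimately show ?thesis using edgeI[OF basis_img[OF assms(1) e(1)] _ leafmove_img[OF e(3)]] by simp
qed

text \<open>One representative for each size. Which chart is split does not matter, but consecutive
  representatives are joined by an edge, and \<open>local_lift\<close> uses this to compare
  sizes.\<close>

fun std_basis :: "nat \<Rightarrow> ((nat \<Rightarrow> 'x) \<Rightarrow> (nat \<Rightarrow> 'x)) set" where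
  "std_basis 0 = {id}"
| "std_basis (Suc j) = std_basis j - {SOME e. e \<in> std_basis j} \<union> range (sub (SOME e. e \<in> std_basis j))"

lemma basis_B: "basis (std_basis j)" and edge_B: "edge (std_basis j) (std_basis (Suc j))"
proof -
  have e: "edge (std_basis j) (std_basis (Suc j))" if "basis (std_basis j)" for j
    using edgeI[OF that _ leafmove_sub, of "SOME e. e \<in> std_basis j"] basis_nonempty[OF that] some_in_eq[of "std_basis j"] by auto
  show b: "basis (std_basis j)"
  proof (induction j)
    case 0
    then show ?case using H_id by (simp add: H_def)
  next
    case (Suc j)
    then show ?case using edge_basis(2)[OF e] by blast
  qed
  show "edge (std_basis j) (std_basis (Suc j))" by (rule e[OF b])
qed

lemma card_B: "card (std_basis j) = 1 + j * (card (UNIV :: 'x set) - 1)"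
proof (induction j)
  case (Suc j)
  let ?e = "SOME e. e \<in> std_basis j"
  have e: "?e \<in> std_basis j" using basis_nonempty[OF basis_B[of j]] some_in_eq[of "std_basis j"] by auto
  have "card (range (sub ?e)) = card (UNIV :: 'x set)"
    using card_split[OF basis_B e, of "\<lambda>_. id"] id_N by simp
  then have "card (std_basis (Suc j)) = card (std_basis j) - 1 + card (UNIV :: 'x set)"
    using card_replace[OF basis_B e leafmove_sub] by simp
  then show ?case using Suc two by simp
qed simp

lemma card_B_inj: "card (std_basis i) = card (std_basis j) \<Longrightarrow> i = j"
  using card_B two by simp

text \<open>A level that refines both \<open>b\<close> and \<open>{id}\<close> shows that the size
  of \<open>b\<close> has the form 1 + j(d - 1); \<open>basis_transport\<close> then supplies the
  group element.\<close>

lemma orbit_rep: assumes "basis b" shows "\<exists>h j. h \<in> H \<and> b = img h (std_basis j)"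
proof -
  obtain n where n: "resolved b (lev n)" "resolved (std_basis 0) (lev n)"
    using common_lev[of "{b, std_basis 0}"] assms basis_B[of 0] by auto
  obtain i j where ij: "card (lev n) = card b + j * (card (UNIV :: 'x set) - 1)"
     "card (lev n) = 1 + i * (card (UNIV :: 'x set) - 1)"
    using resolved_card_mod[OF n(1)] resolved_card_mod[OF n(2)] by auto
  have pos: "card b \<ge> 1" using basis_nonempty[OF assms] basis_finite[OF assms] by (simp add: Suc_leI card_gt_0_iff)
  have le: "j * (card (UNIV :: 'x set) - 1) \<le> i * (card (UNIV :: 'x set) - 1)" using ij pos by linarith
  then have "j \<le> i" using two by simp
  then have "card b = 1 + (i - j) * (card (UNIV :: 'x set) - 1)"
    unfolding diff_mult_distrib using ij le by linarith
  then have "card b = card (std_basis (i - j))" by (simp add: card_B)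
  then obtain \<beta> where \<beta>: "bij_betw \<beta> (std_basis (i - j)) b"
    using finite_same_card_bij[of "std_basis (i - j)" b] basis_finite[OF assms] basis_finite[OF basis_B] by auto
  obtain h where h: "basis {h}" "\<forall>e\<in>std_basis (i - j). h \<circ> e = \<beta> e" using basis_transport[OF basis_B assms \<beta>] by blast
  then have "img h (std_basis (i - j)) = b" using \<beta> by (auto simp: img_def bij_betw_def)
  then show ?thesis using h(1) by (auto simp: H_def)
qed

text \<open>The bound 10 makes the largest basis allowed have $10(d-1)+1 \ge 5d-1$ charts, as the extension of cocycles requires.\<close>

definition gen_set where
  "gen_set = {s \<in> H. \<exists>j\<le>10. \<exists>j'\<le>10. edge (std_basis j) (img s (std_basis j'))}"

lemma finite_leafmove: "finite {r. leafmove e r}"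
proof -
  have "{h :: 'x \<Rightarrow> 'x list \<Rightarrow> 'x list. \<forall>x. h x \<in> N} = PiE UNIV (\<lambda>_. N)" by (auto simp: PiE_def)
  then have "finite {h :: 'x \<Rightarrow> 'x list \<Rightarrow> 'x list. \<forall>x. h x \<in> N}" using finite_PiE[of "UNIV :: 'x set" "\<lambda>_. N"] finite_N by simp
  moreover have "{r. leafmove e r} = (\<lambda>g. {twist e g}) ` N \<union> (\<lambda>h. range (\<lambda>x. twist (sub e x) (h x))) ` {h. \<forall>x. h x \<in> N}"
    unfolding leafmove_def by blast
  ultimately show ?thesis using finite_N by simp
qed

lemma finite_edge: "finite {b'. edge b b'}"
proof (cases "basis b")
  case True
  have "{b'. edge b b'} \<subseteq> (\<Union>e\<in>b. (\<lambda>r. b - {e} \<union> r) ` {r. leafmove e r})"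
    by (auto simp: edge_def)
  then show ?thesis by (rule finite_subset) (simp add: basis_finite[OF True] finite_leafmove)
qed (simp add: edge_def)

text \<open>An element is determined by what it does to the charts of \<open>b\<close>, since their
  images cover the space.\<close>

lemma finite_transporter: assumes "basis b" "basis b'" shows "finite {s \<in> H. img s b = b'}"
proof -
  have "inj_on (\<lambda>s. restrict (\<lambda>e. s \<circ> e) b) {s \<in> H. img s b = b'}"
  proof (rule inj_onI)
    fix s s' assume "restrict (\<lambda>e. s \<circ> e) b = restrict (\<lambda>e. s' \<circ> e) b"
    then have eq: "s \<circ> e = s' \<circ> e" if "e \<in> b" for e using that by (metis restrict_apply')
    show "s = s'"
    proof
      fix y
      obtain e w where "e \<in> b" "y = e w" using basis_cover[OF assms(1)] by blast
      then show "s y = s' y" using eq[of e] by (metis comp_apply)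
    qed
  qed
  moreover have "(\<lambda>s. restrict (\<lambda>e. s \<circ> e) b) ` {s \<in> H. img s b = b'} \<subseteq> PiE b (\<lambda>_. b')"
    by (auto simp: img_def)
  moreover have "finite (PiE b (\<lambda>_. b'))" using basis_finite assms by (simp add: finite_PiE)
  ultimately show ?thesis by (rule inj_on_finite)
qed

lemma finite_S: "finite gen_set"
proof -
  have "gen_set \<subseteq> (\<Union>j\<in>{..10}. \<Union>j'\<in>{..10}. \<Union>b'\<in>{b'. edge (std_basis j) b'}. {s \<in> H. img s (std_basis j') = b'})"
    unfolding gen_set_def by auto
  moreover have "finite (\<Union>j\<in>{..10}. \<Union>j'\<in>{..10}. \<Union>b'\<in>{b'. edge (std_basis j) b'}. {s \<in> H. img s (std_basis j') = b'})"
    by (intro finite_UN_I finite_atMost finite_edge finite_transporter[OF basis_B edge_basis(2)]) simp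
  ultimately show ?thesis by (rule finite_subset)
qed

lemma S_H: "s \<in> gen_set \<Longrightarrow> s \<in> H" by (simp add: gen_set_def)

lemma id_S: "id \<in> gen_set"
  unfolding gen_set_def using H_id edge_refl[OF basis_B] by auto

lemma big_M: "Suc (card (std_basis 10)) \<ge> 5 * card (UNIV :: 'x set)"
  using card_B[of 10] two by linarith

text \<open>A chosen group element carrying the representative of the orbit to \<open>b\<close>. It
  is unique only up to the finite stabiliser, an ambiguity that \<open>local_lift\<close>
  corrects.\<close>

definition hb where "hb b = (SOME h. \<exists>j. h \<in> H \<and> b = img h (std_basis j))"
definition ix where "ix b = (SOME j. hb b \<in> H \<and> b = img (hb b) (std_basis j))"

lemma hb: assumes "basis b" shows "hb b \<in> H" "b = img (hb b) (std_basis (ix b))"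
proof -
  have "\<exists>j. hb b \<in> H \<and> b = img (hb b) (std_basis j)"
    unfolding hb_def by (rule someI_ex[of "\<lambda>h. \<exists>j. h \<in> H \<and> b = img h (std_basis j)"]) (rule orbit_rep[OF assms])
  then have "hb b \<in> H \<and> b = img (hb b) (std_basis (ix b))" unfolding ix_def by (rule someI_ex[of "\<lambda>j. hb b \<in> H \<and> b = img (hb b) (std_basis j)"])
  then show "hb b \<in> H" "b = img (hb b) (std_basis (ix b))" by auto
qed

lemma card_ix: "basis b \<Longrightarrow> card b = card (std_basis (ix b))"
  using hb[of b] card_img[of "hb b" "std_basis (ix b)"] by simp

lemma ix_img: "h \<in> H \<Longrightarrow> ix (img h (std_basis j)) = j"
  using card_ix[OF basis_img[OF _ basis_B]] card_img card_B_inj by metis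

lemma ix_le: assumes "basis b" "card b \<le> (card (std_basis 10))" shows "ix b \<le> 10"
proof -
  have "card (std_basis (ix b)) \<le> card (std_basis 10)" using card_ix[OF assms(1)] assms(2) by simp
  then have "ix b * (card (UNIV :: 'x set) - 1) \<le> 10 * (card (UNIV :: 'x set) - 1)" using card_B by simp
  then show ?thesis using two by simp
qed

lemma card_B_le: "j \<le> 10 \<Longrightarrow> card (std_basis j) \<le> (card (std_basis 10))"
  unfolding card_B by (simp add: mult_le_mono1)

text \<open>Moving the edge back by \<open>hb b\<close> makes it start at a representative, the
  shape required in \<open>gen_set\<close>.\<close>

lemma S_of_edge:
  assumes "edge b b'" "card b' \<le> (card (std_basis 10))"
  shows "Hilbert_Choice.inv (hb b) \<circ> hb b' \<in> gen_set"
proof -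
  note bb = edge_basis[OF assms(1)]
  let ?h = "Hilbert_Choice.inv (hb b)"
  have h: "?h \<in> H" by (rule H_inv[OF hb(1)[OF bb(1)]])
  have 1: "img ?h b = std_basis (ix b)"
  proof -
    have "img ?h b = img ?h (img (hb b) (std_basis (ix b)))" using hb(2)[OF bb(1)] by simp
    then show ?thesis by (simp add: img_img H_inv_left[OF hb(1)[OF bb(1)]])
  qed
  have 2: "img ?h b' = img (?h \<circ> hb b') (std_basis (ix b'))"
  proof -
    have "img ?h b' = img ?h (img (hb b') (std_basis (ix b')))" using hb(2)[OF bb(2)] by simp
    then show ?thesis by (simp add: img_img)
  qed
  have "edge (std_basis (ix b)) (img (?h \<circ> hb b') (std_basis (ix b')))" using edge_img[OF h assms(1)] 1 2 by simp
  moreover have "card b \<le> (card (std_basis 10))" using edge_card(1)[OF assms(1)] assms(2) by simp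
  ultimately show ?thesis unfolding gen_set_def using ix_le bb assms(2) H_comp[OF h hb(1)[OF bb(2)]] by blast
qed

lemma inv_comp_cancel: "h \<in> H \<Longrightarrow> h \<circ> (Hilbert_Choice.inv h \<circ> k) = k" "h \<in> H \<Longrightarrow> Hilbert_Choice.inv h \<circ> (h \<circ> k) = k"
  using H_inv_right H_inv_left by (metis comp_assoc id_comp)+

text \<open>These are the finitely many relators in disguise. As \<open>id\<close> is a generator
  with value 0, relations of the form \<open>p \<circ> q = r\<close> are included.\<close>

definition compat :: "(((nat \<Rightarrow> 'x) \<Rightarrow> (nat \<Rightarrow> 'x)) \<Rightarrow> 'k::group_add) \<Rightarrow> bool" where
  "compat t \<longleftrightarrow> t id = 0 \<and> (\<forall>p\<in>gen_set. \<forall>q\<in>gen_set. \<forall>r\<in>gen_set. \<forall>s\<in>gen_set. p \<circ> q = r \<circ> s \<longrightarrow> t p + t q = t r + t s)"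

lemma compatD: "compat t \<Longrightarrow> t id = 0"
  "compat t \<Longrightarrow> p \<in> gen_set \<Longrightarrow> q \<in> gen_set \<Longrightarrow> r \<in> gen_set \<Longrightarrow> s \<in> gen_set \<Longrightarrow> p \<circ> q = r \<circ> s \<Longrightarrow> t p + t q = t r + t s"
  unfolding compat_def by blast+

text \<open>The labels of consecutive edges telescope, so both ways around a square multiply to the
  same element of the group.\<close>

lemma cocycle_of_compat:
  assumes t: "compat t"
  shows "cocycle (card (std_basis 10)) (\<lambda>b b'. t (Hilbert_Choice.inv (hb b) \<circ> hb b'))"
  unfolding cocycle_def
proof (intro conjI allI impI)
  fix b assume "basis b"
  then show "t (Hilbert_Choice.inv (hb b) \<circ> hb b) = 0" using compatD(1)[OF t] H_inv_left[OF hb(1)] by simp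
next
  fix b b1 b2 b3 assume e: "edge b b1" "edge b1 b3" "edge b b2" "edge b2 b3" and m: "card b3 \<le> (card (std_basis 10))"
  have m': "card b1 \<le> (card (std_basis 10))" "card b2 \<le> (card (std_basis 10))" using edge_card(1)[OF e(2)] edge_card(1)[OF e(4)] m by auto
  have "Hilbert_Choice.inv (hb b) \<circ> hb b1 \<circ> (Hilbert_Choice.inv (hb b1) \<circ> hb b3) = Hilbert_Choice.inv (hb b) \<circ> hb b3"
    "Hilbert_Choice.inv (hb b) \<circ> hb b2 \<circ> (Hilbert_Choice.inv (hb b2) \<circ> hb b3) = Hilbert_Choice.inv (hb b) \<circ> hb b3"
    by (simp_all only: comp_assoc inv_comp_cancel[OF hb(1)[OF edge_basis(2)[OF e(1)]]] inv_comp_cancel[OF hb(1)[OF edge_basis(2)[OF e(3)]]])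
  then show "t (Hilbert_Choice.inv (hb b) \<circ> hb b1) + t (Hilbert_Choice.inv (hb b1) \<circ> hb b3) =
     t (Hilbert_Choice.inv (hb b) \<circ> hb b2) + t (Hilbert_Choice.inv (hb b2) \<circ> hb b3)"
    by (intro compatD(2)[OF t] S_of_edge e m m') simp
qed

text \<open>On a finite part of the Cayley graph, \<open>t\<close> is the increment of a function on
  vertices. The potential on bases supplies it once the choice of \<open>hb\<close> is corrected and
  the size of the base point is seen not to matter.\<close>

lemma local_lift:
  fixes t :: "((nat \<Rightarrow> 'x) \<Rightarrow> (nat \<Rightarrow> 'x)) \<Rightarrow> 'k::group_add"
  assumes t: "compat t" and A: "finite A" "A \<subseteq> H"
  shows "\<exists>\<psi>. \<forall>h\<in>A. \<forall>s\<in>gen_set. h \<circ> s \<in> A \<longrightarrow> \<psi> h + t s = \<psi> (h \<circ> s)"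
proof -
  let ?c = "\<lambda>b b'. t (Hilbert_Choice.inv (hb b) \<circ> hb b')"
  let ?B = "(\<lambda>(h, j). img h (std_basis j)) ` (A \<times> {..10})"
  have "finite ?B" using A by simp
  moreover have "basis b" if "b \<in> ?B" for b using that A(2) basis_img[OF _ basis_B] by auto
  ultimately have "\<exists>\<phi>. \<forall>b\<in>?B. \<forall>b'\<in>?B. edge b b' \<longrightarrow> card b' \<le> (card (std_basis 10)) \<longrightarrow> ?c b b' = - \<phi> b + \<phi> b'"
    by (rule local_potential[OF cocycle_of_compat[OF t] big_M])
  then obtain \<phi> where \<phi>: "\<And>b b'. b \<in> ?B \<Longrightarrow> b' \<in> ?B \<Longrightarrow> edge b b' \<Longrightarrow> card b' \<le> (card (std_basis 10)) \<Longrightarrow> ?c b b' = - \<phi> b + \<phi> b'" by blast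
  \<comment> \<open>\<open>\<tau> h j\<close> stabilises \<open>std_basis j\<close> and measures how
    the chosen \<open>hb\<close> differs from \<open>h\<close>; it is a generator because edges are
    reflexive.\<close>
  define \<tau> where "\<tau> h j = Hilbert_Choice.inv (hb (img h (std_basis j))) \<circ> h" for h j
  define \<Psi> where "\<Psi> h j = \<phi> (img h (std_basis j)) + t (\<tau> h j)" for h j
  have hbH: "hb (img h (std_basis j)) \<in> H" if "h \<in> H" for h j by (rule hb(1)[OF basis_img[OF that basis_B]])
  have \<tau>gen_set: "\<tau> h j \<in> gen_set" if h: "h \<in> H" "j \<le> 10" for h j
  proof -
    let ?b = "img h (std_basis j)"
    have "?b = img (hb ?b) (std_basis j)" using hb(2)[OF basis_img[OF h(1) basis_B]] ix_img[OF h(1)] by simp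
    then have "img (Hilbert_Choice.inv (hb ?b)) ?b = img (Hilbert_Choice.inv (hb ?b)) (img (hb ?b) (std_basis j))" by simp
    then have "img (\<tau> h j) (std_basis j) = std_basis j"
      by (simp add: img_img \<tau>_def H_inv_left[OF hbH[OF h(1)]])
    moreover have "\<tau> h j \<in> H" unfolding \<tau>_def by (intro H_comp H_inv hbH h)
    ultimately show ?thesis unfolding gen_set_def using edge_refl[OF basis_B[of j]] h(2)
      by (intro CollectI conjI exI[of _ j]) simp_all
  qed
  have step: "\<Psi> h j + t s = \<Psi> (h \<circ> s) j'"
    if h: "h \<in> A" "h \<circ> s \<in> A" "s \<in> gen_set" and j: "j \<le> 10" "j' \<le> 10" "edge (std_basis j) (img s (std_basis j'))" for h s j j'
  proof -
    let ?b = "img h (std_basis j)" and ?b' = "img (h \<circ> s) (std_basis j')"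
    have hH: "h \<in> H" "h \<circ> s \<in> H" using h A(2) by auto
    have e: "edge ?b ?b'" using edge_img[OF hH(1) j(3)] by (simp add: img_img)
    have cb: "card ?b' \<le> (card (std_basis 10))" using card_img[OF hH(2)] card_B_le[OF j(2)] by simp
    have "?b \<in> ?B" "?b' \<in> ?B" using h j by auto
    then have p: "?c ?b ?b' = - \<phi> ?b + \<phi> ?b'" by (rule \<phi>[OF _ _ e cb])
    \<comment> \<open>Both sides are the inverse of \<open>hb ?b\<close> followed on the right by
      \<open>h \<circ> s\<close>, so a single relation between products of two generators
      suffices.\<close>
    have "\<tau> h j \<circ> s = (Hilbert_Choice.inv (hb ?b) \<circ> hb ?b') \<circ> \<tau> (h \<circ> s) j'"
      unfolding \<tau>_def by (simp only: comp_assoc inv_comp_cancel[OF hbH[OF hH(2)]])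
    then have "t (\<tau> h j) + t s = ?c ?b ?b' + t (\<tau> (h \<circ> s) j')"
      by (intro compatD(2)[OF t] \<tau>gen_set hH j h(3) S_of_edge[OF e cb])
    then show ?thesis unfolding \<Psi>_def p by (simp add: add.assoc)
  qed
  \<comment> \<open>The generator \<open>id\<close> realises the edge from one representative to the
    next, and its value is 0.\<close>
  have const: "\<Psi> h j = \<Psi> h 0" if "h \<in> A" "j \<le> 10" for h j
    using that(2)
  proof (induction j)
    case (Suc j)
    have "\<Psi> h j + t id = \<Psi> (h \<circ> id) (Suc j)"
      by (rule step) (use Suc that(1) id_S edge_B[of j] in \<open>auto simp del: std_basis.simps\<close>)
    then show ?case using Suc compatD(1)[OF t] by simp
  qed simp
  show ?thesis
  proof (intro exI[of _ "\<lambda>h. \<Psi> h 0"] ballI impI)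
    fix h s assume h: "h \<in> A" "s \<in> gen_set" "h \<circ> s \<in> A"
    then obtain j j' where j: "j \<le> 10" "j' \<le> 10" "edge (std_basis j) (img s (std_basis j'))" unfolding gen_set_def by blast
    show "\<Psi> h 0 + t s = \<Psi> (h \<circ> s) 0"
      using step[OF h(1,3,2) j] const[OF h(1) j(1)] const[OF h(3) j(2)] by simp
  qed
qed

section \<open>Relations between generators, and generation\<close>

fun ev :: "(((nat \<Rightarrow> 'x) \<Rightarrow> (nat \<Rightarrow> 'x)) \<times> bool) list \<Rightarrow> (nat \<Rightarrow> 'x) \<Rightarrow> (nat \<Rightarrow> 'x)" where
  "ev [] = id"
| "ev ((s, b) # ps) = (if b then s else Hilbert_Choice.inv s) \<circ> ev ps"

fun tv :: "(((nat \<Rightarrow> 'x) \<Rightarrow> (nat \<Rightarrow> 'x)) \<Rightarrow> 'k::group_add) \<Rightarrow> (((nat \<Rightarrow> 'x) \<Rightarrow> (nat \<Rightarrow> 'x)) \<times> bool) list \<Rightarrow> 'k" where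
  "tv t [] = 0"
| "tv t ((s, b) # ps) = (if b then t s else - t s) + tv t ps"

lemma ev_append: "ev (ps @ qs) = ev ps \<circ> ev qs"
  by (induction ps rule: ev.induct) (simp_all add: comp_assoc)

lemma tv_append: "tv t (ps @ qs) = tv t ps + tv t qs"
  by (induction t ps rule: tv.induct) (simp_all add: add.assoc)

lemma ev_H: "fst ` set ps \<subseteq> gen_set \<Longrightarrow> ev ps \<in> H"
  by (induction ps rule: ev.induct) (auto simp: H_id H_comp H_inv S_H)

text \<open>A relation is a closed walk through the values of its prefixes. Along it
  \<open>tv t\<close> is the increment of \<open>\<psi>\<close>, which vanishes because the walk
  ends where it began; inverse letters run through an edge backwards.\<close>

theorem relation_consequence:
  fixes t :: "((nat \<Rightarrow> 'x) \<Rightarrow> (nat \<Rightarrow> 'x)) \<Rightarrow> 'k::group_add"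
  assumes t: "compat t" and ps: "fst ` set ps \<subseteq> gen_set" "ev ps = id"
  shows "tv t ps = 0"
proof -
  define A where "A = (\<lambda>k. ev (take k ps)) ` {..length ps}"
  have AH: "A \<subseteq> H" unfolding A_def using ev_H ps(1) set_take_subset by fast
  obtain \<psi> where \<psi>: "\<And>h s. h \<in> A \<Longrightarrow> s \<in> gen_set \<Longrightarrow> h \<circ> s \<in> A \<Longrightarrow> \<psi> h + t s = \<psi> (h \<circ> s)"
    using local_lift[OF t _ AH] by (auto simp: A_def)
  have "\<psi> (ev (take k ps)) = \<psi> id + tv t (take k ps)" if "k \<le> length ps" for k
    using that
  proof (induction k)
    case (Suc k)
    obtain s b where sb: "ps ! k = (s, b)" by (cases "ps ! k")
    have tk: "take (Suc k) ps = take k ps @ [(s, b)]" using Suc.prems sb by (simp add: take_Suc_conv_app_nth)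
    have sS: "s \<in> gen_set" using ps(1) sb Suc.prems nth_mem[of k ps] by (force simp: image_iff)
    let ?h = "ev (take k ps)" and ?h' = "ev (take (Suc k) ps)"
    have A: "?h \<in> A" "?h' \<in> A" using Suc.prems by (auto simp: A_def)
    have h': "?h' = ?h \<circ> (if b then s else Hilbert_Choice.inv s)" by (simp add: tk ev_append)
    have IH: "\<psi> ?h = \<psi> id + tv t (take k ps)" by (rule Suc.IH[OF Suc_leD[OF Suc.prems]])
    have "\<psi> ?h' = \<psi> ?h + (if b then t s else - t s)"
    proof (cases b)
      case True
      then show ?thesis using \<psi>[OF A(1) sS] A(2) h' by simp
    next
      case False
      have "?h' \<circ> s = ?h" using False h' H_inv_left[OF S_H[OF sS]] by (simp add: comp_assoc)
      then have "\<psi> ?h' + t s = \<psi> ?h" using \<psi>[OF A(2) sS] A(1) by simp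
      then have "\<psi> ?h' = \<psi> ?h - t s" by (simp add: eq_diff_eq)
      then show ?thesis using False by simp
    qed
    moreover have "tv t (take (Suc k) ps) = tv t (take k ps) + (if b then t s else - t s)"
      by (simp add: tk tv_append)
    ultimately show ?case by (simp only: IH add.assoc)
  qed simp
  from this[of "length ps"] have "\<psi> id + 0 = \<psi> id + tv t ps" using ps(2) by simp
  then show ?thesis by (metis add_left_cancel)
qed

text \<open>\<open>F b\<close> is the left coset of \<open>hb b\<close> modulo the generated
  subgroup. It is constant along edges, hence the same at \<open>{h}\<close> and
  \<open>{id}\<close>, where \<open>hb\<close> equals \<open>h\<close> and
  \<open>id\<close>.\<close>

theorem S_generates:
  assumes "h \<in> H"
  shows "\<exists>ps. fst ` set ps \<subseteq> gen_set \<and> ev ps = h"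
proof -
  define W :: "(((nat \<Rightarrow> 'x) \<Rightarrow> (nat \<Rightarrow> 'x)) \<times> bool) list set" where "W = {ps. fst ` set ps \<subseteq> gen_set}"
  define F where "F b = {hb b \<circ> ev ps | ps. ps \<in> W}" for b
  have "F b = F b'" if e: "edge b b'" "card b' \<le> (card (std_basis 10))" for b b'
  proof -
    define s where "s = Hilbert_Choice.inv (hb b) \<circ> hb b'"
    have s: "s \<in> gen_set" unfolding s_def by (rule S_of_edge[OF e])
    note hH = hb(1)[OF edge_basis(1)[OF e(1)]]
    have eq: "hb b' = hb b \<circ> s" unfolding s_def by (simp only: inv_comp_cancel[OF hH])
    have 1: "hb b' \<circ> ev ps = hb b \<circ> ev ((s, True) # ps)" for ps
      unfolding eq ev.simps if_True comp_assoc ..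
    have 2: "hb b \<circ> ev ps = hb b' \<circ> ev ((s, False) # ps)" for ps
      unfolding eq ev.simps if_False comp_assoc inv_comp_cancel(1)[OF S_H[OF s]] ..
    show ?thesis
    proof
      show "F b \<subseteq> F b'" unfolding F_def
      proof
        fix x assume "x \<in> {hb b \<circ> ev ps |ps. ps \<in> W}"
        then obtain ps where "ps \<in> W" "x = hb b \<circ> ev ps" by blast
        then show "x \<in> {hb b' \<circ> ev ps |ps. ps \<in> W}" using 2[of ps] s
          by (intro CollectI exI[of _ "(s, False) # ps"]) (auto simp: W_def)
      qed
      show "F b' \<subseteq> F b" unfolding F_def
      proof
        fix x assume "x \<in> {hb b' \<circ> ev ps |ps. ps \<in> W}"
        then obtain ps where "ps \<in> W" "x = hb b' \<circ> ev ps" by blast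
        then show "x \<in> {hb b \<circ> ev ps |ps. ps \<in> W}" using 1[of ps] s
          by (intro CollectI exI[of _ "(s, True) # ps"]) (auto simp: W_def)
      qed
    qed
  qed
  then have inv: "invariant (card (std_basis 10)) F" by (simp add: invariant_def)
  have sing: "basis {k}" "card {k} \<le> (card (std_basis 10))" "hb {k} = k" if k: "k \<in> H" for k
  proof -
    show bk: "basis {k}" using k by (simp add: H_def)
    show "card {k} \<le> (card (std_basis 10))" by (simp add: card_B)
    have "{k} = img k (std_basis 0)" by (simp add: img_def)
    then have "ix {k} = 0" using ix_img[OF k, of 0] by simp
    then show "hb {k} = k" using hb(2)[OF bk] by (simp add: img_def)
  qed
  have "F {h} = F {id}" by (rule invariant_constant[OF inv big_M sing(1,2)[OF assms] sing(1,2)[OF H_id]])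
  moreover have "h \<in> F {h}" unfolding F_def sing(3)[OF assms]
    by (intro CollectI exI[of _ "[]"]) (simp add: W_def)
  ultimately obtain ps where "ps \<in> W" "h = hb {id} \<circ> ev ps" unfolding F_def by blast
  then show ?thesis using sing(3)[OF H_id] by (auto simp: W_def)
qed

end

section \<open>Presented groups as groups of bijections\<close>

text \<open>Cocycles take values in a type of class \<open>group_add\<close>, whereas the presented
  group depends on the relators. It acts faithfully by left multiplication, so it embeds in a type
  of bijections that does not.\<close>

typedef 'a bijection = "{f :: 'a \<Rightarrow> 'a. bij f}"
  by (rule exI[of _ id]) simp

instantiation bijection :: (type) group_add
begin

definition zero_bijection where "0 = Abs_bijection id"
definition plus_bijection where "f + g = Abs_bijection (Rep_bijection f \<circ> Rep_bijection g)"
definition uminus_bijection where "- f = Abs_bijection (Hilbert_Choice.inv (Rep_bijection f))"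
definition minus_bijection :: "'a bijection \<Rightarrow> 'a bijection \<Rightarrow> 'a bijection" where "minus_bijection f g = f + - g"

instance
proof
  fix f g h :: "'a bijection"
  have bij: "bij (Rep_bijection k)" for k :: "'a bijection" using Rep_bijection[of k] by simp
  show "f + g + h = f + (g + h)"
    by (simp add: plus_bijection_def Abs_bijection_inverse bij bij_comp comp_assoc)
  show "0 + f = f" "f + 0 = f"
    by (simp_all add: plus_bijection_def zero_bijection_def Abs_bijection_inverse Rep_bijection_inverse)
  show "- f + f = 0"
    by (simp add: plus_bijection_def zero_bijection_def uminus_bijection_def Abs_bijection_inverse bij bij_imp_bij_inv bij_is_inj)
  show "f + - g = f - g" by (simp add: minus_bijection_def)
qed

end

lemma pres_eq_cong: "pres_eq R u v \<Longrightarrow> pres_eq R (p @ u @ q) (p @ v @ q)"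
proof (induction rule: pres_eq.induct)
  case (cancel u i b v)
  then show ?case using pres_eq.cancel[of R "p @ u" i b "v @ q"] by simp
next
  case (rel r u v)
  then show ?case using pres_eq.rel[of r R "p @ u" "v @ q"] by simp
qed (blast intro: pres_eq.intros)+

definition pres_class :: "(nat \<times> bool) list set \<Rightarrow> (nat \<times> bool) list \<Rightarrow> (nat \<times> bool) list set" where
  "pres_class R u = {v. pres_eq R u v}"

lemma pres_class_eq: "pres_class R u = pres_class R v \<longleftrightarrow> pres_eq R u v"
proof
  assume "pres_class R u = pres_class R v"
  then have "v \<in> pres_class R u" by (simp add: pres_class_def pres_eq.refl)
  then show "pres_eq R u v" by (simp add: pres_class_def)
qed (auto simp: pres_class_def intro: pres_eq.trans pres_eq.sym)

text \<open>Left multiplication on the presented group, extended by the identity to all sets of words.\<close>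

definition transl :: "(nat \<times> bool) list set \<Rightarrow> (nat \<times> bool) list \<Rightarrow> (nat \<times> bool) list set \<Rightarrow> (nat \<times> bool) list set" where
  "transl R w C = (if \<exists>u. C = pres_class R u then pres_class R (w @ (SOME u. C = pres_class R u)) else C)"

lemma transl_class: "transl R w (pres_class R u) = pres_class R (w @ u)"
proof -
  have "pres_class R u = pres_class R (SOME u'. pres_class R u = pres_class R u')"
    by (rule someI[of "\<lambda>u'. pres_class R u = pres_class R u'" u]) simp
  then have "pres_eq R (w @ u) (w @ (SOME u'. pres_class R u = pres_class R u'))"
    using pres_eq_cong[of R u _ w "[]"] by (simp add: pres_class_eq)
  then show ?thesis unfolding transl_def using pres_class_eq[of R "w @ u"] by auto
qed

lemma transl_other: "\<nexists>u. C = pres_class R u \<Longrightarrow> transl R w C = C"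
  by (simp add: transl_def)

lemma transl_append: "transl R (w @ w') = transl R w \<circ> transl R w'"
proof
  fix C
  show "transl R (w @ w') C = (transl R w \<circ> transl R w') C"
  proof (cases "\<exists>u. C = pres_class R u")
    case True
    then show ?thesis by (auto simp: transl_class)
  next
    case False
    then show ?thesis by (simp add: transl_other)
  qed
qed

lemma transl_cong: "pres_eq R w w' \<Longrightarrow> transl R w = transl R w'"
proof
  fix C assume w: "pres_eq R w w'"
  show "transl R w C = transl R w' C"
  proof (cases "\<exists>u. C = pres_class R u")
    case True
    then obtain u where "C = pres_class R u" by blast
    then show ?thesis using pres_eq_cong[OF w, of "[]" u] by (simp add: transl_class pres_class_eq)
  next
    case False
    then show ?thesis by (simp add: transl_other)
  qed
qed

lemma transl_Nil: "transl R [] = id"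
proof
  fix C
  show "transl R [] C = id C"
  proof (cases "\<exists>u. C = pres_class R u")
    case True
    then show ?thesis by (auto simp: transl_class)
  next
    case False
    then show ?thesis by (simp add: transl_other)
  qed
qed

lemma transl_cancel: "transl R [(i, b)] \<circ> transl R [(i, \<not> b)] = id"
  using transl_cong[OF pres_eq.cancel[of R "[]" i b "[]"]] transl_append[of R "[(i, b)]" "[(i, \<not> b)]"]
  by (simp add: transl_Nil)

lemma bij_transl: "bij (transl R w)"
proof (induction w)
  case Nil
  show ?case unfolding transl_Nil by (rule bij_id)
next
  case (Cons a w)
  obtain i b where a: "a = (i, b)" by (cases a)
  have "bij (transl R [(i, b)])"
    using o_bij[OF transl_cancel[of R i "\<not> b", simplified] transl_cancel[of R i b]] by simp
  moreover have "transl R (a # w) = transl R [(i, b)] \<circ> transl R w"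
    using transl_append[of R "[a]" w] by (simp only: append.simps a)
  ultimately show ?case using bij_comp[OF Cons.IH] by metis
qed

definition wval :: "(nat \<times> bool) list set \<Rightarrow> (nat \<times> bool) list \<Rightarrow> (nat \<times> bool) list set bijection" where
  "wval R w = Abs_bijection (transl R w)"

lemma wval_append: "wval R (u @ v) = wval R u + wval R v"
  by (simp add: wval_def plus_bijection_def Abs_bijection_inverse bij_transl transl_append)

lemma wval_Nil: "wval R [] = 0"
  by (simp add: wval_def zero_bijection_def transl_Nil)

lemma wval_cong: "pres_eq R u v \<Longrightarrow> wval R u = wval R v"
  by (simp add: wval_def transl_cong)

lemma wval_letter: "wval R [(i, False)] = - wval R [(i, True)]"
proof -
  have "wval R [(i, True)] + wval R [(i, False)] = 0"
    using wval_cong[OF pres_eq.cancel[of R "[]" i True "[]"]] wval_append[of R "[(i, True)]" "[(i, False)]"]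
    by (simp add: wval_Nil)
  then show ?thesis by (metis add_minus_cancel add.right_neutral minus_add_cancel)
qed

lemma wval_relator: "r \<in> R \<Longrightarrow> wval R r = 0"
  using wval_cong[OF pres_eq.rel[of r R "[]" "[]"]] by (simp add: wval_Nil)

text \<open>The action is faithful: \<open>w\<close> sends the class of the empty word to the class
  of \<open>w\<close>.\<close>

lemma wval_zero: assumes "wval R w = 0" shows "pres_eq R w []"
proof -
  have "transl R w = id"
    using assms Abs_bijection_inject[of "transl R w" id] by (simp add: wval_def zero_bijection_def bij_transl)
  then have "transl R w (pres_class R []) = pres_class R []" by simp
  then show ?thesis by (simp add: transl_class pres_class_eq)
qed

section \<open>The finite presentation\<close>

context nucleus_group
begin

section \<open>Topology of the sequence space and identification of \<open>VG G\<close> with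
  \<open>H\<close>\<close>

lemma topspace_Xomega: "topspace (Xomega :: (nat \<Rightarrow> 'x) topology) = UNIV"
  by (simp add: Xomega_def)

lemma openin_cylinder: "openin Xomega (range (conc w) :: (nat \<Rightarrow> 'x) set)"
proof -
  let ?S = "\<lambda>i. if i < length w then {w ! i} else UNIV"
  have "range (conc w) = PiE UNIV ?S"
  proof (intro equalityI subsetI)
    fix \<omega> assume "\<omega> \<in> range (conc w)"
    then show "\<omega> \<in> PiE UNIV ?S" by (auto simp: conc_def)
  next
    fix \<omega> assume a: "\<omega> \<in> PiE UNIV ?S"
    have "\<omega> i \<in> ?S i" for i using a by (rule PiE_mem) simp
    then have "\<omega> i = w ! i" if "i < length w" for i using that by (metis singletonD)
    then have "\<omega> = conc w (\<lambda>n. \<omega> (length w + n))" by (auto simp: conc_def fun_eq_iff)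
    then show "\<omega> \<in> range (conc w)" by (rule range_eqI[where x = "\<lambda>n. \<omega> (length w + n)"])
  qed
  moreover have "finite {i. ?S i \<noteq> topspace (discrete_topology (UNIV :: 'x set))}"
    by (rule finite_subset[of _ "{..<length w}"]) (auto split: if_splits)
  ultimately show ?thesis unfolding Xomega_def by (simp add: openin_PiE_gen)
qed

lemma glocal_continuous:
  assumes "glocal e"
  shows "continuous_map Xomega Xomega e"
proof -
  obtain n where n: "\<forall>w. length w = n \<longrightarrow> gform e w" using assms by (auto simp: glocal_def)
  have "continuous_map Xomega (discrete_topology UNIV) (\<lambda>\<omega>. e \<omega> k)" for k
    unfolding continuous_map_def
  proof (intro conjI allI impI)
    fix U :: "'x set"
    show "openin Xomega {\<omega> \<in> topspace Xomega. e \<omega> k \<in> U}"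
    proof (subst openin_subopen, intro ballI)
      fix \<omega> assume a: "\<omega> \<in> {\<omega> \<in> topspace Xomega. e \<omega> k \<in> U}"
      obtain w \<rho> where w: "length w = n" "\<omega> = conc w \<rho>" using conc_split by blast
      \<comment> \<open>\<open>Suc k\<close> letters after \<open>w\<close> determine the output up
        to position \<open>k\<close>, whatever the length of \<open>u\<close>.\<close>
      obtain w' \<rho>' where w': "length w' = Suc k" "\<rho> = conc w' \<rho>'" using conc_split by blast
      have "gform e w" using n w by blast
      then obtain u g where g: "g \<in> G" "e \<circ> conc w = conc u \<circ> act g" by (rule gformE)
      have val: "e (conc (w @ w') \<sigma>) k = (u @ g w') ! k" for \<sigma>
      proof -
        have "e (conc (w @ w') \<sigma>) = (conc u \<circ> act g) (conc w' \<sigma>)" unfolding g(2)[symmetric] by (simp add: conc_append)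
        also have "\<dots> = conc (u @ g w') (act (sect g w') \<sigma>)" by (simp add: act_conc[OF G_tree_aut[OF g(1)]] conc_append)
        finally show ?thesis using w'(1) tree_aut_length[OF G_tree_aut[OF g(1)], of w'] by (simp add: conc_def)
      qed
      have "\<omega> = conc (w @ w') \<rho>'" using w w' by (simp add: conc_append)
      then have "(u @ g w') ! k \<in> U" "\<omega> \<in> range (conc (w @ w'))" using a val[of \<rho>'] by auto
      moreover from this have "range (conc (w @ w')) \<subseteq> {\<omega> \<in> topspace Xomega. e \<omega> k \<in> U}"
        using val by (auto simp: topspace_Xomega)
      ultimately show "\<exists>T. openin Xomega T \<and> \<omega> \<in> T \<and> T \<subseteq> {\<omega> \<in> topspace Xomega. e \<omega> k \<in> U}"
        using openin_cylinder by (intro exI[of _ "range (conc (w @ w'))"]) simp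
    qed
  qed simp
  then show ?thesis
    by (subst (2) Xomega_def) (simp add: continuous_map_componentwise_UNIV)
qed

lemma prefix_iff: "is_prefix_of_seq v \<omega> \<longleftrightarrow> (\<exists>\<rho>. \<omega> = conc v \<rho>)"
proof
  assume "is_prefix_of_seq v \<omega>"
  then have "\<omega> = conc v (\<lambda>n. \<omega> (length v + n))" by (auto simp: is_prefix_of_seq_def conc_def fun_eq_iff)
  then show "\<exists>\<rho>. \<omega> = conc v \<rho>" by (rule exI[where x = "\<lambda>n. \<omega> (length v + n)"])
qed (auto simp: is_prefix_of_seq_def conc_def)

text \<open>A word as long as the longest element of \<open>A1\<close> extends some element of
  \<open>A1\<close>, and sections carry the local form down to it.\<close>

lemma VG_imp_H: assumes "f \<in> VG G" shows "f \<in> H"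
proof -
  from assms obtain A1 A2 \<alpha> gv where hom: "homeomorphic_map Xomega Xomega f" and A: "complete_antichain A1"
    and gv: "\<And>v. v \<in> A1 \<Longrightarrow> gv v \<in> G" and f: "\<And>v w. v \<in> A1 \<Longrightarrow> f (conc v w) = conc (\<alpha> v) (act (gv v) w)"
    unfolding VG_def by blast
  have inj: "inj f" using homeomorphic_imp_injective_map[OF hom] by (simp add: topspace_Xomega)
  have surj: "surj f" using homeomorphic_imp_surjective_map[OF hom] by (simp add: topspace_Xomega)
  have fin: "finite A1" using A by (simp add: complete_antichain_def)
  define n where "n = Max (insert 0 (length ` A1))"
  have n: "length v \<le> n" if "v \<in> A1" for v unfolding n_def by (rule Max_ge) (use fin that in auto)
  have "glocal f" unfolding glocal_def
  proof (intro exI[of _ n] allI impI)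
    fix w :: "'x list" assume w: "length w = n"
    obtain v where v: "v \<in> A1" "is_prefix_of_seq v (conc w undefined)" using A unfolding complete_antichain_def by blast
    then obtain \<rho> where "conc v \<rho> = conc w undefined" unfolding prefix_iff by metis
    moreover have "length v \<le> length w" using n[OF v(1)] w by simp
    ultimately obtain s where s: "w = v @ s" using conc_comparable by blast
    have "f \<circ> conc w = conc (\<alpha> v @ gv v s) \<circ> act (sect (gv v) s)"
    proof
      fix \<omega>
      show "(f \<circ> conc w) \<omega> = (conc (\<alpha> v @ gv v s) \<circ> act (sect (gv v) s)) \<omega>"
        by (simp add: s conc_append f[OF v(1)] act_conc[OF G_tree_aut[OF gv[OF v(1)]]])
    qed
    then show "gform f w" by (rule gformI[OF G_sect[OF gv[OF v(1)]]])
  qed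
  then show ?thesis by (rule H_I[OF inj surj])
qed

text \<open>A full level serves as \<open>A1\<close>, and the output prefixes form
  \<open>A2\<close>; bijectivity of \<open>f\<close> makes these incomparable and covering.\<close>

lemma H_imp_VG: assumes "f \<in> H" shows "f \<in> VG G"
proof -
  obtain n where n: "\<forall>w. length w = n \<longrightarrow> gform f w" using H_glocal[OF assms] by (auto simp: glocal_def)
  let ?A = "{w :: 'x list. length w = n}"
  have "\<forall>w\<in>?A. \<exists>ug. snd ug \<in> G \<and> f \<circ> conc w = conc (fst ug) \<circ> act (snd ug)"
  proof
    fix w assume "w \<in> ?A"
    then have "gform f w" using n by simp
    then obtain u g where "g \<in> G" "f \<circ> conc w = conc u \<circ> act g" by (rule gformE)
    then show "\<exists>ug. snd ug \<in> G \<and> f \<circ> conc w = conc (fst ug) \<circ> act (snd ug)" by (intro exI[of _ "(u, g)"]) simp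
  qed
  from bchoice[OF this] obtain ug where ug: "\<forall>w\<in>?A. snd (ug w) \<in> G \<and> f \<circ> conc w = conc (fst (ug w)) \<circ> act (snd (ug w))" ..
  define \<alpha> where "\<alpha> w = fst (ug w)" for w
  define gv where "gv w = snd (ug w)" for w
  have gv: "gv w \<in> G" if "w \<in> ?A" for w using ug that by (simp add: gv_def)
  have f: "f (conc w \<omega>) = conc (\<alpha> w) (act (gv w) \<omega>)" if "w \<in> ?A" for w \<omega>
  proof -
    have "f \<circ> conc w = conc (\<alpha> w) \<circ> act (gv w)" using ug that by (simp add: \<alpha>_def gv_def)
    from fun_cong[OF this, of \<omega>] show ?thesis by simp
  qed
  have finA: "finite ?A" using finite_lists_length_eq[of "UNIV :: 'x set" n] by simp
  \<comment> \<open>A common point of two image cylinders has one preimage, which has only one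
    prefix of length \<open>n\<close>.\<close>
  have meet: "v = w" if "v \<in> ?A" "w \<in> ?A" "conc (\<alpha> v) \<rho> = conc (\<alpha> w) \<rho>'" for v w \<rho> \<rho>'
  proof -
    let ?r = "\<lambda>v \<rho>. conc v (act (Hilbert_Choice.inv (gv v)) \<rho>)"
    have "f (?r v \<rho>) = f (?r w \<rho>')" using f[OF that(1)] f[OF that(2)] that(3) act_inv_right[OF gv[OF that(1)]] act_inv_right[OF gv[OF that(2)]] by simp
    then have "?r v \<rho> = ?r w \<rho>'" using H_inj[OF assms] by (simp add: inj_eq)
    then show ?thesis using conc_same_length that(1,2) by (metis mem_Collect_eq)
  qed
  have A1: "complete_antichain ?A"
    unfolding complete_antichain_def
  proof (intro conjI ballI allI impI)
    fix u v :: "'x list" assume "u \<in> ?A" "v \<in> ?A" "word_prefix u v"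
    then show "u = v" by (auto simp: word_prefix_def)
  next
    fix \<omega> :: "nat \<Rightarrow> 'x"
    show "\<exists>v\<in>?A. is_prefix_of_seq v \<omega>" using conc_split[of n \<omega>] by (auto simp: prefix_iff)
  qed (rule finA)
  have inj: "inj_on \<alpha> ?A" by (rule inj_onI) (rule meet, auto)
  have A2: "complete_antichain (\<alpha> ` ?A)"
    unfolding complete_antichain_def
  proof (intro conjI ballI allI impI)
    fix u v assume "u \<in> \<alpha> ` ?A" "v \<in> \<alpha> ` ?A" and p: "word_prefix u v"
    then obtain u' v' where uv: "u' \<in> ?A" "v' \<in> ?A" "u = \<alpha> u'" "v = \<alpha> v'" by auto
    obtain s where "v = u @ s" using p by (auto simp: word_prefix_def)
    then have "conc (\<alpha> u') (conc s undefined) = conc (\<alpha> v') undefined" using uv by (simp add: conc_append)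
    then have "u' = v'" by (rule meet[OF uv(1,2)])
    then show "u = v" using uv by simp
  next
    fix \<omega> :: "nat \<Rightarrow> 'x"
    obtain \<sigma> where s: "\<omega> = f \<sigma>" using H_surj[OF assms] by (metis surjD)
    obtain w \<rho> where w: "length w = n" "\<sigma> = conc w \<rho>" using conc_split by blast
    have "\<omega> = conc (\<alpha> w) (act (gv w) \<rho>)" using f[of w \<rho>] w s by simp
    then have "is_prefix_of_seq (\<alpha> w) \<omega>" unfolding prefix_iff by (rule exI[where x = "act (gv w) \<rho>"])
    then show "\<exists>v\<in>\<alpha> ` ?A. is_prefix_of_seq v \<omega>" using w(1) by (intro bexI[of _ "\<alpha> w"]) auto
  qed (use finA in simp)
  have "homeomorphic_maps Xomega Xomega f (Hilbert_Choice.inv f)"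
    unfolding homeomorphic_maps_def
    using glocal_continuous[OF H_glocal[OF assms]] glocal_continuous[OF H_glocal[OF H_inv[OF assms]]]
      H_inj[OF assms] H_surj[OF assms] by (simp add: surj_f_inv_f)
  then have "homeomorphic_map Xomega Xomega f" by (rule homeomorphic_maps_map[THEN iffD1, THEN conjunct1])
  moreover have "bij_betw \<alpha> ?A (\<alpha> ` ?A)" using inj by (rule inj_on_imp_bij_betw)
  ultimately show ?thesis unfolding VG_def using A1 A2 gv f
    by (intro CollectI conjI exI[of _ ?A] exI[of _ "\<alpha> ` ?A"] exI[of _ \<alpha>] exI[of _ gv] ballI allI) simp_all
qed

lemma VG_eq_H: "VG G = H"
  using VG_imp_H H_imp_VG by (intro equalityI subsetI)

lemma VG_group_simps: "carrier (VG_group G) = H" "mult (VG_group G) = (\<circ>)" "one (VG_group G) = id"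
  by (simp_all add: VG_group_def VG_eq_H)

lemma group_VG: "Group.group (VG_group G)"
proof (rule groupI, unfold VG_group_simps)
  fix x assume "x \<in> H"
  then show "\<exists>y\<in>H. y \<circ> x = id" using H_inv H_inv_left by (intro bexI[of _ "Hilbert_Choice.inv x"])
qed (auto simp: H_comp H_id comp_assoc)

lemma m_inv_VG: "h \<in> H \<Longrightarrow> m_inv (VG_group G) h = Hilbert_Choice.inv h"
  by (rule group.inv_equality[OF group_VG]) (simp_all add: VG_group_simps H_inv H_inv_left)

section \<open>Evaluation of words and the relators\<close>

lemma word_eval_ev:
  assumes "set gens \<subseteq> gen_set" "valid_word (length gens) w"
  shows "word_eval (VG_group G) gens w = ev (map (\<lambda>(i, b). (gens ! i, b)) w)"
  using assms(2)
proof (induction w)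
  case Nil
  then show ?case by (simp add: word_eval_def VG_group_simps)
next
  case (Cons a w)
  obtain i b where a: "a = (i, b)" by (cases a)
  have i: "i < length gens" "valid_word (length gens) w" using Cons.prems by (auto simp: valid_word_def a)
  have "gens ! i \<in> H" using assms(1) i(1) S_H nth_mem by blast
  then show ?case using Cons.IH[OF i(2)] by (simp add: word_eval_def a VG_group_simps m_inv_VG)
qed

theorem finitely_presented_VG: "finitely_presented (VG_group G)"
proof -
  obtain gens where gens: "set gens = gen_set" "distinct gens" using finite_distinct_list[OF finite_S] by blast
  define n where "n = length gens"
  define idx where "idx s = (THE i. i < n \<and> gens ! i = s)" for s
  have idx_nth: "idx (gens ! i) = i" if "i < n" for i
    unfolding idx_def
  proof (rule the_equality)
    fix j assume j: "j < n \<and> gens ! j = gens ! i"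
    show "j = i"
      by (rule nth_eq_iff_index_eq[OF gens(2), THEN iffD1]) (use j that in \<open>simp_all only: n_def\<close>)
  qed (use that in \<open>simp only: simp_thms\<close>)
  have idx: "idx s < n" "gens ! idx s = s" if s: "s \<in> gen_set" for s
  proof -
    have "s \<in> set gens" using s gens(1) by simp
    then obtain i where i: "i < n" "gens ! i = s" unfolding in_set_conv_nth n_def by blast
    then have "idx s = i" using idx_nth[OF i(1)] by simp
    then show "idx s < n" "gens ! idx s = s" using i by simp_all
  qed
  \<comment> \<open>The conditions of \<open>compat\<close> written as words. The right-hand side is
    inverted, so its two letters appear in reverse order.\<close>
  define R where "R = {[(i, True)] | i. i < n \<and> gens ! i = id} \<union>
     {[(i, True), (j, True), (l, False), (k, False)] | i j k l.
        i < n \<and> j < n \<and> k < n \<and> l < n \<and> gens ! i \<circ> gens ! j = gens ! k \<circ> gens ! l}"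
  have R_cases: "(\<exists>i<n. r = [(i, True)] \<and> gens ! i = id) \<or> (\<exists>i<n. \<exists>j<n. \<exists>k<n. \<exists>l<n.
      r = [(i, True), (j, True), (l, False), (k, False)] \<and> gens ! i \<circ> gens ! j = gens ! k \<circ> gens ! l)" if "r \<in> R" for r
    using that unfolding R_def
  proof (elim UnE CollectE exE conjE)
    fix i assume "r = [(i, True)]" "i < n" "gens ! i = id"
    then show ?thesis by (intro disjI1 exI[of _ i] conjI)
  next
    fix i j k l assume "r = [(i, True), (j, True), (l, False), (k, False)]" "i < n" "j < n" "k < n" "l < n"
      "gens ! i \<circ> gens ! j = gens ! k \<circ> gens ! l"
    then show ?thesis by (intro disjI2 exI[of _ i] exI[of _ j] exI[of _ k] exI[of _ l] conjI)
  qed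
  have "R \<subseteq> {w. set w \<subseteq> {..<n} \<times> UNIV \<and> length w \<le> 4}"
  proof
    fix r assume "r \<in> R"
    from R_cases[OF this] show "r \<in> {w. set w \<subseteq> {..<n} \<times> UNIV \<and> length w \<le> 4}" by auto
  qed
  then have finR: "finite R" by (rule finite_subset) (rule finite_lists_length_le, simp)
  have validR: "valid_word n r" if "r \<in> R" for r
    using R_cases[OF that] by (auto simp: valid_word_def)
  \<comment> \<open>A derivation in \<open>pres_eq\<close> may pass through words with indices
    beyond \<open>n\<close>, since cancellation can insert any letter. Giving these letters the
    value \<open>id\<close> keeps evaluation invariant at every step.\<close>
  define L where "L i = (if i < n then gens ! i else id)" for i
  have LS: "L i \<in> gen_set" for i using gens(1) id_S nth_mem by (auto simp: L_def n_def)
  define ev' where "ev' w = ev (map (\<lambda>(i, b). (L i, b)) w)" for w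
  have ev'_append: "ev' (u @ v) = ev' u \<circ> ev' v" for u v by (simp add: ev'_def ev_append)
  have ev'_R: "ev' r = id" if "r \<in> R" for r
    using R_cases[OF that]
  proof (elim disjE exE conjE)
    fix i assume "i < n" "r = [(i, True)]" "gens ! i = id"
    then show ?thesis by (simp add: ev'_def L_def)
  next
    fix i j k l assume a: "i < n" "j < n" "k < n" "l < n" "r = [(i, True), (j, True), (l, False), (k, False)]"
      "gens ! i \<circ> gens ! j = gens ! k \<circ> gens ! l"
    let ?k = "gens ! k" and ?l = "gens ! l"
    have kl: "?k \<in> H" "?l \<in> H" using LS[of k] LS[of l] a S_H by (auto simp: L_def)
    have "ev' r = (gens ! i \<circ> gens ! j) \<circ> (Hilbert_Choice.inv ?l \<circ> Hilbert_Choice.inv ?k)"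
      using a(1-5) by (simp add: ev'_def L_def comp_assoc)
    also have "\<dots> = ?k \<circ> (?l \<circ> (Hilbert_Choice.inv ?l \<circ> Hilbert_Choice.inv ?k))"
      unfolding a(6) comp_assoc ..
    also have "\<dots> = id" unfolding inv_comp_cancel(1)[OF kl(2)] by (rule H_inv_right[OF kl(1)])
    finally show ?thesis .
  qed
  have ev'_cancel: "ev' [(i, b), (i, \<not> b)] = id" for i b
    using H_inv_left[OF S_H[OF LS[of i]]] H_inv_right[OF S_H[OF LS[of i]]] by (cases b) (simp_all add: ev'_def)
  have sound: "ev' u = ev' v" if "pres_eq R u v" for u v
    using that
  proof (induction rule: pres_eq.induct)
    case (cancel u i b v)
    then show ?case by (simp only: ev'_append ev'_cancel id_comp)
  next
    case (rel r u v)
    then show ?case by (simp only: ev'_append ev'_R id_comp)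
  qed simp_all
  \<comment> \<open>The tautological map into the presented group. For it,
    \<open>relation_consequence\<close> says that a word trivial in the group is trivial modulo the
    relators.\<close>
  define t where "t s = wval R [(idx s, True)]" for s
  have "compat t"
    unfolding compat_def
  proof (intro conjI ballI impI)
    have "[(idx id, True)] \<in> R" unfolding R_def using idx[OF id_S] by blast
    then show "t id = 0" unfolding t_def by (rule wval_relator)
  next
    fix p q r s assume a: "p \<in> gen_set" "q \<in> gen_set" "r \<in> gen_set" "s \<in> gen_set" "p \<circ> q = r \<circ> s"
    have "[(idx p, True), (idx q, True), (idx s, False), (idx r, False)] \<in> R"
      unfolding R_def using idx[OF a(1)] idx[OF a(2)] idx[OF a(3)] idx[OF a(4)] a(5)
      by (intro UnI2 CollectI exI[of _ "idx p"] exI[of _ "idx q"] exI[of _ "idx r"] exI[of _ "idx s"]) simp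
    then have "wval R ([(idx p, True)] @ [(idx q, True)] @ [(idx s, False)] @ [(idx r, False)]) = 0"
      using wval_relator by simp
    then have "t p + (t q + (- t s + - t r)) = 0" by (simp only: wval_append wval_letter t_def)
    then have "(t p + t q) - (t r + t s) = 0"
      by (simp add: add.assoc minus_add diff_conv_add_uminus del: add_uminus_conv_diff)
    then show "t p + t q = t r + t s" by simp
  qed
  note rc = relation_consequence[OF this]
  have tv: "tv t (map (\<lambda>(i, b). (gens ! i, b)) w) = wval R w" if "valid_word n w" for w
    using that
  proof (induction w)
    case Nil
    then show ?case by (simp add: wval_Nil)
  next
    case (Cons a w)
    obtain i b where a: "a = (i, b)" by (cases a)
    have i: "i < n" "valid_word n w" using Cons.prems by (auto simp: valid_word_def a)
    have "(if b then t (gens ! i) else - t (gens ! i)) = wval R [a]"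
      using wval_letter[of R i] by (simp add: t_def idx_nth[OF i(1)] a)
    then show ?case using Cons.IH[OF i(2)] wval_append[of R "[a]" w] by (simp add: a)
  qed
  have in_S: "fst ` set (map (\<lambda>(i, b). (gens ! i, b)) w) \<subseteq> gen_set" if "valid_word n w" for w
    using that gens(1) nth_mem unfolding valid_word_def n_def by fastforce
  have eval: "word_eval (VG_group G) gens w = ev (map (\<lambda>(i, b). (gens ! i, b)) w)" if "valid_word n w" for w
    by (rule word_eval_ev) (use gens(1) that n_def in auto)
  have eval': "word_eval (VG_group G) gens w = ev' w" if "valid_word n w" for w
  proof -
    have "map (\<lambda>(i, b). (gens ! i, b)) w = map (\<lambda>(i, b). (L i, b)) w"
      using that by (auto simp: valid_word_def L_def)
    then show ?thesis unfolding eval[OF that] ev'_def by (rule arg_cong)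
  qed
  show ?thesis unfolding finitely_presented_def
  proof (intro conjI exI[of _ gens] exI[of _ R] ballI allI impI group_VG finR)
    show "set gens \<subseteq> carrier (VG_group G)" using gens(1) S_H by (auto simp: VG_group_simps)
    show "valid_word (length gens) r" if "r \<in> R" for r using validR[OF that] by (simp add: n_def)
    show "\<exists>w. valid_word (length gens) w \<and> word_eval (VG_group G) gens w = h" if "h \<in> carrier (VG_group G)" for h
    proof -
      have "h \<in> H" using that by (simp add: VG_group_simps)
      then obtain ps where ps: "fst ` set ps \<subseteq> gen_set" "ev ps = h" using S_generates by blast
      let ?w = "map (\<lambda>(s, b). (idx s, b)) ps"
      have v: "valid_word n ?w" using ps(1) idx(1) by (fastforce simp: valid_word_def)
      have "map (\<lambda>(i, b). (gens ! i, b)) ?w = ps"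
        unfolding map_map by (rule map_idI) (use ps(1) idx(2) in fastforce)
      then show ?thesis using eval[OF v] v ps(2) by (intro exI[of _ ?w]) (simp add: n_def)
    qed
    fix w assume "valid_word (length gens) w"
    then have w: "valid_word n w" by (simp add: n_def)
    show "word_eval (VG_group G) gens w = \<one>\<^bsub>VG_group G\<^esub> \<longleftrightarrow> pres_eq R w []"
    proof
      assume "word_eval (VG_group G) gens w = \<one>\<^bsub>VG_group G\<^esub>"
      then have "ev (map (\<lambda>(i, b). (gens ! i, b)) w) = id" using eval[OF w] by (simp add: VG_group_simps)
      then have "wval R w = 0" using rc[OF in_S[OF w]] tv[OF w] by simp
      then show "pres_eq R w []" by (rule wval_zero)
    next
      assume "pres_eq R w []"
      then have "ev' w = ev' []" by (rule sound)
      then show "word_eval (VG_group G) gens w = \<one>\<^bsub>VG_group G\<^esub>"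
        using eval'[OF w] by (simp add: VG_group_simps ev'_def)
    qed
  qed
qed

end

section \<open>A nucleus closed under sections and inverses\<close>

lemma sect_inv:
  assumes "self_similar G" "g \<in> G"
  shows "sect (Hilbert_Choice.inv g) v = Hilbert_Choice.inv (sect g (Hilbert_Choice.inv g v))"
proof -
  let ?i = "Hilbert_Choice.inv g"
  have ta: "tree_aut h" if "h \<in> G" for h using assms(1) that by (simp add: self_similar_def)
  have iG: "?i \<in> G" using assms by (simp add: self_similar_def)
  have bij: "bij g" by (rule tree_aut_bij[OF ta[OF assms(2)]])
  have gi: "g (?i u) = u" for u using bij by (simp add: bij_is_surj surj_f_inv_f)
  let ?s = "sect g (?i v)"
  have s: "?s (sect ?i v w) = w" for w
  proof -
    have "v @ w = g (?i v @ sect ?i v w)" using gi[of "v @ w"] tree_aut_append[OF ta[OF iG], of v w] by simp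
    also have "\<dots> = v @ ?s (sect ?i v w)" using tree_aut_append[OF ta[OF assms(2)]] gi by simp
    finally show ?thesis by simp
  qed
  have "bij ?s" by (rule tree_aut_bij[OF ta[OF self_similar_sect[OF assms]]])
  then have "sect ?i v w = Hilbert_Choice.inv ?s w" for w
    using s[of w] by (metis bij_is_inj inv_f_f)
  then show ?thesis by blast
qed

text \<open>Adding all sections keeps the set finite, because sections at long words already belong
  to it. Inverses can then be adjoined, since a section of an inverse is the inverse of a
  section.\<close>

lemma nucleus_exists:
  fixes G :: "('x::finite list \<Rightarrow> 'x list) set"
  assumes two: "card (UNIV :: 'x set) \<ge> 2" and ss: "self_similar G" and con: "contracting G"
  shows "\<exists>N. nucleus_group G N"
proof -
  obtain N0 where N0: "finite N0" "N0 \<subseteq> G" and ab: "\<And>g. g \<in> G \<Longrightarrow> \<exists>n. \<forall>v. length v \<ge> n \<longrightarrow> sect g v \<in> N0"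
    using con unfolding contracting_def by blast
  have ta: "tree_aut h" if "h \<in> G" for h using ss that by (simp add: self_similar_def)
  define N1 where "N1 = (\<Union>g\<in>N0. range (sect g))"
  have "finite (range (sect g))" if g: "g \<in> N0" for g
  proof -
    obtain n where n: "\<forall>v. length v \<ge> n \<longrightarrow> sect g v \<in> N0" using ab[of g] N0(2) g by blast
    have "range (sect g) \<subseteq> N0 \<union> sect g ` {v. set v \<subseteq> UNIV \<and> length v \<le> n}"
    proof
      fix h assume "h \<in> range (sect g)"
      then obtain v where "h = sect g v" by blast
      then show "h \<in> N0 \<union> sect g ` {v. set v \<subseteq> UNIV \<and> length v \<le> n}"
        using n by (cases "length v \<ge> n") auto
    qed
    then show ?thesis using N0(1) finite_lists_length_le[of "UNIV :: 'x set" n] by (auto intro: finite_subset)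
  qed
  then have fin1: "finite N1" using N0(1) by (simp add: N1_def)
  have G1: "N1 \<subseteq> G" using N0(2) self_similar_sect[OF ss] by (auto simp: N1_def)
  have s1: "sect g v \<in> N1" if g: "g \<in> N1" for g v
  proof -
    obtain h u where h: "h \<in> N0" "g = sect h u" using g by (auto simp: N1_def)
    have "sect g v = sect h (u @ v)" unfolding h(2) by (rule sect_append[symmetric])
    then show ?thesis using h(1) by (auto simp: N1_def)
  qed
  have N01: "N0 \<subseteq> N1"
  proof
    fix g assume "g \<in> N0"
    moreover have "g \<in> range (sect g)" using rangeI[of "sect g" "[]"] by (simp only: sect_Nil)
    ultimately show "g \<in> N1" unfolding N1_def by (rule UN_I[where B = "\<lambda>g. range (sect g)"])
  qed
  define N where "N = insert id (N1 \<union> Hilbert_Choice.inv ` N1)"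
  have "nucleus_group G N"
  proof
    show "2 \<le> card (UNIV :: 'x set)" by (rule two)
    show "self_similar G" by (rule ss)
    show "finite N" using fin1 by (simp add: N_def)
    show "N \<subseteq> G" using G1 ss by (auto simp: N_def self_similar_def)
    show "id \<in> N" by (simp add: N_def)
    fix g
    show "Hilbert_Choice.inv g \<in> N" if "g \<in> N"
    proof -
      have "Hilbert_Choice.inv (Hilbert_Choice.inv h) = h" if "h \<in> N1" for h
        using inv_inv_eq[OF tree_aut_bij[OF ta]] that G1 by blast
      then show ?thesis using that by (auto simp: N_def)
    qed
    show "sect g [x] \<in> N" if "g \<in> N" for x
    proof -
      have "sect (Hilbert_Choice.inv h) [x] \<in> N" if h: "h \<in> N1" for h
      proof -
        have "h \<in> G" using G1 h by blast
        then show ?thesis using s1[OF h] by (simp add: sect_inv[OF ss] N_def)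
      qed
      then show ?thesis using that s1 by (auto simp: N_def)
    qed
    show "\<exists>n. \<forall>v. length v \<ge> n \<longrightarrow> sect g v \<in> N" if "g \<in> G"
      using ab[OF that] N01 unfolding N_def by blast
  qed
  then show ?thesis by blast
qed

theorem theorem5p6:
  fixes G :: "('x::finite list \<Rightarrow> 'x list) set"
  assumes "card (UNIV :: 'x set) \<ge> 2"
    and "self_similar G"
    and "contracting G"
  shows "finitely_presented (VG_group G)"
  using nucleus_exists[OF assms] nucleus_group.finitely_presented_VG by blast

end
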